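(* Let $R$ be a noetherian ring, let $F,G$ be finite free $R$-modules of ranks $m,n$, let $\psi:G\to F$ be an $R$-linear map such that the dual map $\psi^*:F^*\to G^*$ is injective, and let $M=\operatorname{Coker}\psi^*$. Put $r=n-m$, $C=\operatorname{Coker}\psi$, let $I_M$ be the ideal generated by the $m$-minors of $\psi$, and assume that $g=\operatorname{grade} I_M=r+1$. Let $\bar\chi:M\to R$ be a linear form with $h=\operatorname{grade}\operatorname{Im}\bar\chi<g$ (i.e. $h\le r$). Then the homology $\bar H_{r-h}$ at $\bigwedge^{r-h}M$ of the truncated Koszul complex $$0\to\bigwedge^rM\to\cdots\to\bigwedge^iM\xrightarrow{\partial_{\bar\chi}}\bigwedge^{i-1}M\to\cdots\to M\xrightarrow{\bar\chi}R\to0$$ is neither $0$ nor isomorphic to a symmetric power $S^j(C)$, $j\ge0$, where $S^0(C)$ is to be read as $R/I_M$.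
   Context: Rings are commutative. ${}^*$ denotes $\operatorname{Hom}_R(-,R)$. For $j\ge1$, $S^j(C)$ is the $j$-th symmetric power of $C$ over $R$; by convention in this statement $S^0(C)=R/I_M$. The grade of an ideal $I\ne R$ is the maximal length of an $R$-regular sequence in $I$, and $\operatorname{grade}R=\infty$. The differential is $\partial_{\bar\chi}(x_1\wedge\dots\wedge x_i)=\sum_{j=1}^i(-1)^{j+1}\bar\chi(x_j)\,x_1\wedge\dots\widehat{x_j}\dots\wedge x_i$. *)

theory Defs
  imports "HOL-Algebra.Algebra" "HOL-Library.Extended_Nat" "HOL-Combinatorics.Permutations"
begin

text \<open>
  Modules are records of \<^theory>\<open>HOL-Algebra.Module\<close>. Such a record extends a ring
  record; its fields \<^const>\<open>monoid.mult\<close> and \<^const>\<open>one\<close> have no meaning for a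
  module and are left unspecified below.
\<close>

section \<open>Linear maps, duals, quotients\<close>

definition self_module :: "('a, 'p) ring_scheme \<Rightarrow> ('a, 'a) module" where
  "self_module R = \<lparr>carrier = carrier R, monoid.mult = monoid.mult R, one = one R,
     ring.zero = ring.zero R, ring.add = ring.add R, module.smult = monoid.mult R\<rparr>"

text \<open>Linear maps are extensional, so that a map is determined by its values on the carrier.\<close>

definition linear_maps ::
  "('a, 'p) ring_scheme \<Rightarrow> ('a, 'b, 'q) module_scheme \<Rightarrow> ('a, 'c, 's) module_scheme \<Rightarrow> ('b \<Rightarrow> 'c) set" where
  "linear_maps R M N = {h \<in> carrier M \<rightarrow>\<^sub>E carrier N.
     (\<forall>x\<in>carrier M. \<forall>y\<in>carrier M. h (x \<oplus>\<^bsub>M\<^esub> y) = h x \<oplus>\<^bsub>N\<^esub> h y) \<and>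
     (\<forall>a\<in>carrier R. \<forall>x\<in>carrier M. h (a \<odot>\<^bsub>M\<^esub> x) = a \<odot>\<^bsub>N\<^esub> h x)}"

definition module_isomorphic ::
  "('a, 'p) ring_scheme \<Rightarrow> ('a, 'b, 'q) module_scheme \<Rightarrow> ('a, 'c, 's) module_scheme \<Rightarrow> bool" where
  "module_isomorphic R M N \<longleftrightarrow> (\<exists>h\<in>linear_maps R M N. bij_betw h (carrier M) (carrier N))"

definition dual_module ::
  "('a, 'p) ring_scheme \<Rightarrow> ('a, 'b, 'q) module_scheme \<Rightarrow> ('a, 'b \<Rightarrow> 'a) module" where
  "dual_module R M = \<lparr>carrier = linear_maps R M (self_module R), monoid.mult = undefined, one = undefined,
     ring.zero = (\<lambda>x\<in>carrier M. \<zero>\<^bsub>R\<^esub>),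
     ring.add = (\<lambda>\<phi> \<theta>. \<lambda>x\<in>carrier M. \<phi> x \<oplus>\<^bsub>R\<^esub> \<theta> x),
     module.smult = (\<lambda>a \<phi>. \<lambda>x\<in>carrier M. a \<otimes>\<^bsub>R\<^esub> \<phi> x)\<rparr>"

text \<open>For \<open>h : M \<rightarrow> N\<close>, the map \<open>N\<^sup>* \<rightarrow> M\<^sup>*\<close> of precomposition with \<open>h\<close>.\<close>

definition dual_map ::
  "('a, 'p) ring_scheme \<Rightarrow> ('a, 'b, 'q) module_scheme \<Rightarrow> ('a, 'c, 's) module_scheme \<Rightarrow>
   ('b \<Rightarrow> 'c) \<Rightarrow> ('c \<Rightarrow> 'a) \<Rightarrow> ('b \<Rightarrow> 'a)" where
  "dual_map R M N h = (\<lambda>\<phi>\<in>carrier (dual_module R N). compose (carrier M) \<phi> h)"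

definition quot_module :: "('a, 'b, 'q) module_scheme \<Rightarrow> 'b set \<Rightarrow> ('a, 'b set) module" where
  "quot_module N K = \<lparr>carrier = a_rcosets\<^bsub>N\<^esub> K, monoid.mult = undefined, one = undefined,
     ring.zero = K, ring.add = set_add N,
     module.smult = (\<lambda>a Y. \<Union>x\<in>Y. K +>\<^bsub>N\<^esub> (a \<odot>\<^bsub>N\<^esub> x))\<rparr>"

definition coker_module ::
  "('a, 'b, 'q) module_scheme \<Rightarrow> ('a, 'c, 's) module_scheme \<Rightarrow> ('b \<Rightarrow> 'c) \<Rightarrow> ('a, 'c set) module" where
  "coker_module M N h = quot_module N (h ` carrier M)"

text \<open>The map into \<open>N / K\<close> induced on cosets by a map \<open>h\<close> into \<open>N\<close> (compatible with the cosets).\<close>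

definition coset_map ::
  "('a, 'c, 's) module_scheme \<Rightarrow> 'c set \<Rightarrow> ('b \<Rightarrow> 'c) \<Rightarrow> 'b set \<Rightarrow> 'c set" where
  "coset_map N K h Y = (\<Union>x\<in>Y. K +>\<^bsub>N\<^esub> h x)"

definition span_module ::
  "('a, 'p) ring_scheme \<Rightarrow> ('a, 'b, 'q) module_scheme \<Rightarrow> 'b set \<Rightarrow> 'b set" where
  "span_module R N S = \<Inter>{K. submodule K R N \<and> S \<subseteq> K}"


section \<open>Finite free modules and minors\<close>

definition is_basis ::
  "('a, 'p) ring_scheme \<Rightarrow> ('a, 'b, 'q) module_scheme \<Rightarrow> nat \<Rightarrow> (nat \<Rightarrow> 'b) \<Rightarrow> bool" where
  "is_basis R N k b \<longleftrightarrow> b ` {..<k} \<subseteq> carrier N \<and>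
     (\<forall>x\<in>carrier N. \<exists>!c. c \<in> {..<k} \<rightarrow>\<^sub>E carrier R \<and> x = (\<Oplus>\<^bsub>N\<^esub>i\<in>{..<k}. c i \<odot>\<^bsub>N\<^esub> b i))"

definition coords ::
  "('a, 'p) ring_scheme \<Rightarrow> ('a, 'b, 'q) module_scheme \<Rightarrow> nat \<Rightarrow> (nat \<Rightarrow> 'b) \<Rightarrow> 'b \<Rightarrow> nat \<Rightarrow> 'a" where
  "coords R N k b x =
     (THE c. c \<in> {..<k} \<rightarrow>\<^sub>E carrier R \<and> x = (\<Oplus>\<^bsub>N\<^esub>i\<in>{..<k}. c i \<odot>\<^bsub>N\<^esub> b i))"

definition leibniz_det :: "('a, 'p) ring_scheme \<Rightarrow> nat \<Rightarrow> (nat \<Rightarrow> nat \<Rightarrow> 'a) \<Rightarrow> 'a" where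
  "leibniz_det R t A = (\<Oplus>\<^bsub>R\<^esub>\<pi>\<in>{\<pi>. \<pi> permutes {..<t}}.
     (if evenperm \<pi> then (\<Otimes>\<^bsub>R\<^esub>i\<in>{..<t}. A i (\<pi> i))
      else \<ominus>\<^bsub>R\<^esub> (\<Otimes>\<^bsub>R\<^esub>i\<in>{..<t}. A i (\<pi> i))))"

text \<open>The ideal generated by the \<open>t\<close>-minors of a \<open>k \<times> l\<close> matrix \<open>A\<close>.\<close>

definition minors_ideal ::
  "('a, 'p) ring_scheme \<Rightarrow> nat \<Rightarrow> nat \<Rightarrow> nat \<Rightarrow> (nat \<Rightarrow> nat \<Rightarrow> 'a) \<Rightarrow> 'a set" where
  "minors_ideal R k l t A = Idl\<^bsub>R\<^esub> {leibniz_det R t (\<lambda>i j. A (\<rho> i) (\<sigma> j)) | \<rho> \<sigma>.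
     strict_mono_on {..<t} \<rho> \<and> \<rho> ` {..<t} \<subseteq> {..<k} \<and>
     strict_mono_on {..<t} \<sigma> \<and> \<sigma> ` {..<t} \<subseteq> {..<l}}"


section \<open>Grade\<close>

definition regular_seq :: "('a, 'p) ring_scheme \<Rightarrow> 'a list \<Rightarrow> bool" where
  "regular_seq R xs \<longleftrightarrow> set xs \<subseteq> carrier R \<and> Idl\<^bsub>R\<^esub> (set xs) \<noteq> carrier R \<and>
     (\<forall>i<length xs. \<forall>a\<in>carrier R.
        xs ! i \<otimes>\<^bsub>R\<^esub> a \<in> Idl\<^bsub>R\<^esub> (set (take i xs)) \<longrightarrow> a \<in> Idl\<^bsub>R\<^esub> (set (take i xs)))"

definition grade :: "('a, 'p) ring_scheme \<Rightarrow> 'a set \<Rightarrow> enat" where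
  "grade R I = (if I = carrier R then \<infinity>
     else Sup {enat (length xs) | xs. regular_seq R xs \<and> set xs \<subseteq> I})"


section \<open>Exterior and symmetric powers\<close>

text \<open>The free module on a set \<open>B\<close>: finitely supported functions, vanishing outside \<open>B\<close>.\<close>

definition free_module :: "('a, 'p) ring_scheme \<Rightarrow> 'b set \<Rightarrow> ('a, 'b \<Rightarrow> 'a) module" where
  "free_module R B = \<lparr>carrier = {f. range f \<subseteq> carrier R \<and>
       finite {x. f x \<noteq> \<zero>\<^bsub>R\<^esub>} \<and> {x. f x \<noteq> \<zero>\<^bsub>R\<^esub>} \<subseteq> B}, monoid.mult = undefined, one = undefined,
     ring.zero = (\<lambda>_. \<zero>\<^bsub>R\<^esub>), ring.add = (\<lambda>f g x. f x \<oplus>\<^bsub>R\<^esub> g x), module.smult = (\<lambda>a f x. a \<otimes>\<^bsub>R\<^esub> f x)\<rparr>"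

definition unit_vec :: "('a, 'p) ring_scheme \<Rightarrow> 'b \<Rightarrow> 'b \<Rightarrow> 'a" where
  "unit_vec R x = (\<lambda>y. if y = x then \<one>\<^bsub>R\<^esub> else \<zero>\<^bsub>R\<^esub>)"

definition tuples :: "('a, 'b, 'q) module_scheme \<Rightarrow> nat \<Rightarrow> 'b list set" where
  "tuples M i = {xs. length xs = i \<and> set xs \<subseteq> carrier M}"

abbreviation free_tuples ::
  "('a, 'p) ring_scheme \<Rightarrow> ('a, 'b, 'q) module_scheme \<Rightarrow> nat \<Rightarrow> ('a, 'b list \<Rightarrow> 'a) module" where
  "free_tuples R M i \<equiv> free_module R (tuples M i)"

definition multilinear_rels ::
  "('a, 'p) ring_scheme \<Rightarrow> ('a, 'b, 'q) module_scheme \<Rightarrow> nat \<Rightarrow> ('b list \<Rightarrow> 'a) set" where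
  "multilinear_rels R M i =
     {unit_vec R (xs[k := x \<oplus>\<^bsub>M\<^esub> y])
        \<ominus>\<^bsub>free_tuples R M i\<^esub> (unit_vec R (xs[k := x]) \<oplus>\<^bsub>free_tuples R M i\<^esub> unit_vec R (xs[k := y]))
      | xs k x y. xs \<in> tuples M i \<and> k < i \<and> x \<in> carrier M \<and> y \<in> carrier M} \<union>
     {unit_vec R (xs[k := a \<odot>\<^bsub>M\<^esub> x])
        \<ominus>\<^bsub>free_tuples R M i\<^esub> (a \<odot>\<^bsub>free_tuples R M i\<^esub> unit_vec R (xs[k := x]))
      | xs k a x. xs \<in> tuples M i \<and> k < i \<and> a \<in> carrier R \<and> x \<in> carrier M}"

definition ext_rels ::
  "('a, 'p) ring_scheme \<Rightarrow> ('a, 'b, 'q) module_scheme \<Rightarrow> nat \<Rightarrow> ('b list \<Rightarrow> 'a) set" where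
  "ext_rels R M i = span_module R (free_tuples R M i)
     (multilinear_rels R M i \<union> {unit_vec R xs | xs. xs \<in> tuples M i \<and> \<not> distinct xs})"

definition sym_rels ::
  "('a, 'p) ring_scheme \<Rightarrow> ('a, 'b, 'q) module_scheme \<Rightarrow> nat \<Rightarrow> ('b list \<Rightarrow> 'a) set" where
  "sym_rels R M i = span_module R (free_tuples R M i)
     (multilinear_rels R M i \<union>
      {unit_vec R xs \<ominus>\<^bsub>free_tuples R M i\<^esub> unit_vec R ys | xs ys. xs \<in> tuples M i \<and> mset ys = mset xs})"

text \<open>The class of \<^term>\<open>unit_vec R [x\<^sub>1, x\<^sub>2, x\<^sub>3]\<close> is \<open>x\<^sub>1 \<and> x\<^sub>2 \<and> x\<^sub>3\<close>, respectively the product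
  \<open>x\<^sub>1 x\<^sub>2 x\<^sub>3\<close> in the symmetric power. Since the only tuple of length \<open>0\<close> is \<^term>\<open>[]\<close> and there
  are no relations in degree \<open>0\<close>, the exterior power of degree \<open>0\<close> is \<open>R\<close>.\<close>

definition ext_power ::
  "('a, 'p) ring_scheme \<Rightarrow> ('a, 'b, 'q) module_scheme \<Rightarrow> nat \<Rightarrow> ('a, ('b list \<Rightarrow> 'a) set) module" where
  "ext_power R M i = quot_module (free_tuples R M i) (ext_rels R M i)"

definition sym_power ::
  "('a, 'p) ring_scheme \<Rightarrow> ('a, 'b, 'q) module_scheme \<Rightarrow> nat \<Rightarrow> ('a, ('b list \<Rightarrow> 'a) set) module" where
  "sym_power R M i = quot_module (free_tuples R M i) (sym_rels R M i)"


section \<open>The truncated Koszul complex\<close>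

definition koszul_on_tuple ::
  "('a, 'p) ring_scheme \<Rightarrow> ('a, 'b, 'q) module_scheme \<Rightarrow> ('b \<Rightarrow> 'a) \<Rightarrow> nat \<Rightarrow> 'b list \<Rightarrow> ('b list \<Rightarrow> 'a)" where
  "koszul_on_tuple R M \<chi> i xs = (\<Oplus>\<^bsub>free_tuples R M (i - 1)\<^esub>j\<in>{..<i}.
     (if even j then \<chi> (xs ! j) else \<ominus>\<^bsub>R\<^esub> \<chi> (xs ! j))
       \<odot>\<^bsub>free_tuples R M (i - 1)\<^esub> unit_vec R (take j xs @ drop (Suc j) xs))"

definition koszul_on_free ::
  "('a, 'p) ring_scheme \<Rightarrow> ('a, 'b, 'q) module_scheme \<Rightarrow> ('b \<Rightarrow> 'a) \<Rightarrow> nat \<Rightarrow> ('b list \<Rightarrow> 'a) \<Rightarrow> ('b list \<Rightarrow> 'a)" where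
  "koszul_on_free R M \<chi> i f = (\<Oplus>\<^bsub>free_tuples R M (i - 1)\<^esub>xs\<in>{xs. f xs \<noteq> \<zero>\<^bsub>R\<^esub>}.
     f xs \<odot>\<^bsub>free_tuples R M (i - 1)\<^esub> koszul_on_tuple R M \<chi> i xs)"

text \<open>The differential from degree \<open>i \<ge> 1\<close> to degree \<open>i - 1\<close>.\<close>

definition koszul_diff ::
  "('a, 'p) ring_scheme \<Rightarrow> ('a, 'b, 'q) module_scheme \<Rightarrow> ('b \<Rightarrow> 'a) \<Rightarrow> nat \<Rightarrow>
   ('b list \<Rightarrow> 'a) set \<Rightarrow> ('b list \<Rightarrow> 'a) set" where
  "koszul_diff R M \<chi> i = coset_map (free_tuples R M (i - 1)) (ext_rels R M (i - 1)) (koszul_on_free R M \<chi> i)"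

text \<open>Cycles, boundaries and homology in degree \<open>i \<le> r\<close> of
  \<open>0 \<rightarrow> \<And>\<^sup>r M \<rightarrow> \<cdots> \<rightarrow> M \<rightarrow> R \<rightarrow> 0\<close>, with \<open>\<And>\<^sup>i M\<close> in degree \<open>i\<close>.\<close>

definition koszul_cycles ::
  "('a, 'p) ring_scheme \<Rightarrow> ('a, 'b, 'q) module_scheme \<Rightarrow> ('b \<Rightarrow> 'a) \<Rightarrow> nat \<Rightarrow> ('b list \<Rightarrow> 'a) set set" where
  "koszul_cycles R M \<chi> i = (if i = 0 then carrier (ext_power R M 0)
     else {Y \<in> carrier (ext_power R M i). koszul_diff R M \<chi> i Y = \<zero>\<^bsub>ext_power R M (i - 1)\<^esub>})"

definition trunc_koszul_boundaries ::
  "('a, 'p) ring_scheme \<Rightarrow> ('a, 'b, 'q) module_scheme \<Rightarrow> ('b \<Rightarrow> 'a) \<Rightarrow> nat \<Rightarrow> nat \<Rightarrow> ('b list \<Rightarrow> 'a) set set" where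
  "trunc_koszul_boundaries R M \<chi> r i =
     (if i < r then koszul_diff R M \<chi> (i + 1) ` carrier (ext_power R M (i + 1))
      else {\<zero>\<^bsub>ext_power R M i\<^esub>})"

definition trunc_koszul_homology ::
  "('a, 'p) ring_scheme \<Rightarrow> ('a, 'b, 'q) module_scheme \<Rightarrow> ('b \<Rightarrow> 'a) \<Rightarrow> nat \<Rightarrow> nat \<Rightarrow>
   ('a, ('b list \<Rightarrow> 'a) set set) module" where
  "trunc_koszul_homology R M \<chi> r i =
     quot_module ((ext_power R M i)\<lparr>carrier := koszul_cycles R M \<chi> i\<rparr>) (trunc_koszul_boundaries R M \<chi> r i)"

end

theory Submission
  imports "Jordan_Normal_Form.Determinant" Defs
begin

text \<open>
  The modules \<open>R/I\<^sub>M\<close> and \<open>S\<^sup>j(C)\<close>, \<open>j \<ge> 1\<close>, are killed by every maximal minor of \<open>\<psi>\<close>, by Cramer's rule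
  (\<open>minor_kills_cokernel\<close>, \<open>sym_power_killed\<close>), and so is the zero module. It therefore suffices to find
  a maximal minor \<open>d\<close> that does not kill the homology \<open>H\<close> in degree \<open>r - h\<close>.

  Let \<open>x\<^sub>1, \<dots>, x\<^sub>h\<close> be a maximal regular sequence in \<open>J = Im \<chi>\<close>. As \<open>R\<close> is noetherian, some \<open>z\<close> outside the
  ideal \<open>(x)\<close> satisfies \<open>J z \<subseteq> (x)\<close> (\<open>maximal_regular_sequence_annihilator\<close>). If some power of each
  maximal minor killed \<open>z\<close> modulo \<open>(x)\<close>, a regular sequence of length \<open>r + 1 > h\<close> in \<open>I\<^sub>M\<close> would do so
  for a multiple of \<open>z\<close> outside \<open>(x)\<close>, which is impossible for a sequence longer than \<open>x\<close>
  (\<open>regular_length_bound\<close>). So there is a maximal minor \<open>d\<close> such that \<open>d\<^sup>N z\<close> is outside \<open>(x)\<close> for all \<open>N\<close>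
  (\<open>large_grade_nonnilpotent_generator\<close>).

  After inverting \<open>d\<close>, the module \<open>M\<close> is free of rank \<open>r\<close>. The Koszul complex of a linear form on a free
  module of rank \<open>r\<close> is depth sensitive: \<open>x\<^sub>1, \<dots>, x\<^sub>h\<close> forces its homology to vanish above degree \<open>r - h\<close>. If
  it vanished in degree \<open>r - h\<close> too, then dividing by \<open>x\<^sub>1, \<dots>, x\<^sub>h\<close> one after the other would show
  that the complex modulo \<open>(x)\<close> has no homology in degree \<open>r\<close>; but there \<open>z\<close> times the product of the basis
  vectors is a cycle, and it is not zero (\<open>koszul_nontorsion\<close>). Rather than localizing, the proof
  replaces vanishing by being killed by a power of \<open>d\<close> (\<open>torsion_homology\<close>) and compares the exterior
  powers of \<open>M\<close> with the explicit Koszul complex by chain maps in both directions whose composition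
  is a power of \<open>d\<close> (\<open>killed_homology_imp_torsion\<close>). These maps exist because a maximal minor \<open>d\<close> yields
  \<open>r\<close> generators of \<open>M\<close> and \<open>r\<close> linear forms on \<open>M\<close> that are dual to each other up to \<open>d\<close>
  (\<open>minor_splitting\<close>).

  The explicit complex lives over a type of class \<open>comm_ring_1\<close> that maps onto the carrier of \<open>R\<close>, and
  the statements about it are relative to an ideal \<open>K\<close>, which starts as the kernel of that map.
\<close>

section \<open>Ideals and regular sequences modulo an ideal\<close>

definition ideal_on :: "'s::comm_ring_1 set \<Rightarrow> bool" where
  "ideal_on K \<longleftrightarrow> 0 \<in> K \<and> (\<forall>x\<in>K. \<forall>y\<in>K. x + y \<in> K) \<and> (\<forall>c. \<forall>x\<in>K. c * x \<in> K)"

lemma ideal_onD: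
  assumes "ideal_on K"
  shows "0 \<in> K" "x \<in> K \<Longrightarrow> y \<in> K \<Longrightarrow> x + y \<in> K" "x \<in> K \<Longrightarrow> c * x \<in> K" "x \<in> K \<Longrightarrow> x * c \<in> K"
    "x \<in> K \<Longrightarrow> - x \<in> K" "x \<in> K \<Longrightarrow> y \<in> K \<Longrightarrow> x - y \<in> K"
proof -
  show 1: "0 \<in> K" and 2: "\<And>x y. x \<in> K \<Longrightarrow> y \<in> K \<Longrightarrow> x + y \<in> K" and 3: "\<And>c x. x \<in> K \<Longrightarrow> c * x \<in> K"
    for x y c using assms unfolding ideal_on_def by auto
  show 4: "x \<in> K \<Longrightarrow> x * c \<in> K" for x c using 3[of x c] by (simp add: mult.commute)
  show 5: "x \<in> K \<Longrightarrow> - x \<in> K" for x using 3[of x "-1"] by simp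
  show "x \<in> K \<Longrightarrow> y \<in> K \<Longrightarrow> x - y \<in> K" for x y using 2[of x "-y"] 5[of y] by simp
qed

lemma ideal_on_sum:
  assumes "ideal_on K" "\<And>x. x \<in> A \<Longrightarrow> f x \<in> K"
  shows "sum f A \<in> K"
  using assms(2) by (induction A rule: infinite_finite_induct) (auto simp: ideal_onD[OF assms(1)])

lemma ideal_on_diff_iff:
  assumes "ideal_on K" "x - y \<in> K"
  shows "x \<in> K \<longleftrightarrow> y \<in> K"
  using ideal_onD(2)[OF assms(1) assms(2), of y] ideal_onD(6)[OF assms(1) _ assms(2), of x] by auto

text \<open>
  The ideal \<open>K + (x)\<close>. Quotient rings never appear: a statement about \<open>R/K\<close> is expressed as one
  about \<open>R\<close> modulo \<open>K\<close>, and passing from \<open>R/K\<close> to \<open>R/(K + (x))\<close> is the step of every induction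
  along a regular sequence.
\<close>

definition add_gen :: "'s::comm_ring_1 set \<Rightarrow> 's \<Rightarrow> 's set" where
  "add_gen K x = {y. \<exists>c. y - c * x \<in> K}"

lemma add_gen_ideal: assumes "ideal_on K" shows "ideal_on (add_gen K x)"
  unfolding ideal_on_def add_gen_def
proof (safe, goal_cases)
  case 1
  show ?case using ideal_onD(1)[OF assms] by (intro exI[of _ 0]) simp
next
  case (2 u v c c')
  then show ?case using ideal_onD(2)[OF assms 2]
    by (intro exI[of _ "c + c'"]) (simp add: algebra_simps)
next
  case (3 c u c')
  then show ?case using ideal_onD(3)[OF assms 3, of c]
    by (intro exI[of _ "c * c'"]) (simp add: algebra_simps)
qed

lemma add_gen_mono: assumes "ideal_on K" shows "K \<subseteq> add_gen K x"
  unfolding add_gen_def by (auto intro!: exI[of _ 0])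

lemma add_gen_mem: assumes "ideal_on K" shows "x \<in> add_gen K x"
  unfolding add_gen_def using ideal_onD(1)[OF assms] by (auto intro!: exI[of _ 1])

lemma add_gen_least:
  assumes "ideal_on L" "K \<subseteq> L" "x \<in> L" shows "add_gen K x \<subseteq> L"
proof
  fix y assume "y \<in> add_gen K x"
  then obtain c where "y - c * x \<in> L" using assms(2) unfolding add_gen_def by auto
  from ideal_onD(2)[OF assms(1) this ideal_onD(3)[OF assms(1,3), of c]] show "y \<in> L" by simp
qed

definition add_gens :: "'s::comm_ring_1 set \<Rightarrow> 's list \<Rightarrow> 's set" where
  "add_gens = foldl add_gen"

lemma add_gens_simps [simp]:
  "add_gens K [] = K" "add_gens K (x # xs) = add_gens (add_gen K x) xs"
  "add_gens K (xs @ [x]) = add_gen (add_gens K xs) x"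
  by (auto simp: add_gens_def)

lemma add_gens_ideal: "ideal_on K \<Longrightarrow> ideal_on (add_gens K xs)"
  by (induction xs arbitrary: K) (auto simp: add_gen_ideal)

lemma add_gens_mono: "ideal_on K \<Longrightarrow> K \<subseteq> add_gens K xs"
  by (induction xs arbitrary: K) (auto, meson add_gen_ideal add_gen_mono subsetD)

lemma add_gens_mem: "ideal_on K \<Longrightarrow> x \<in> set xs \<Longrightarrow> x \<in> add_gens K xs"
proof (induction xs arbitrary: K)
  case (Cons y xs)
  have I: "ideal_on (add_gen K y)" using Cons.prems by (simp add: add_gen_ideal)
  show ?case
  proof (cases "x = y")
    case True
    then show ?thesis using add_gens_mono[OF I, of xs] add_gen_mem[OF Cons.prems(1), of y] by auto
  next
    case False
    then show ?thesis using Cons.IH[OF I] Cons.prems by auto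
  qed
qed simp

lemma add_gens_least:
  assumes "ideal_on L" "K \<subseteq> L" "set xs \<subseteq> L" shows "add_gens K xs \<subseteq> L"
  using assms(2,3)
proof (induction xs arbitrary: K)
  case (Cons x xs)
  then show ?case using add_gen_least[OF assms(1), of K x] by simp
qed simp

fun regular_mod :: "'s::comm_ring_1 set \<Rightarrow> 's list \<Rightarrow> bool" where
  "regular_mod K [] \<longleftrightarrow> True"
| "regular_mod K (x # xs) \<longleftrightarrow> (\<forall>a. x * a \<in> K \<longrightarrow> a \<in> K) \<and> regular_mod (add_gen K x) xs"

lemma regular_mod_snoc:
  "regular_mod K (xs @ [x]) \<longleftrightarrow> regular_mod K xs \<and> (\<forall>a. x * a \<in> add_gens K xs \<longrightarrow> a \<in> add_gens K xs)"
  by (induction xs arbitrary: K) auto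

lemma regular_mod_nth:
  "regular_mod K xs \<longleftrightarrow> (\<forall>i<length xs. \<forall>a. xs ! i * a \<in> add_gens K (take i xs) \<longrightarrow> a \<in> add_gens K (take i xs))"
proof (induction xs rule: rev_induct)
  case (snoc x xs)
  then show ?case unfolding regular_mod_snoc by (auto simp: nth_append less_Suc_eq)
qed simp

section \<open>The Koszul complex of a finite family of ring elements\<close>

text \<open>
  A chain is a function on subsets of \<open>{..<r}\<close>, its value at \<open>S\<close> being the coefficient of the wedge
  product of the basis vectors \<open>e\<^sub>t\<close>, \<open>t \<in> S\<close>, in increasing order. The differential and the left
  multiplications are combinations of the annihilation operators \<open>contr t\<close> and the creation operators
  \<open>wedge1 t\<close>, and all identities follow from the anticommutation relations between these.
\<close>

definition koszul_sign :: "nat \<Rightarrow> nat set \<Rightarrow> 's::comm_ring_1" where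
  "koszul_sign t S = (- 1) ^ card {s \<in> S. s < t}"

definition contr :: "nat \<Rightarrow> (nat set \<Rightarrow> 's) \<Rightarrow> nat set \<Rightarrow> 's::comm_ring_1" where
  "contr t Y S = (if t \<in> S then 0 else koszul_sign t S * Y (insert t S))"

definition wedge1 :: "nat \<Rightarrow> (nat set \<Rightarrow> 's) \<Rightarrow> nat set \<Rightarrow> 's::comm_ring_1" where
  "wedge1 t Y S = (if t \<in> S then koszul_sign t S * Y (S - {t}) else 0)"

definition bd :: "nat \<Rightarrow> (nat \<Rightarrow> 's) \<Rightarrow> (nat set \<Rightarrow> 's) \<Rightarrow> nat set \<Rightarrow> 's::comm_ring_1" where
  "bd r a Y S = (\<Sum>t<r. a t * contr t Y S)"

definition wedge :: "nat \<Rightarrow> (nat \<Rightarrow> 's) \<Rightarrow> (nat set \<Rightarrow> 's) \<Rightarrow> nat set \<Rightarrow> 's::comm_ring_1" where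
  "wedge r u Y S = (\<Sum>t<r. u t * wedge1 t Y S)"

definition koszul_chains :: "nat \<Rightarrow> nat \<Rightarrow> (nat set \<Rightarrow> 's::comm_ring_1) set" where
  "koszul_chains r i = {Y. \<forall>S. Y S \<noteq> 0 \<longrightarrow> S \<subseteq> {..<r} \<and> card S = i}"

lemma koszul_sign_insert:
  assumes "finite S" "s \<notin> S"
  shows "koszul_sign t (insert s S) = (if s < t then - koszul_sign t S else (koszul_sign t S :: 's::comm_ring_1))"
proof -
  have "{x \<in> insert s S. x < t} = (if s < t then insert s {x \<in> S. x < t} else {x \<in> S. x < t})" by auto
  then show ?thesis using assms by (simp add: koszul_sign_def)
qed

lemma koszul_sign_remove:
  assumes "finite S" "s \<in> S"
  shows "koszul_sign t (S - {s}) = (if s < t then - koszul_sign t S else (koszul_sign t S :: 's::comm_ring_1))"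
  using koszul_sign_insert[where ?'s='s, of "S - {s}" s t] assms by (cases "s < t") (simp_all add: insert_absorb)

lemma koszul_sign_sq [simp]: "koszul_sign t S * koszul_sign t S = (1 :: 's::comm_ring_1)"
  by (simp add: koszul_sign_def flip: power_add)

lemma koszul_sign_sq' [simp]: "koszul_sign t S * (koszul_sign t S * x) = (x :: 's::comm_ring_1)"
  by (simp flip: mult.assoc)

lemma contr_contr:
  assumes "finite S" shows "contr s (contr t Y) S = - contr t (contr s Y) S"
proof (cases "s \<in> S \<or> t \<in> S \<or> s = t")
  case True
  then show ?thesis by (auto simp: contr_def)
next
  case False
  then show ?thesis using assms
    by (cases s t rule: linorder_cases) (simp_all add: contr_def koszul_sign_insert insert_commute)
qed

lemma wedge1_wedge1:
  assumes "finite S" shows "wedge1 s (wedge1 t Y) S = - wedge1 t (wedge1 s Y) S"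
proof (cases "s \<notin> S \<or> t \<notin> S \<or> s = t")
  case True
  then show ?thesis by (auto simp: wedge1_def)
next
  case False
  moreover have "S - {t} - {s} = S - {s} - {t}" by auto
  ultimately show ?thesis using assms
    by (cases s t rule: linorder_cases) (simp_all add: wedge1_def koszul_sign_remove)
qed

lemma contr_wedge1:
  assumes "finite S"
  shows "contr s (wedge1 t Y) S = (if s = t then Y S else 0) - wedge1 t (contr s Y) S"
proof (cases "s = t")
  case True
  then show ?thesis using assms
    by (cases "t \<in> S") (simp_all add: contr_def wedge1_def koszul_sign_insert koszul_sign_remove insert_absorb)
next
  case False
  show ?thesis
  proof (cases "s \<in> S \<or> t \<notin> S")
    case True
    then show ?thesis using False by (auto simp: contr_def wedge1_def)
  next
    case st: False
    have eq: "insert s S - {t} = insert s (S - {t})" using False by auto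
    have "contr s (wedge1 t Y) S = koszul_sign s S * koszul_sign t (insert s S) * Y (insert s (S - {t}))"
      using st by (simp add: contr_def wedge1_def eq mult.assoc)
    moreover have "wedge1 t (contr s Y) S = koszul_sign t S * koszul_sign s (S - {t}) * Y (insert s (S - {t}))"
      using st False by (simp add: contr_def wedge1_def mult.assoc)
    moreover have "koszul_sign s S * koszul_sign t (insert s S) = - (koszul_sign t S * koszul_sign s (S - {t}) :: 'a)"
      using st False koszul_sign_insert[where ?'s='a, OF assms, of s t] koszul_sign_remove[where ?'s='a, OF assms, of t s]
      by (cases s t rule: linorder_cases) (simp_all add: mult.commute)
    ultimately show ?thesis using False by simp
  qed
qed

lemma contr_sum: "contr t (\<lambda>S. \<Sum>x\<in>A. f x * Y x S) S = (\<Sum>x\<in>A. f x * contr t (Y x) S)"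
  by (simp add: contr_def sum_distrib_left mult_ac)

lemma wedge1_sum: "wedge1 t (\<lambda>S. \<Sum>x\<in>A. f x * Y x S) S = (\<Sum>x\<in>A. f x * wedge1 t (Y x) S)"
  by (simp add: wedge1_def sum_distrib_left mult_ac)

lemma wedge_sum: "wedge r u (\<lambda>S. \<Sum>x\<in>A. f x * Y x S) S = (\<Sum>x\<in>A. f x * wedge r u (Y x) S)"
  unfolding wedge_def wedge1_sum sum_distrib_left by (subst sum.swap) (simp add: mult_ac)

lemma bd_lin: "bd r a (\<lambda>S. x * Y S - y * Z S) S = x * bd r a Y S - y * bd r a Z S"
  unfolding bd_def sum_distrib_left sum_subtractf[symmetric]
  by (intro sum.cong refl) (simp add: contr_def algebra_simps)

lemma antisym_double_sum:
  fixes f :: "nat \<Rightarrow> nat \<Rightarrow> 's::comm_ring_1"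
  assumes "\<And>s t. s < r \<Longrightarrow> t < r \<Longrightarrow> f s t = - f t s" and "\<And>t. t < r \<Longrightarrow> f t t = 0"
  shows "(\<Sum>s<r. \<Sum>t<r. f s t) = 0"
  using assms
proof (induction r)
  case (Suc r)
  have "(\<Sum>s<Suc r. \<Sum>t<Suc r. f s t) = (\<Sum>s<r. \<Sum>t<r. f s t) + (\<Sum>s<r. f s r + f r s) + f r r"
    by (simp add: sum.distrib)
  also have "(\<Sum>s<r. f s r + f r s) = 0" using Suc.prems(1)[of _ r] by (intro sum.neutral) auto
  also have "(\<Sum>s<r. \<Sum>t<r. f s t) = 0"
    by (rule Suc.IH) (rule Suc.prems; simp)+
  finally show ?case using Suc.prems(2)[of r] by simp
qed simp

lemma bd_bd: assumes "finite S" shows "bd r a (bd r a Y) S = 0"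
proof -
  have "bd r a (bd r a Y) S = (\<Sum>s<r. \<Sum>t<r. a s * a t * contr s (contr t Y) S)"
    unfolding bd_def[of r a "bd r a Y"] unfolding bd_def[of r a Y, abs_def] contr_sum
    by (simp add: sum_distrib_left mult_ac)
  also have "\<dots> = 0"
  proof (rule antisym_double_sum)
    show "a s * a t * contr s (contr t Y) S = - (a t * a s * contr t (contr s Y) S)" for s t
      using contr_contr[OF assms, of s t Y] by (simp add: mult.commute)
  qed (simp add: contr_def)
  finally show ?thesis .
qed

lemma wedge_wedge_self: assumes "finite S" shows "wedge r u (wedge r u Y) S = 0"
proof -
  have "wedge r u (wedge r u Y) S = (\<Sum>s<r. \<Sum>t<r. u s * u t * wedge1 s (wedge1 t Y) S)"
    unfolding wedge_def[of r u "wedge r u Y"] unfolding wedge_def[of r u Y, abs_def] wedge1_sum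
    by (simp add: sum_distrib_left mult_ac)
  also have "\<dots> = 0"
  proof (rule antisym_double_sum)
    show "u s * u t * wedge1 s (wedge1 t Y) S = - (u t * u s * wedge1 t (wedge1 s Y) S)" for s t
      using wedge1_wedge1[OF assms, of s t Y] by (simp add: mult.commute)
  qed (simp add: wedge1_def)
  finally show ?thesis .
qed

text \<open>
  Left multiplication by \<open>u\<close> is a homotopy between \<open>0\<close> and multiplication by the value of the linear
  form at \<open>u\<close>.
\<close>

lemma bd_wedge:
  assumes "finite S"
  shows "bd r a (wedge r u Y) S = (\<Sum>t<r. u t * a t) * Y S - wedge r u (bd r a Y) S"
proof -
  have "bd r a (wedge r u Y) S = (\<Sum>s<r. \<Sum>t<r. a s * u t * contr s (wedge1 t Y) S)"
    unfolding bd_def[of r a "wedge r u Y"] unfolding wedge_def[of r u Y, abs_def] contr_sum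
    by (simp add: sum_distrib_left mult_ac)
  also have "\<dots> = (\<Sum>s<r. \<Sum>t<r. (if s = t then a s * u t * Y S else 0)) - (\<Sum>s<r. \<Sum>t<r. a s * u t * wedge1 t (contr s Y) S)"
    unfolding contr_wedge1[OF assms] sum_subtractf[symmetric]
    by (intro sum.cong refl) (simp add: right_diff_distrib)
  also have "(\<Sum>s<r. \<Sum>t<r. (if s = t then a s * u t * Y S else 0)) = (\<Sum>t<r. u t * a t) * Y S"
    by (simp add: sum_distrib_left sum_distrib_right mult_ac)
  also have "(\<Sum>s<r. \<Sum>t<r. a s * u t * wedge1 t (contr s Y) S) = wedge r u (bd r a Y) S"
    unfolding wedge_def[of r u "bd r a Y"] unfolding bd_def[of r a Y, abs_def] wedge1_sum
    by (subst sum.swap) (simp add: sum_distrib_left mult_ac)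
  finally show ?thesis .
qed

lemma chains_bd: assumes "Y \<in> koszul_chains r (Suc i)" shows "bd r a Y \<in> koszul_chains r i"
  unfolding koszul_chains_def
proof (rule CollectI, intro allI impI)
  fix S assume "bd r a Y S \<noteq> 0"
  then have "\<exists>t<r. contr t Y S \<noteq> 0"
    by (rule contrapos_np) (auto simp: bd_def intro!: sum.neutral)
  then obtain t where t: "t < r" "contr t Y S \<noteq> 0" by blast
  then have *: "t \<notin> S" "Y (insert t S) \<noteq> 0" by (auto simp: contr_def split: if_splits)
  then have "insert t S \<subseteq> {..<r}" "card (insert t S) = Suc i" using assms by (auto simp: koszul_chains_def)
  moreover from this have "finite S" using finite_subset[of "insert t S" "{..<r}"] by simp
  ultimately show "S \<subseteq> {..<r} \<and> card S = i" using *(1) by auto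
qed

lemma bd_zero_chains: assumes "Y \<in> koszul_chains r 0" shows "bd r a Y S = 0"
proof -
  have "Y (insert t S) = 0" for t
    using assms unfolding koszul_chains_def
    by (cases "finite S") (force simp: finite_subset)+
  then show ?thesis unfolding bd_def contr_def by (intro sum.neutral) auto
qed

lemma chains_wedge: assumes "Y \<in> koszul_chains r i" shows "wedge r u Y \<in> koszul_chains r (Suc i)"
  unfolding koszul_chains_def
proof (rule CollectI, intro allI impI)
  fix S assume "wedge r u Y S \<noteq> 0"
  then have "\<exists>t<r. wedge1 t Y S \<noteq> 0"
    by (rule contrapos_np) (auto simp: wedge_def intro!: sum.neutral)
  then obtain t where t: "t < r" "wedge1 t Y S \<noteq> 0" by blast
  then have *: "t \<in> S" "Y (S - {t}) \<noteq> 0" by (auto simp: wedge1_def split: if_splits)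
  then have "S - {t} \<subseteq> {..<r}" "card (S - {t}) = i" using assms by (auto simp: koszul_chains_def)
  moreover from this have "finite S" using finite_subset[of "S - {t}" "{..<r}"] by simp
  ultimately show "S \<subseteq> {..<r} \<and> card S = Suc i"
    using *(1) t(1) card_Suc_Diff1[of S t] by auto
qed

lemma chains_lin: "Y \<in> koszul_chains r i \<Longrightarrow> Z \<in> koszul_chains r i \<Longrightarrow> (\<lambda>S. x * Y S - y * Z S) \<in> koszul_chains r i"
  unfolding koszul_chains_def by clarsimp (metis diff_zero mult_zero_right)

lemma chains_top: assumes "Y \<in> koszul_chains r i" "r < i" shows "Y = (\<lambda>_. 0)"
proof
  fix S show "Y S = 0"
    using assms card_mono[of "{..<r}" S] unfolding koszul_chains_def by fastforce
qed

lemma chains_zero: "(\<lambda>_. 0) \<in> koszul_chains r i" by (simp add: koszul_chains_def)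

lemma chains_finite: "Y \<in> koszul_chains r i \<Longrightarrow> \<not> finite S \<Longrightarrow> Y S = 0"
  unfolding koszul_chains_def by (auto dest: finite_subset)

section \<open>Depth sensitivity up to torsion\<close>

text \<open>
  Homology of the complex modulo \<open>K\<close> that is killed by powers of \<open>d\<close>, that is, homology which
  vanishes once \<open>d\<close> is inverted. The exponent may depend on the cycle.
\<close>

definition torsion_homology :: "'s::comm_ring_1 \<Rightarrow> nat \<Rightarrow> (nat \<Rightarrow> 's) \<Rightarrow> 's set \<Rightarrow> nat \<Rightarrow> bool" where
  "torsion_homology d r a K i \<longleftrightarrow> (\<forall>Y\<in>koszul_chains r i. (\<forall>S. bd r a Y S \<in> K) \<longrightarrow>
     (\<exists>N. \<exists>W\<in>koszul_chains r (Suc i). \<forall>S. d ^ N * Y S - bd r a W S \<in> K))"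

lemma torsion_homologyE:
  assumes "torsion_homology d r a K i" "Y \<in> koszul_chains r i" "\<And>S. bd r a Y S \<in> K"
  obtains N W where "W \<in> koszul_chains r (Suc i)" "\<And>S. d ^ N * Y S - bd r a W S \<in> K"
  using assms unfolding torsion_homology_def by blast

lemma split_add_gen:
  assumes K: "ideal_on K" and Z: "Z \<in> koszul_chains r i" "\<And>S. Z S \<in> add_gen K x"
  obtains V where "V \<in> koszul_chains r i" "\<And>S. Z S - x * V S \<in> K"
proof -
  have "\<exists>v. Z S - x * v \<in> K \<and> (Z S = 0 \<longrightarrow> v = 0)" for S
  proof (cases "Z S = 0")
    case True
    then show ?thesis using ideal_onD(1)[OF K] by auto
  next
    case False
    then show ?thesis using Z(2)[of S] unfolding add_gen_def by (auto simp: mult.commute)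
  qed
  then obtain V where V: "\<And>S. Z S - x * V S \<in> K \<and> (Z S = 0 \<longrightarrow> V S = 0)" by metis
  then have "V \<in> koszul_chains r i" using Z(1) unfolding koszul_chains_def by blast
  with V that show thesis by blast
qed

lemma bd_cong_mod:
  assumes K: "ideal_on K" and "\<And>S. Y S - Z S \<in> K"
  shows "bd r a Y S - bd r a Z S \<in> K"
proof -
  have "bd r a Y S - bd r a Z S = bd r a (\<lambda>S. 1 * Y S - 1 * Z S) S" using bd_lin[of r a 1 Y 1 Z S] by simp
  also have "\<dots> \<in> K" unfolding bd_def
    by (intro ideal_on_sum[OF K] ideal_onD(3)[OF K]) (auto simp: contr_def ideal_onD[OF K] assms(2))
  finally show ?thesis .
qed

lemma wedge_mod:
  assumes K: "ideal_on K" and "\<And>S. Y S \<in> K"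
  shows "wedge r a Y S \<in> K"
  unfolding wedge_def
    by (intro ideal_on_sum[OF K] ideal_onD(3)[OF K]) (auto simp: wedge1_def ideal_onD[OF K] assms(2))

lemma bd_bd_mod: assumes K: "ideal_on K" and Y: "Y \<in> koszul_chains r i" shows "bd r a (bd r a Y) S \<in> K"
proof (cases "finite S")
  case True then show ?thesis using bd_bd ideal_onD(1)[OF K] by metis
next
  case False
  have "contr t (bd r a Y) S = 0" for t
  proof -
    have "contr s Y (insert t S) = 0" for s
      using False chains_finite[OF Y] by (simp add: contr_def)
    then show ?thesis by (simp add: bd_def contr_def[of t])
  qed
  then show ?thesis using ideal_onD(1)[OF K] by (simp add: bd_def[of r a "bd r a Y"])
qed

text \<open>
  Multiplication by \<open>d x\<close> is null-homotopic because \<open>d x\<close> lies in the ideal generated by the \<open>a\<^sub>t\<close>.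
  So, up to powers of \<open>d\<close>, a cycle \<open>Y\<close> modulo \<open>K\<close> satisfies \<open>x Y = \<partial>(u \<and> Y)\<close>; the element \<open>u \<and> Y\<close> is a
  cycle modulo \<open>K + (x)\<close>, hence \<open>\<partial>W + x V\<close>, and \<open>x\<close> can be cancelled from \<open>x Y = x \<partial>V\<close>.
\<close>

lemma torsion_homology_down:
  assumes K: "ideal_on K" and reg: "\<And>b. x * b \<in> K \<Longrightarrow> b \<in> K"
    and x: "d * x - (\<Sum>t<r. u t * a t) \<in> K"
    and T: "torsion_homology d r a (add_gen K x) (Suc i)"
  shows "torsion_homology d r a K i"
  unfolding torsion_homology_def
proof (intro ballI impI)
  fix Y :: "nat set \<Rightarrow> 'a" assume Y: "Y \<in> koszul_chains r i" and cyc: "\<forall>S. bd r a Y S \<in> K"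
  note I = ideal_onD[OF K]
  have UC: "wedge r u Y \<in> koszul_chains r (Suc i)" by (rule chains_wedge[OF Y])
  have hom: "d * x * Y S - bd r a (wedge r u Y) S \<in> K" for S
  proof (cases "finite S")
    case True
    have "d * x * Y S - bd r a (wedge r u Y) S = (d * x - (\<Sum>t<r. u t * a t)) * Y S + wedge r u (bd r a Y) S"
      unfolding bd_wedge[OF True] by (simp add: algebra_simps)
    moreover have "wedge r u (bd r a Y) S \<in> K" by (rule wedge_mod[OF K]) (use cyc in auto)
    ultimately show ?thesis using I(2)[OF I(4)[OF x]] by simp
  next
    case False
    have "bd r a (wedge r u Y) S = 0"
      using chains_finite[OF chains_bd[OF UC] False] .
    then show ?thesis using chains_finite[OF Y False] I(1) by simp
  qed
  have "bd r a (wedge r u Y) S \<in> add_gen K x" for S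
    unfolding add_gen_def using I(5)[OF hom[of S]]
    by (auto intro!: exI[of _ "d * Y S"] simp: mult_ac)
  from torsion_homologyE[OF T UC this]
  obtain N W where W: "W \<in> koszul_chains r (Suc (Suc i))"
    "\<And>S. d ^ N * wedge r u Y S - bd r a W S \<in> add_gen K x" by metis
  have "(\<lambda>S. d ^ N * wedge r u Y S - 1 * bd r a W S) \<in> koszul_chains r (Suc i)"
    by (intro chains_lin UC chains_bd W(1))
  then obtain V where V: "V \<in> koszul_chains r (Suc i)"
    "\<And>S. (d ^ N * wedge r u Y S - 1 * bd r a W S) - x * V S \<in> K"
    using split_add_gen[OF K] W(2) by (smt (verit) mult_1)
  have "d ^ Suc N * Y S - bd r a V S \<in> K" for S
  proof (rule reg)
    define U where "U = (\<lambda>S. d ^ N * wedge r u Y S - 1 * bd r a W S)"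
    have "bd r a U S - bd r a (\<lambda>S. x * V S - 0 * V S) S \<in> K"
      by (rule bd_cong_mod[OF K]) (use V(2) in \<open>simp add: U_def\<close>)
    then have 1: "d ^ N * bd r a (wedge r u Y) S - bd r a (bd r a W) S - x * bd r a V S \<in> K"
      unfolding U_def bd_lin by simp
    have 2: "d ^ N * (d * x * Y S - bd r a (wedge r u Y) S) \<in> K" using I(3)[OF hom] .
    have 3: "bd r a (bd r a W) S \<in> K" by (rule bd_bd_mod[OF K W(1)])
    have "x * (d ^ Suc N * Y S - bd r a V S) =
       (d ^ N * bd r a (wedge r u Y) S - bd r a (bd r a W) S - x * bd r a V S)
       + d ^ N * (d * x * Y S - bd r a (wedge r u Y) S) + bd r a (bd r a W) S"
      by (simp add: algebra_simps)
    then show "x * (d ^ Suc N * Y S - bd r a V S) \<in> K" using 1 2 3 I(2) by metis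
  qed
  then show "\<exists>N. \<exists>W\<in>koszul_chains r (Suc i). \<forall>S. d ^ N * Y S - bd r a W S \<in> K" using V(1) by blast
qed

lemma torsion_homology_up0:
  assumes K: "ideal_on K" and T: "torsion_homology d r a K 0"
  shows "torsion_homology d r a (add_gen K x) 0"
  using T bd_zero_chains ideal_onD(1)[OF K] add_gen_mono[OF K, of x]
  unfolding torsion_homology_def by (metis subsetD)

text \<open>
  If \<open>\<partial>Y = x V\<close> modulo \<open>K\<close>, then \<open>V\<close> is a cycle because \<open>x\<close> is regular. Writing \<open>V = \<partial>W\<close>, up to
  powers of \<open>d\<close>, the chain \<open>Y - x W\<close> is a cycle modulo \<open>K\<close> and therefore a boundary: this is the exactness of the long homology
  sequence of multiplication by \<open>x\<close>.
\<close>

lemma torsion_homology_up: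
  assumes K: "ideal_on K" and reg: "\<And>b. x * b \<in> K \<Longrightarrow> b \<in> K"
    and T: "torsion_homology d r a K i" "torsion_homology d r a K (Suc i)"
  shows "torsion_homology d r a (add_gen K x) (Suc i)"
  unfolding torsion_homology_def
proof (intro ballI impI)
  fix Y :: "nat set \<Rightarrow> 'a" assume Y: "Y \<in> koszul_chains r (Suc i)" and cyc: "\<forall>S. bd r a Y S \<in> add_gen K x"
  note I = ideal_onD[OF K]
  obtain V where V: "V \<in> koszul_chains r i" "\<And>S. bd r a Y S - x * V S \<in> K"
    using split_add_gen[OF K chains_bd[OF Y]] cyc by metis
  have "bd r a V S \<in> K" for S
  proof (rule reg)
    have "bd r a (bd r a Y) S - bd r a (\<lambda>S. x * V S - 0 * V S) S \<in> K"
      by (rule bd_cong_mod[OF K]) (use V(2) in simp)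
    then have "bd r a (bd r a Y) S - x * bd r a V S \<in> K" unfolding bd_lin by simp
    then show "x * bd r a V S \<in> K" using bd_bd_mod[OF K Y] ideal_on_diff_iff[OF K] by blast
  qed
  from torsion_homologyE[OF T(1) V(1) this]
  obtain N W where W: "W \<in> koszul_chains r (Suc i)" "\<And>S. d ^ N * V S - bd r a W S \<in> K" by metis
  define Z where "Z = (\<lambda>S. d ^ N * Y S - x * W S)"
  have Zc: "Z \<in> koszul_chains r (Suc i)" unfolding Z_def by (intro chains_lin Y W(1))
  have "bd r a Z S \<in> K" for S
  proof -
    have "bd r a Z S = d ^ N * (bd r a Y S - x * V S) + x * (d ^ N * V S - bd r a W S)"
      unfolding Z_def bd_lin by (simp add: algebra_simps)
    then show ?thesis using I(2)[OF I(3)[OF V(2)] I(3)[OF W(2)]] by simp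
  qed
  from torsion_homologyE[OF T(2) Zc this]
  obtain N' W' where W': "W' \<in> koszul_chains r (Suc (Suc i))" "\<And>S. d ^ N' * Z S - bd r a W' S \<in> K" by metis
  have "d ^ (N' + N) * Y S - bd r a W' S \<in> add_gen K x" for S
    unfolding add_gen_def using W'(2)[of S]
    by (auto intro!: exI[of _ "d ^ N' * W S"] simp: Z_def algebra_simps power_add)
  then show "\<exists>N. \<exists>W\<in>koszul_chains r (Suc (Suc i)). \<forall>S. d ^ N * Y S - bd r a W S \<in> add_gen K x"
    using W'(1) by blast
qed

lemma torsion_homology_depth_sensitivity:
  assumes "ideal_on K" "regular_mod K xs"
    and "\<And>x. x \<in> set xs \<Longrightarrow> \<exists>u. d * x - (\<Sum>t<r. u t * a t) \<in> K"
    and "r < i + length xs"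
  shows "torsion_homology d r a K i"
  using assms
proof (induction xs arbitrary: K i)
  case Nil
  show ?case
    unfolding torsion_homology_def
  proof (intro ballI impI)
    fix Y :: "nat set \<Rightarrow> 'a" assume "Y \<in> koszul_chains r i"
    then have "Y = (\<lambda>_. 0)" using chains_top Nil.prems(4) by auto
    moreover have "bd r a (\<lambda>_. 0) S = 0" for S
      unfolding bd_def contr_def by (intro sum.neutral) auto
    ultimately show "\<exists>N. \<exists>W\<in>koszul_chains r (Suc i). \<forall>S. d ^ N * Y S - bd r a W S \<in> K"
      using ideal_onD(1)[OF Nil.prems(1)] by (intro exI[of _ 0] bexI[of _ "\<lambda>_. 0"]) (auto simp: chains_zero)
  qed
next
  case (Cons x xs)
  obtain u where u: "d * x - (\<Sum>t<r. u t * a t) \<in> K" using Cons.prems(3) by auto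
  have "torsion_homology d r a (add_gen K x) (Suc i)"
  proof (rule Cons.IH)
    fix y assume "y \<in> set xs"
    then show "\<exists>u. d * y - (\<Sum>t<r. u t * a t) \<in> add_gen K x"
      using Cons.prems(3)[of y] add_gen_mono[OF Cons.prems(1), of x] by auto
  qed (use Cons.prems in \<open>simp_all add: add_gen_ideal\<close>)
  then show ?case using torsion_homology_down[OF Cons.prems(1) _ u] Cons.prems(2) by simp
qed

lemma torsion_homology_push_up:
  assumes "ideal_on K" "regular_mod K xs"
    and "\<And>i. r \<le> i + length xs \<Longrightarrow> torsion_homology d r a K i"
  shows "torsion_homology d r a (add_gens K xs) r"
  using assms
proof (induction xs arbitrary: K)
  case (Cons x xs)
  have "torsion_homology d r a (add_gen K x) i" if "r \<le> i + length xs" for i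
    using torsion_homology_up0[OF Cons.prems(1)] torsion_homology_up[OF Cons.prems(1)] Cons.prems(2,3) that
    by (cases i) auto
  then show ?case using Cons.IH[of "add_gen K x"] Cons.prems by (simp add: add_gen_ideal)
qed simp

text \<open>
  In the top degree \<open>r\<close> there are no boundaries, and \<open>z\<close> times the product of all basis vectors is a
  cycle.
\<close>

lemma torsion_homology_top:
  assumes K: "ideal_on K" and T: "torsion_homology d r a K r" and z: "\<And>t. t < r \<Longrightarrow> z * a t \<in> K"
  shows "\<exists>N. d ^ N * z \<in> K"
proof -
  define Y where "Y = (\<lambda>S. if S = {..<r} then z else 0)"
  have Y: "Y \<in> koszul_chains r r" by (simp add: koszul_chains_def Y_def)
  have "bd r a Y S \<in> K" for S
    unfolding bd_def
  proof (rule ideal_on_sum[OF K])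
    fix t assume "t \<in> {..<r}"
    then have "a t * contr t Y S = (if t \<notin> S \<and> insert t S = {..<r} then koszul_sign t S * (z * a t) else 0)"
      by (auto simp: contr_def Y_def)
    then show "a t * contr t Y S \<in> K" using z[of t] \<open>t \<in> _\<close> ideal_onD[OF K] by auto
  qed
  from torsion_homologyE[OF T Y this] obtain N W where W: "W \<in> koszul_chains r (Suc r)"
    "\<And>S. d ^ N * Y S - bd r a W S \<in> K" by metis
  have "W = (\<lambda>_. 0)" using chains_top[OF W(1)] by simp
  then have "bd r a W {..<r} = 0" unfolding bd_def contr_def by (intro sum.neutral) auto
  then have "d ^ N * z \<in> K" using W(2)[of "{..<r}"] by (simp add: Y_def)
  then show ?thesis ..
qed

text \<open>
  The nonvanishing half of depth sensitivity. If the homology in degree \<open>r - h\<close> were torsion, where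
  \<open>h\<close> is the length of the regular sequence, then it would be torsion in all degrees from \<open>r - h\<close> on;
  going up along the sequence makes the homology modulo the sequence torsion in degree \<open>r\<close>, which
  \<open>z\<close> refutes.
\<close>

lemma koszul_nontorsion:
  assumes K: "ideal_on K" and reg: "regular_mod K xs"
    and gen: "\<And>x. x \<in> set xs \<Longrightarrow> \<exists>u. d * x - (\<Sum>t<r. u t * a t) \<in> K"
    and z: "\<And>t. t < r \<Longrightarrow> z * a t \<in> add_gens K xs" "\<And>N. d ^ N * z \<notin> add_gens K xs"
    and len: "length xs \<le> r"
  shows "\<not> torsion_homology d r a K (r - length xs)"
proof
  assume T: "torsion_homology d r a K (r - length xs)"
  have "torsion_homology d r a K i" if "r \<le> i + length xs" for i
  proof (cases "i = r - length xs")
    case False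
    then have "r < i + length xs" using that len by linarith
    show ?thesis by (rule torsion_homology_depth_sensitivity[OF K reg]) (use gen \<open>r < i + length xs\<close> in auto)
  qed (use T in simp)
  from torsion_homology_top[OF add_gens_ideal[OF K] torsion_homology_push_up[OF K reg this] z(1)] z(2)
  show False by blast
qed

text \<open>
  A regular sequence that is maximal in an ideal has the maximal length. Apply both halves of depth
  sensitivity, with \<open>d = 1\<close>, to the Koszul complex of the concatenation of the two sequences: if \<open>z\<close> were
  not in the ideal of \<open>xs\<close>, then \<open>xs\<close> would yield nonzero homology in a degree where the longer
  sequence \<open>ys\<close> forces it to vanish.
\<close>

lemma regular_length_bound:
  assumes K: "ideal_on K" and xs: "regular_mod K xs" and ys: "regular_mod K ys"
    and len: "length xs < length ys" and z: "\<And>y. y \<in> set ys \<Longrightarrow> z * y \<in> add_gens K xs"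
  shows "z \<in> add_gens K xs"
proof (rule ccontr)
  assume z0: "z \<notin> add_gens K xs"
  define ws where "ws = xs @ ys"
  define r where "r = length ws"
  define a where "a t = ws ! t" for t
  have gen: "\<exists>u. 1 * x - (\<Sum>t<r. u t * a t) \<in> K" if x: "x \<in> set ws" for x
  proof -
    obtain s where s: "s < r" "x = a s" using x by (metis a_def in_set_conv_nth r_def)
    have "(\<Sum>t<r. (if t = s then 1 else 0) * a t) = x"
      using s by (simp add: if_distrib[of "\<lambda>c. c * _"] cong: if_cong)
    then show ?thesis using ideal_onD(1)[OF K] by (intro exI[of _ "\<lambda>t. if t = s then 1 else 0"]) simp
  qed
  have "\<not> torsion_homology 1 r a K (r - length xs)"
  proof (rule koszul_nontorsion[OF K xs])
    fix t assume "t < r"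
    then have "a t \<in> set ws" by (simp add: a_def r_def)
    then consider "a t \<in> set xs" | "a t \<in> set ys" by (auto simp: ws_def)
    then show "z * a t \<in> add_gens K xs"
      using z add_gens_mem[OF K] ideal_onD(3)[OF add_gens_ideal[OF K]] by cases auto
  qed (use z0 gen in \<open>auto simp: ws_def r_def\<close>)
  moreover have "torsion_homology 1 r a K (r - length xs)"
    by (rule torsion_homology_depth_sensitivity[OF K ys]) (use gen len in \<open>auto simp: ws_def r_def\<close>)
  ultimately show False by blast
qed

section \<open>Zero divisors in noetherian rings\<close>

text \<open>
  The maximal condition for the ideals that contain \<open>K\<close>, in other words \<open>R/K\<close> is noetherian.
\<close>

definition noetherian_over :: "'s::comm_ring_1 set \<Rightarrow> bool" where
  "noetherian_over K \<longleftrightarrow> (\<forall>\<A>. \<A> \<noteq> {} \<and> (\<forall>I\<in>\<A>. ideal_on I \<and> K \<subseteq> I) \<longrightarrow>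
     (\<exists>I\<in>\<A>. \<forall>I'\<in>\<A>. I \<subseteq> I' \<longrightarrow> I' = I))"

lemma noetherian_overD:
  assumes "noetherian_over K" "I0 \<in> \<A>" "\<forall>I\<in>\<A>. ideal_on I \<and> K \<subseteq> I"
  shows "\<exists>I. I \<in> \<A> \<and> (\<forall>I'. I' \<in> \<A> \<longrightarrow> I \<subseteq> I' \<longrightarrow> I' = I)"
  using assms unfolding noetherian_over_def by (metis empty_iff)

definition colon :: "'s::comm_ring_1 set \<Rightarrow> 's \<Rightarrow> 's set" where
  "colon K z = {b. b * z \<in> K}"

lemma colon_ideal: assumes "ideal_on K" shows "ideal_on (colon K z)"
  unfolding colon_def ideal_on_def
  using ideal_onD(1)[OF assms] ideal_onD(2)[OF assms] ideal_onD(3)[OF assms]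
  by (simp add: distrib_right mult.assoc)

lemma colon_above: "ideal_on K \<Longrightarrow> K \<subseteq> colon K z"
  unfolding colon_def by (simp add: subset_iff ideal_onD(4))

text \<open>
  An ideal consisting of zero divisors modulo \<open>K\<close> is contained in an associated prime of \<open>K\<close>. Instead of
  first showing that there are finitely many maximal associated primes, one ideal \<open>Z\<close> accumulates
  elements \<open>w\<close> with \<open>K : w\<close> a maximal annihilator, together with some \<open>b \<in> J\<close> that is regular on
  \<open>Z/K\<close>; the last clause of \<open>good\<close> says that a maximal annihilator containing the annihilator of \<open>Z/K\<close>
  contains \<open>K : w\<close> for one of these \<open>w\<close>. If \<open>J\<close> is in no associated prime, a maximal such \<open>Z\<close> could be enlarged, with \<open>b\<close>
  corrected as in prime avoidance.
\<close>

lemma zero_divisors_common_annihilator: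
  assumes N: "noetherian_over K" and K: "ideal_on K" and J: "ideal_on J"
    and zd: "\<And>b. b \<in> J \<Longrightarrow> \<exists>z. z \<notin> K \<and> b * z \<in> K"
  shows "\<exists>z. z \<notin> K \<and> (\<forall>b\<in>J. b * z \<in> K)"
proof (rule ccontr)
  assume neg: "\<not> ?thesis"
  note I = ideal_onD[OF K]
  define maxann where "maxann z \<longleftrightarrow> z \<notin> K \<and> (\<forall>w. w \<notin> K \<longrightarrow> colon K z \<subseteq> colon K w \<longrightarrow> colon K w = colon K z)" for z
  have maxann_ex: "\<exists>w. maxann w \<and> colon K z \<subseteq> colon K w" if zK: "z \<notin> K" for z
  proof -
    let ?A = "{colon K w | w. w \<notin> K \<and> colon K z \<subseteq> colon K w}"
    have A1: "colon K z \<in> ?A" using zK by blast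
    have A2: "\<forall>I\<in>?A. ideal_on I \<and> K \<subseteq> I"
      using colon_ideal[OF K] colon_above[OF K] by (intro ballI, elim CollectE exE conjE) simp
    obtain I where I_mem: "I \<in> ?A" and max: "\<forall>I'. I' \<in> ?A \<longrightarrow> I \<subseteq> I' \<longrightarrow> I' = I"
      using noetherian_overD[OF N A1 A2] by (elim exE conjE)
    from I_mem obtain w where w: "I = colon K w" "w \<notin> K" "colon K z \<subseteq> colon K w" by blast
    have "maxann w" unfolding maxann_def
    proof (intro conjI allI impI)
      show "w \<notin> K" by fact
      fix v assume v: "v \<notin> K" "colon K w \<subseteq> colon K v"
      then have "colon K v \<in> ?A" using w by blast
      then show "colon K v = colon K w" using max v(2) unfolding w(1) by blast
    qed
    with w show ?thesis by blast
  qed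
  have prime: "b \<in> colon K z" if z: "maxann z" and bc: "b * c \<in> colon K z" "c \<notin> colon K z" for z b c
  proof -
    have "c * z \<notin> K" using bc by (simp add: colon_def)
    moreover have "colon K z \<subseteq> colon K (c * z)"
    proof
      fix x assume "x \<in> colon K z"
      then show "x \<in> colon K (c * z)" using I(3)[of "x * z" c] by (simp add: colon_def mult_ac)
    qed
    ultimately have "colon K (c * z) = colon K z" using z unfolding maxann_def by blast
    moreover have "b \<in> colon K (c * z)" using bc by (simp add: colon_def mult_ac)
    ultimately show ?thesis by simp
  qed
  define ann where "ann Z = {t. \<forall>y\<in>Z. t * y \<in> K}" for Z
  define good where "good Z \<longleftrightarrow> ideal_on Z \<and> K \<subseteq> Z \<and> (\<exists>b\<in>J. \<forall>y\<in>Z. b * y \<in> K \<longrightarrow> y \<in> K) \<and>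
     (\<forall>z. maxann z \<longrightarrow> ann Z \<subseteq> colon K z \<longrightarrow> (\<exists>w\<in>Z. maxann w \<and> colon K w \<subseteq> colon K z))" for Z
  have "good K"
    unfolding good_def
  proof (intro conjI allI impI)
    show "\<exists>b\<in>J. \<forall>y\<in>K. b * y \<in> K \<longrightarrow> y \<in> K" using ideal_onD(1)[OF J] by auto
    fix z assume "maxann z" "ann K \<subseteq> colon K z"
    moreover have "1 \<in> ann K" by (simp add: ann_def)
    ultimately show "\<exists>w\<in>K. maxann w \<and> colon K w \<subseteq> colon K z" by (auto simp: colon_def maxann_def)
  qed (use K in auto)
  then have A1: "K \<in> Collect good" by simp
  have A2: "\<forall>I\<in>Collect good. ideal_on I \<and> K \<subseteq> I" by (simp add: good_def)
  obtain Z where "Z \<in> Collect good" and Zm: "\<forall>Z'. Z' \<in> Collect good \<longrightarrow> Z \<subseteq> Z' \<longrightarrow> Z' = Z"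
    using noetherian_overD[OF N A1 A2] by (elim exE conjE)
  then have Z: "good Z" and Zmax: "\<And>Z'. good Z' \<Longrightarrow> Z \<subseteq> Z' \<Longrightarrow> Z' = Z" by blast+
  have Zi: "ideal_on Z" and KZ: "K \<subseteq> Z" using Z unfolding good_def by auto
  obtain b where b: "b \<in> J" "\<And>y. y \<in> Z \<Longrightarrow> b * y \<in> K \<Longrightarrow> y \<in> K" using Z unfolding good_def by auto
  have Zass: "\<exists>w\<in>Z. maxann w \<and> colon K w \<subseteq> colon K z" if "maxann z" "ann Z \<subseteq> colon K z" for z
    using Z that unfolding good_def by auto
  obtain z0 where "z0 \<notin> K" "b * z0 \<in> K" using zd[OF b(1)] by blast
  moreover obtain w where w: "maxann w" "colon K z0 \<subseteq> colon K w" using maxann_ex[OF \<open>z0 \<notin> K\<close>] by blast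
  ultimately have bw: "b * w \<in> K" and wK: "w \<notin> K" by (auto simp: colon_def maxann_def)
  have "\<not> ann Z \<subseteq> colon K w"
  proof
    assume "ann Z \<subseteq> colon K w"
    then obtain v where v: "v \<in> Z" "maxann v" "colon K v \<subseteq> colon K w" using Zass w(1) by blast
    then have "colon K v = colon K w" using wK unfolding maxann_def by blast
    then have "b * v \<in> K" using bw by (auto simp: colon_def)
    then show False using b(2) v unfolding maxann_def by blast
  qed
  \<comment> \<open>The correction \<open>t\<close> annihilates \<open>Z\<close>, so that \<open>b + t\<close> acts on \<open>Z\<close> as \<open>b\<close>, but avoids \<open>K : w\<close>.\<close>
  then obtain t1 where t1: "t1 \<in> ann Z" "t1 \<notin> colon K w" by blast
  obtain t2 where t2: "t2 \<in> J" "t2 \<notin> colon K w" using neg wK unfolding colon_def by blast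
  define t where "t = t1 * t2"
  have tw: "t \<notin> colon K w" using prime[OF w(1), of t1 t2] t1(2) t2(2) unfolding t_def by blast
  have tJ: "t \<in> J" using ideal_onD(3)[OF J t2(1)] by (simp add: t_def)
  have tZ: "t * y \<in> K" if "y \<in> Z" for y
    using t1(1) that I(3)[of "t1 * y" t2] unfolding ann_def t_def by (auto simp: mult_ac)
  have "good (add_gen Z w)"
    unfolding good_def
  proof (intro conjI allI impI)
    show "ideal_on (add_gen Z w)" using add_gen_ideal[OF Zi] .
    show "K \<subseteq> add_gen Z w" using KZ add_gen_mono[OF Zi] by blast
    show "\<exists>b\<in>J. \<forall>y\<in>add_gen Z w. b * y \<in> K \<longrightarrow> y \<in> K"
    proof (intro bexI[of _ "b + t"] ballI impI)
      show "b + t \<in> J" using ideal_onD(2)[OF J b(1) tJ] .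
      fix y assume "y \<in> add_gen Z w" and y: "(b + t) * y \<in> K"
      then obtain c where c: "y - c * w \<in> Z" unfolding add_gen_def by blast
      define z where "z = y - c * w"
      have zZ: "z \<in> Z" using c by (simp add: z_def)
      have eq: "(b + t) * y = (b * z + (t * c) * w) + (t * z + c * (b * w))"
        by (simp add: z_def algebra_simps)
      have "t * z + c * (b * w) \<in> K" using I(2)[OF tZ[OF zZ] I(3)[OF bw]] .
      then have s: "b * z + (t * c) * w \<in> K" using y ideal_on_diff_iff[OF K, of "(b + t) * y" "b * z + (t * c) * w"] eq by simp
      have "c \<in> colon K w"
      proof (rule ccontr)
        assume cw: "c \<notin> colon K w"
        have "b * (b * z) \<in> K"
          using I(6)[OF I(3)[OF s, of b] I(3)[OF bw, of "t * c"]] by (simp add: algebra_simps)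
        then have "b * z \<in> K" using b(2)[OF ideal_onD(3)[OF Zi zZ]] by blast
        from I(6)[OF s this] have "(t * c) * w \<in> K" by simp
        then have "t \<in> colon K w" using prime[OF w(1), of t c] cw by (simp add: colon_def)
        then show False using tw by blast
      qed
      then have cw: "c * w \<in> K" by (simp add: colon_def)
      have "b * z \<in> K" using I(6)[OF s I(3)[OF cw, of t]] by (simp add: mult_ac)
      then have "z \<in> K" using b(2) zZ by blast
      then show "y \<in> K" using I(2)[OF _ cw, of z] by (simp add: z_def)
    qed
    fix z assume z: "maxann z" "ann (add_gen Z w) \<subseteq> colon K z"
    show "\<exists>v\<in>add_gen Z w. maxann v \<and> colon K v \<subseteq> colon K z"
    proof (cases "ann Z \<subseteq> colon K z")
      case True
      then show ?thesis using Zass[OF z(1)] add_gen_mono[OF Zi, of w] by blast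
    next
      case False
      then obtain s where s: "s \<in> ann Z" "s \<notin> colon K z" by blast
      have "colon K w \<subseteq> colon K z"
      proof
        fix e assume e: "e \<in> colon K w"
        have "e * s \<in> ann (add_gen Z w)"
          unfolding ann_def
        proof (rule CollectI, rule ballI)
          fix y assume "y \<in> add_gen Z w"
          then obtain c where c: "y - c * w \<in> Z" unfolding add_gen_def by blast
          have "e * s * y = e * (s * (y - c * w)) + (s * c) * (e * w)" by (simp add: algebra_simps)
          moreover have "s * (y - c * w) \<in> K" using s(1) c unfolding ann_def by blast
          moreover have "e * w \<in> K" using e by (simp add: colon_def)
          ultimately show "e * s * y \<in> K" using I(2,3) by metis
        qed
        then have "e * s \<in> colon K z" using z(2) by blast
        then show "e \<in> colon K z" using prime[OF z(1)] s(2) by blast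
      qed
      then show ?thesis using w(1) add_gen_mem[OF Zi, of w] by blast
    qed
  qed
  then have "add_gen Z w = Z" using Zmax add_gen_mono[OF Zi] by blast
  then have "w \<in> Z" using add_gen_mem[OF Zi, of w] by simp
  then show False using b(2) bw wK by blast
qed

text \<open>
  This is the radical of \<open>K : z\<close>.
\<close>

lemma power_colon_ideal:
  assumes K: "ideal_on K"
  shows "ideal_on {y. \<exists>N. y ^ N * z \<in> K}"
  unfolding ideal_on_def
proof (intro conjI ballI allI)
  note I = ideal_onD[OF K]
  show "0 \<in> {y. \<exists>N. y ^ N * z \<in> K}" using I(1) by (auto intro!: exI[of _ 1])
  fix c x assume "x \<in> {y. \<exists>N. y ^ N * z \<in> K}"
  then show "c * x \<in> {y. \<exists>N. y ^ N * z \<in> K}"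
    using I(3) by (auto simp: power_mult_distrib mult.assoc)
next
  note I = ideal_onD[OF K]
  fix x y assume "x \<in> {y. \<exists>N. y ^ N * z \<in> K}" "y \<in> {y. \<exists>N. y ^ N * z \<in> K}"
  then obtain m n where m: "x ^ m * z \<in> K" and n: "y ^ n * z \<in> K" by auto
  have "(x + y) ^ (m + n) * z = (\<Sum>k\<le>m + n. of_nat ((m + n) choose k) * x ^ k * y ^ (m + n - k) * z)"
    by (simp add: binomial_ring sum_distrib_right)
  also have "\<dots> \<in> K"
  proof (rule ideal_on_sum[OF K])
    fix k assume "k \<in> {..m + n}"
    show "of_nat ((m + n) choose k) * x ^ k * y ^ (m + n - k) * z \<in> K"
    proof (cases "m \<le> k")
      case True
      then have e: "x ^ k = x ^ (k - m) * x ^ m" by (simp flip: power_add)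
      have "of_nat ((m + n) choose k) * x ^ k * y ^ (m + n - k) * z =
          (of_nat ((m + n) choose k) * x ^ (k - m) * y ^ (m + n - k)) * (x ^ m * z)"
        unfolding e by (simp add: mult_ac)
      then show ?thesis using I(3)[OF m] by simp
    next
      case False
      then have e: "m + n - k = n + (m - k)" by simp
      have "of_nat ((m + n) choose k) * x ^ k * y ^ (m + n - k) * z =
          (of_nat ((m + n) choose k) * x ^ k * y ^ (m - k)) * (y ^ n * z)"
        unfolding e power_add by (simp add: mult_ac)
      then show ?thesis using I(3)[OF n] by simp
    qed
  qed
  finally show "x + y \<in> {y. \<exists>N. y ^ N * z \<in> K}" by blast
qed

lemma power_killed_imp_killed:
  assumes K: "ideal_on K" and z: "z \<notin> K" and kill: "\<And>y. y \<in> set ys \<Longrightarrow> \<exists>N. y ^ N * z \<in> K"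
  shows "\<exists>c. c * z \<notin> K \<and> (\<forall>y\<in>set ys. y * (c * z) \<in> K)"
  using z kill
proof (induction ys arbitrary: z)
  case Nil
  then show ?case by (auto intro!: exI[of _ 1])
next
  case (Cons y ys)
  note I = ideal_onD[OF K]
  define N where "N = (LEAST N. y ^ N * z \<in> K)"
  have "\<exists>N. y ^ N * z \<in> K" using Cons.prems by simp
  then have N: "y ^ N * z \<in> K" unfolding N_def by (rule LeastI_ex)
  then obtain M where M: "N = Suc M" using Cons.prems(1) by (cases N) auto
  have nz: "y ^ M * z \<notin> K" using not_less_Least[of M "\<lambda>N. y ^ N * z \<in> K"] M by (simp add: N_def[symmetric])
  have "\<exists>n. x ^ n * (y ^ M * z) \<in> K" if x: "x \<in> set ys" for x
  proof -
    obtain n where "x ^ n * z \<in> K" using Cons.prems(2)[of x] x by auto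
    from I(3)[OF this, of "y ^ M"] show ?thesis by (auto simp: mult_ac)
  qed
  from Cons.IH[OF nz this] obtain c where c: "c * (y ^ M * z) \<notin> K" "\<forall>x\<in>set ys. x * (c * (y ^ M * z)) \<in> K"
    by blast
  have "y * (c * (y ^ M * z)) \<in> K" using I(3)[OF N, of c] by (simp add: M mult_ac)
  with c show ?case by (intro exI[of _ "c * y ^ M"]) (auto simp: mult.assoc)
qed

section \<open>Presenting a commutative ring by a type\<close>

datatype 'a cexp = CVar 'a | CZero | COne | CAdd "'a cexp" "'a cexp" | CMul "'a cexp" "'a cexp" | CNeg "'a cexp"

primrec ceval :: "('a, 'p) ring_scheme \<Rightarrow> 'a cexp \<Rightarrow> 'a" where
  "ceval R (CVar x) = (if x \<in> carrier R then x else \<zero>\<^bsub>R\<^esub>)"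
| "ceval R CZero = \<zero>\<^bsub>R\<^esub>"
| "ceval R COne = \<one>\<^bsub>R\<^esub>"
| "ceval R (CAdd e f) = ceval R e \<oplus>\<^bsub>R\<^esub> ceval R f"
| "ceval R (CMul e f) = ceval R e \<otimes>\<^bsub>R\<^esub> ceval R f"
| "ceval R (CNeg e) = \<ominus>\<^bsub>R\<^esub> ceval R e"

primrec cint :: "'a cexp \<Rightarrow> int" where
  "cint (CVar x) = 0"
| "cint CZero = 0"
| "cint COne = 1"
| "cint (CAdd e f) = cint e + cint f"
| "cint (CMul e f) = cint e * cint f"
| "cint (CNeg e) = - cint e"

lemma ceval_closed: "cring R \<Longrightarrow> ceval R e \<in> carrier R"
proof -
  assume "cring R"
  then interpret cring R .
  show ?thesis by (induction e) auto
qed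

text \<open>
  The arguments below are much shorter for a ring that is a type of class \<open>comm_ring_1\<close> than for a ring
  with a carrier. Every ring on a subset of \<open>'a\<close> is a quotient of the following type: ring expressions
  with variables in \<open>'a\<close>, modulo the equations that hold in all commutative rings on subsets of \<open>'a\<close>. The
  integers are included to keep \<open>0 \<noteq> 1\<close> when \<open>'a\<close> has one element.
\<close>

definition cexp_eq :: "'a cexp \<Rightarrow> 'a cexp \<Rightarrow> bool" where
  "cexp_eq e f \<longleftrightarrow> cint e = cint f \<and> (\<forall>R :: 'a ring. cring R \<longrightarrow> ceval R e = ceval R f)"

lemma (in cring) ceval_laws:
  "ceval R (CMul (CMul e f) g) = ceval R (CMul e (CMul f g))"
  "ceval R (CMul e f) = ceval R (CMul f e)"
  "ceval R (CMul COne e) = ceval R e"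
  "ceval R (CAdd (CAdd e f) g) = ceval R (CAdd e (CAdd f g))"
  "ceval R (CAdd e f) = ceval R (CAdd f e)"
  "ceval R (CAdd CZero e) = ceval R e"
  "ceval R (CAdd (CNeg e) e) = ceval R CZero"
  "ceval R (CMul (CAdd e f) g) = ceval R (CAdd (CMul e g) (CMul f g))"
proof -
  have "ceval R e \<in> carrier R" for e by (rule ceval_closed[OF is_cring])
  then show "ceval R (CMul (CMul e f) g) = ceval R (CMul e (CMul f g))"
    "ceval R (CMul e f) = ceval R (CMul f e)"
    "ceval R (CMul COne e) = ceval R e"
    "ceval R (CAdd (CAdd e f) g) = ceval R (CAdd e (CAdd f g))"
    "ceval R (CAdd e f) = ceval R (CAdd f e)"
    "ceval R (CAdd CZero e) = ceval R e"
    "ceval R (CAdd (CNeg e) e) = ceval R CZero"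
    "ceval R (CMul (CAdd e f) g) = ceval R (CAdd (CMul e g) (CMul f g))"
    by (simp_all add: m_ac a_ac r_neg l_distr r_distr)
qed

quotient_type 'a fcring = "'a cexp" / cexp_eq
  by (rule equivpI) (auto simp: reflp_def symp_def transp_def cexp_eq_def)

instantiation fcring :: (type) comm_ring_1
begin

lift_definition zero_fcring :: "'a fcring" is CZero .
lift_definition one_fcring :: "'a fcring" is COne .
lift_definition plus_fcring :: "'a fcring \<Rightarrow> 'a fcring \<Rightarrow> 'a fcring" is CAdd by (simp add: cexp_eq_def)
lift_definition times_fcring :: "'a fcring \<Rightarrow> 'a fcring \<Rightarrow> 'a fcring" is CMul by (simp add: cexp_eq_def)
lift_definition uminus_fcring :: "'a fcring \<Rightarrow> 'a fcring" is CNeg by (simp add: cexp_eq_def)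
lift_definition minus_fcring :: "'a fcring \<Rightarrow> 'a fcring \<Rightarrow> 'a fcring" is "\<lambda>e f. CAdd e (CNeg f)" by (simp add: cexp_eq_def)

instance
proof
  fix a b c :: "'a fcring"
  show "a * b * c = a * (b * c)"
    by transfer (simp add: cexp_eq_def cring.ceval_laws(1) del: ceval.simps)
  show "a * b = b * a"
    by transfer (simp add: cexp_eq_def cring.ceval_laws(2) del: ceval.simps)
  show "1 * a = a"
    by transfer (simp add: cexp_eq_def cring.ceval_laws(3) del: ceval.simps)
  show "a + b + c = a + (b + c)"
    by transfer (simp add: cexp_eq_def cring.ceval_laws(4) del: ceval.simps)
  show "a + b = b + a"
    by transfer (simp add: cexp_eq_def cring.ceval_laws(5) del: ceval.simps)
  show "0 + a = a"
    by transfer (simp add: cexp_eq_def cring.ceval_laws(6) del: ceval.simps)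
  show "- a + a = 0"
    by transfer (simp add: cexp_eq_def cring.ceval_laws(7) del: ceval.simps)
  show "a - b = a + - b"
    by transfer (simp add: cexp_eq_def)
  show "(a + b) * c = a * c + b * c"
    by transfer (simp add: cexp_eq_def cring.ceval_laws(8) distrib_right del: ceval.simps)
  show "(0::'a fcring) \<noteq> 1"
    by transfer (simp add: cexp_eq_def)
qed

end

lift_definition fcring_var :: "'a \<Rightarrow> 'a fcring" is CVar .
lift_definition fcring_eval :: "'a ring \<Rightarrow> 'a fcring \<Rightarrow> 'a" is "\<lambda>R e. if cring R then ceval R e else undefined"
  by (auto simp: cexp_eq_def)

section \<open>Transfer of ideals, regular sequences and grade\<close>

context cring
begin

text \<open>
  The surjection onto the carrier. The record is rebuilt because the evaluation is only defined for
  rings without additional record fields.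
\<close>

definition ev :: "'a fcring \<Rightarrow> 'a" where
  "ev = fcring_eval \<lparr>carrier = carrier R, monoid.mult = (\<otimes>), one = \<one>, ring.zero = \<zero>, ring.add = (\<oplus>)\<rparr>"

lemma truncated_cring:
  "cring \<lparr>carrier = carrier R, monoid.mult = (\<otimes>), one = \<one>, ring.zero = \<zero>, ring.add = (\<oplus>)\<rparr>"
  by (intro cringI abelian_groupI comm_monoidI)
    (auto simp: a_assoc l_distr m_assoc intro: a_comm m_comm l_neg bexI[of _ "\<ominus> x" for x])

lemma truncated_a_inv:
  assumes "x \<in> carrier R"
  shows "\<ominus>\<^bsub>\<lparr>carrier = carrier R, monoid.mult = (\<otimes>), one = \<one>, ring.zero = \<zero>, ring.add = (\<oplus>)\<rparr>\<^esub> x = \<ominus> x"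
proof -
  interpret T: cring "\<lparr>carrier = carrier R, monoid.mult = (\<otimes>), one = \<one>, ring.zero = \<zero>, ring.add = (\<oplus>)\<rparr>"
    by (rule truncated_cring)
  show ?thesis using assms T.a_inv_closed[of x] T.l_neg[of x] by (simp add: minus_equality)
qed

lemma ev_simps [simp]:
  "ev x \<in> carrier R" "ev 0 = \<zero>" "ev 1 = \<one>" "ev (x + y) = ev x \<oplus> ev y" "ev (x * y) = ev x \<otimes> ev y"
  "ev (- x) = \<ominus> ev x" "ev (x - y) = ev x \<ominus> ev y"
proof -
  show c: "ev x \<in> carrier R" for x
    unfolding ev_def using truncated_cring by transfer (use ceval_closed in fastforce)
  show "ev 0 = \<zero>" "ev 1 = \<one>" "ev (x + y) = ev x \<oplus> ev y" "ev (x * y) = ev x \<otimes> ev y"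
    unfolding ev_def using truncated_cring by (transfer, simp)+
  show m: "ev (- x) = \<ominus> ev x" for x
    unfolding truncated_a_inv[OF c, symmetric] unfolding ev_def using truncated_cring by transfer simp
  have "ev (x + - y) = ev x \<oplus> ev (- y)"
    unfolding ev_def using truncated_cring by transfer simp
  then show "ev (x - y) = ev x \<ominus> ev y" by (simp add: m a_minus_def)
qed

lemma ev_var [simp]: "x \<in> carrier R \<Longrightarrow> ev (fcring_var x) = x"
  unfolding ev_def using truncated_cring by transfer simp

lemma ev_sum: "ev (sum f A) = (\<Oplus>x\<in>A. ev (f x))"
  by (induction A rule: infinite_finite_induct) auto

lemma ev_prod: "ev (prod f A) = (\<Otimes>x\<in>A. ev (f x))"
  by (induction A rule: infinite_finite_induct) auto

definition ker :: "'a fcring set" where "ker = {s. ev s = \<zero>}"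

lemma ker_iff: "s \<in> ker \<longleftrightarrow> ev s = \<zero>" by (simp add: ker_def)

lemma ker_diff_iff: "s - t \<in> ker \<longleftrightarrow> ev s = ev t"
  by (simp add: ker_iff r_right_minus_eq)

lemma ker_ideal: "ideal_on ker"
  unfolding ideal_on_def by (simp add: ker_iff)

lemma pullback_ideal: assumes "ideal I R" shows "ideal_on {s. ev s \<in> I}"
proof -
  interpret ideal I R by fact
  show ?thesis unfolding ideal_on_def by (simp add: I_l_closed)
qed

lemma pushforward_ideal: assumes I: "ideal_on I" shows "ideal (ev ` I) R"
proof (rule idealI[OF ring_axioms])
  note D = ideal_onD[OF I]
  show "subgroup (ev ` I) (add_monoid R)"
  proof (rule add.subgroupI)
    fix x y assume "x \<in> ev ` I" "y \<in> ev ` I"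
    then show "x \<oplus> y \<in> ev ` I" using D(2) by (auto simp flip: ev_simps)
  next
    fix x assume "x \<in> ev ` I"
    then obtain b where b: "b \<in> I" "x = ev b" by auto
    then have "\<ominus> x = ev (- b)" by simp
    then show "\<ominus> x \<in> ev ` I" using D(5)[OF b(1)] by blast
  qed (use D(1) in auto)
  fix x a assume x: "x \<in> carrier R" and "a \<in> ev ` I"
  then obtain b where b: "b \<in> I" "a = ev b" by auto
  have "x \<otimes> a = ev (fcring_var x * b)" "a \<otimes> x = ev (b * fcring_var x)" using x b by auto
  then show "x \<otimes> a \<in> ev ` I" "a \<otimes> x \<in> ev ` I" using D(3,4) b(1) by blast+
qed

lemma pullback_pushforward:
  assumes I: "ideal_on I" and "ker \<subseteq> I" shows "ev s \<in> ev ` I \<longleftrightarrow> s \<in> I"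
proof
  assume "ev s \<in> ev ` I"
  then obtain t where "t \<in> I" "s - t \<in> ker" by (auto simp: ker_diff_iff)
  then show "s \<in> I" using ideal_on_diff_iff[OF I, of s t] assms(2) by auto
qed auto

lemma pullback_genideal: "{s. ev s \<in> Idl (ev ` set xs)} = add_gens ker xs"
proof
  have c: "ev ` set xs \<subseteq> carrier R" by auto
  have I: "ideal_on (add_gens ker xs)" by (rule add_gens_ideal[OF ker_ideal])
  have "Idl (ev ` set xs) \<subseteq> ev ` add_gens ker xs"
    by (rule genideal_minimal[OF pushforward_ideal[OF I]]) (use add_gens_mem[OF ker_ideal] in auto)
  then show "{s. ev s \<in> Idl (ev ` set xs)} \<subseteq> add_gens ker xs"
    using pullback_pushforward[OF I add_gens_mono[OF ker_ideal]] by auto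
  have "ideal (Idl (ev ` set xs)) R" by (rule genideal_ideal[OF c])
  then show "add_gens ker xs \<subseteq> {s. ev s \<in> Idl (ev ` set xs)}"
    by (intro add_gens_least pullback_ideal)
      (use genideal_self[OF c] in \<open>auto simp: ker_iff additive_subgroup.zero_closed ideal.axioms(1)\<close>)
qed

lemma add_gens_ker_iff: "s \<in> add_gens ker xs \<longleftrightarrow> ev s \<in> Idl (ev ` set xs)"
  unfolding pullback_genideal[symmetric] by simp

lemma regular_seq_imp_regular_mod:
  assumes "regular_seq R (map ev xs)" shows "regular_mod ker xs"
  using assms unfolding regular_mod_nth regular_seq_def add_gens_ker_iff
  by (simp add: take_map)

lemma regular_mod_imp_regular_seq:
  assumes "regular_mod ker xs" "Idl (ev ` set xs) \<noteq> carrier R" shows "regular_seq R (map ev xs)"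
  unfolding regular_seq_def
proof (intro conjI allI impI ballI)
  fix i a assume i: "i < length (map ev xs)" and a: "a \<in> carrier R"
    and "map ev xs ! i \<otimes> a \<in> Idl (set (take i (map ev xs)))"
  then have "ev (xs ! i * fcring_var a) \<in> Idl (ev ` set (take i xs))" by (simp add: take_map)
  then have "ev (fcring_var a) \<in> Idl (ev ` set (take i xs))"
    using assms(1) i unfolding regular_mod_nth add_gens_ker_iff by simp
  then show "a \<in> Idl (set (take i (map ev xs)))" using a by (simp add: take_map)
qed (use assms(2) in auto)

text \<open>
  Ideals of \<open>R\<close> correspond to the ideals that contain the kernel, so the chain condition carries over.
\<close>

lemma noetherian_over_ker:
  assumes "noetherian_ring R" shows "noetherian_over ker"
  unfolding noetherian_over_def
proof (intro allI impI, elim conjE)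
  interpret N: noetherian_ring R by fact
  fix \<A> :: "'a fcring set set" assume ne: "\<A> \<noteq> {}" and A: "\<forall>I\<in>\<A>. ideal_on I \<and> ker \<subseteq> I"
  define \<B> where "\<B> = image ev ` \<A>"
  have "\<exists>I\<in>\<B>. \<forall>I'\<in>\<B>. I \<subseteq> I' \<longrightarrow> I' = I"
  proof (rule subset_Zorn_nonempty)
    show "\<B> \<noteq> {}" using ne by (simp add: \<B>_def)
    fix C assume C: "C \<noteq> {}" "subset.chain \<B> C"
    have "\<B> \<subseteq> {I. ideal I R}" using A pushforward_ideal by (auto simp: \<B>_def)
    then have "subset.chain {I. ideal I R} C" using C(2) unfolding pred_on.chain_def by blast
    then have "\<Union> C \<in> C" by (rule N.ideal_chain_is_trivial[OF C(1)])
    then show "\<Union> C \<in> \<B>" using C(2) unfolding pred_on.chain_def by blast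
  qed
  then obtain I where I: "I \<in> \<A>" "\<forall>I'\<in>\<A>. ev ` I \<subseteq> ev ` I' \<longrightarrow> ev ` I' = ev ` I"
    unfolding \<B>_def by auto
  have "I' = I" if I': "I' \<in> \<A>" "I \<subseteq> I'" for I'
  proof -
    have "ev ` I' = ev ` I" using I(2) I' by (simp add: image_mono)
    then have "s \<in> I' \<longleftrightarrow> s \<in> I" for s
      using pullback_pushforward[of I s] pullback_pushforward[of I' s] A I(1) I'(1) by simp
    then show ?thesis by blast
  qed
  then show "\<exists>I\<in>\<A>. \<forall>I'\<in>\<A>. I \<subseteq> I' \<longrightarrow> I' = I" using I(1) by blast
qed

text \<open>
  A finite grade is attained, since a supremum of extended naturals over an infinite set is infinite.
\<close>

lemma grade_attained:
  assumes J: "ideal J R" and g: "grade R J = enat h"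
  obtains xs where "length xs = h" "ev ` set xs \<subseteq> J" "regular_mod ker xs"
    "\<And>ys. ev ` set ys \<subseteq> J \<Longrightarrow> regular_mod ker ys \<Longrightarrow> length ys \<le> h"
proof -
  define L where "L = {enat (length xs) | xs. regular_seq R xs \<and> set xs \<subseteq> J}"
  have J0: "J \<noteq> carrier R" and L: "Sup L = enat h"
    using g unfolding grade_def L_def by (auto split: if_splits)
  have mem: "enat (length ys) \<in> L" if "ev ` set ys \<subseteq> J" "regular_mod ker ys" for ys
  proof -
    have "Idl (ev ` set ys) \<subseteq> J" by (rule genideal_minimal[OF J that(1)])
    moreover have "J \<subseteq> carrier R" using ideal.Icarr[OF J] by blast
    ultimately have "Idl (ev ` set ys) \<noteq> carrier R" using J0 by blast
    from regular_mod_imp_regular_seq[OF that(2) this] that(1)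
    show ?thesis unfolding L_def by (intro CollectI exI[of _ "map ev ys"]) auto
  qed
  from mem[of "[]"] have ne: "L \<noteq> {}" by auto
  then have fin: "finite L" and "Max L = enat h" using L unfolding Sup_enat_def by (auto split: if_splits)
  then have "enat h \<in> L" using Max_in[OF fin ne] by simp
  then obtain ys where ys: "regular_seq R ys" "set ys \<subseteq> J" "length ys = h" unfolding L_def by auto
  define xs where "xs = map fcring_var ys"
  have e: "map ev xs = ys"
    using ys(1) unfolding xs_def regular_seq_def by (auto intro!: map_idI)
  show thesis
  proof (rule that)
    show "length xs = h" using ys by (simp add: xs_def)
    show "ev ` set xs \<subseteq> J" using ys(2) by (simp flip: e)
    show "regular_mod ker xs" by (rule regular_seq_imp_regular_mod) (use ys(1) in \<open>simp add: e\<close>)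
    show "length zs \<le> h" if "ev ` set zs \<subseteq> J" "regular_mod ker zs" for zs
      using Sup_upper[OF mem[OF that]] L by simp
  qed
qed

text \<open>
  A regular sequence of length \<open>grade J\<close> in \<open>J\<close> cannot be extended, so \<open>J\<close> consists of zero divisors
  modulo it.
\<close>

lemma maximal_regular_sequence_annihilator:
  assumes "noetherian_ring R" and J: "ideal J R" and g: "grade R J = enat h"
  obtains xs z where "length xs = h" "ev ` set xs \<subseteq> J" "regular_mod ker xs" "z \<notin> add_gens ker xs"
    "\<And>b. ev b \<in> J \<Longrightarrow> b * z \<in> add_gens ker xs"
proof -
  obtain xs where xs: "length xs = h" "ev ` set xs \<subseteq> J" "regular_mod ker xs"
    "\<And>ys. ev ` set ys \<subseteq> J \<Longrightarrow> regular_mod ker ys \<Longrightarrow> length ys \<le> h"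
    using grade_attained[OF J g] by blast
  have K: "ideal_on (add_gens ker xs)" by (rule add_gens_ideal[OF ker_ideal])
  have "\<exists>z. z \<notin> add_gens ker xs \<and> (\<forall>b\<in>{s. ev s \<in> J}. b * z \<in> add_gens ker xs)"
  proof (rule zero_divisors_common_annihilator[OF _ K pullback_ideal[OF J]])
    show "noetherian_over (add_gens ker xs)"
      using noetherian_over_ker[OF assms(1)] add_gens_mono[OF ker_ideal, of xs]
      unfolding noetherian_over_def by (meson subset_trans)
    fix b assume "b \<in> {s. ev s \<in> J}"
    then have "ev ` set (xs @ [b]) \<subseteq> J" using xs(2) by auto
    then have "\<not> regular_mod ker (xs @ [b])" using xs(4)[of "xs @ [b]"] xs(1) by auto
    then show "\<exists>z. z \<notin> add_gens ker xs \<and> b * z \<in> add_gens ker xs"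
      using xs(3) unfolding regular_mod_snoc by blast
  qed
  then show thesis using that xs by blast
qed

text \<open>
  Otherwise some power of every element of \<open>Idl D\<close> kills \<open>z\<close> modulo the sequence. For the members of a
  regular sequence of length \<open>g\<close> in \<open>Idl D\<close> this gives a multiple of \<open>z\<close>, still outside the ideal,
  that is killed by all of them, contrary to the bound on lengths.
\<close>

lemma large_grade_nonnilpotent_generator:
  assumes D: "D \<subseteq> carrier R" and g: "grade R (Idl D) = enat g" "length xs < g"
    and xs: "regular_mod ker xs" and z: "z \<notin> add_gens ker xs"
  obtains d where "ev d \<in> D" "\<And>N. d ^ N * z \<notin> add_gens ker xs"
proof -
  have K: "ideal_on (add_gens ker xs)" by (rule add_gens_ideal[OF ker_ideal])
  obtain ys where ys: "length ys = g" "ev ` set ys \<subseteq> Idl D" "regular_mod ker ys"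
    by (rule grade_attained[OF genideal_ideal[OF D] g(1)])
  have "\<exists>d. ev d \<in> D \<and> (\<forall>N. d ^ N * z \<notin> add_gens ker xs)"
  proof (rule ccontr)
    assume neg: "\<not> ?thesis"
    define Q where "Q = {y. \<exists>N. y ^ N * z \<in> add_gens ker xs}"
    have Q: "ideal_on Q" unfolding Q_def by (rule power_colon_ideal[OF K])
    have kQ: "ker \<subseteq> Q" unfolding Q_def
      using add_gens_mono[OF ker_ideal, of xs] ideal_onD(4)[OF K] by (auto intro!: exI[of _ 1])
    have "D \<subseteq> ev ` Q"
    proof
      fix d assume "d \<in> D"
      then have d: "ev (fcring_var d) = d" using D by auto
      then have "ev (fcring_var d) \<in> D" using \<open>d \<in> D\<close> by simp
      then have "fcring_var d \<in> Q" using neg unfolding Q_def by blast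
      then show "d \<in> ev ` Q" using d by (intro image_eqI[of d ev "fcring_var d"]) simp_all
    qed
    then have "Idl D \<subseteq> ev ` Q" by (rule genideal_minimal[OF pushforward_ideal[OF Q]])
    then have "set ys \<subseteq> Q" using ys(2) pullback_pushforward[OF Q kQ] by blast
    then have "\<exists>N. y ^ N * z \<in> add_gens ker xs" if "y \<in> set ys" for y using that unfolding Q_def by blast
    from power_killed_imp_killed[OF K z this]
    obtain c where c: "c * z \<notin> add_gens ker xs" "\<forall>y\<in>set ys. y * (c * z) \<in> add_gens ker xs" by blast
    have "c * z \<in> add_gens ker xs"
      by (rule regular_length_bound[OF ker_ideal xs ys(3)]) (use g(2) ys(1) c(2) in \<open>auto simp: mult.commute\<close>)
    then show False using c(1) by blast
  qed
  then show thesis using that by blast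
qed

end

section \<open>Linear maps, quotients and free modules\<close>

lemma (in module) submodule_abelian_subgroup: "submodule K R M \<Longrightarrow> abelian_subgroup K M"
  by (intro abelian_subgroupI3 additive_subgroupI submodule.axioms(1)) (auto intro: M.abelian_group_axioms)

lemma (in module) submoduleD:
  assumes "submodule K R M"
  shows "\<zero>\<^bsub>M\<^esub> \<in> K" "x \<in> K \<Longrightarrow> x \<in> carrier M" "x \<in> K \<Longrightarrow> y \<in> K \<Longrightarrow> x \<oplus>\<^bsub>M\<^esub> y \<in> K"
    "a \<in> carrier R \<Longrightarrow> x \<in> K \<Longrightarrow> a \<odot>\<^bsub>M\<^esub> x \<in> K" "x \<in> K \<Longrightarrow> \<ominus>\<^bsub>M\<^esub> x \<in> K"
    "x \<in> K \<Longrightarrow> y \<in> K \<Longrightarrow> x \<ominus>\<^bsub>M\<^esub> y \<in> K"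
proof -
  interpret K: abelian_subgroup K M by (rule submodule_abelian_subgroup[OF assms])
  show "\<zero>\<^bsub>M\<^esub> \<in> K" "x \<in> K \<Longrightarrow> x \<in> carrier M" "x \<in> K \<Longrightarrow> y \<in> K \<Longrightarrow> x \<oplus>\<^bsub>M\<^esub> y \<in> K" "x \<in> K \<Longrightarrow> \<ominus>\<^bsub>M\<^esub> x \<in> K"
    "x \<in> K \<Longrightarrow> y \<in> K \<Longrightarrow> x \<ominus>\<^bsub>M\<^esub> y \<in> K" "a \<in> carrier R \<Longrightarrow> x \<in> K \<Longrightarrow> a \<odot>\<^bsub>M\<^esub> x \<in> K"
    using submoduleE(4)[OF assms] by (auto simp: a_minus_def)
qed

lemma (in module) submodule_finsum:
  assumes K: "submodule K R M" and "\<And>x. x \<in> A \<Longrightarrow> f x \<in> K"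
  shows "(\<Oplus>\<^bsub>M\<^esub>x\<in>A. f x) \<in> K"
  using assms(2)
proof (induction A rule: infinite_finite_induct)
  case (insert x A)
  then have "f \<in> A \<rightarrow> carrier M" "f x \<in> carrier M" using submoduleD(2)[OF K] by auto
  then show ?case using insert submoduleD(3)[OF K] by simp
qed (auto simp: submoduleD(1)[OF K])

lemma (in module) minus_smult:
  assumes "x \<in> carrier M"
  shows "\<ominus>\<^bsub>M\<^esub> x = (\<ominus> \<one>) \<odot>\<^bsub>M\<^esub> x"
  using assms smult_l_minus[of \<one> x] by simp

subsection \<open>Linear maps\<close>

text \<open>
  Linear maps without the extensionality requirement of \<^const>\<open>linear_maps\<close>, which would be a burden for
  maps given by formulas.
\<close>

definition linear :: "('a, 'p) ring_scheme \<Rightarrow> ('a, 'b, 'q) module_scheme \<Rightarrow> ('a, 'c, 's) module_scheme \<Rightarrow> ('b \<Rightarrow> 'c) \<Rightarrow> bool"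
  where "linear R M N h \<longleftrightarrow> (\<forall>x\<in>carrier M. h x \<in> carrier N) \<and>
     (\<forall>x\<in>carrier M. \<forall>y\<in>carrier M. h (x \<oplus>\<^bsub>M\<^esub> y) = h x \<oplus>\<^bsub>N\<^esub> h y) \<and>
     (\<forall>a\<in>carrier R. \<forall>x\<in>carrier M. h (a \<odot>\<^bsub>M\<^esub> x) = a \<odot>\<^bsub>N\<^esub> h x)"

lemma linear_mapsD: "h \<in> linear_maps R M N \<Longrightarrow> linear R M N h"
  unfolding linear_maps_def linear_def by auto

lemma linearD:
  assumes "linear R M N h"
  shows "x \<in> carrier M \<Longrightarrow> h x \<in> carrier N"
    "x \<in> carrier M \<Longrightarrow> y \<in> carrier M \<Longrightarrow> h (x \<oplus>\<^bsub>M\<^esub> y) = h x \<oplus>\<^bsub>N\<^esub> h y"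
    "a \<in> carrier R \<Longrightarrow> x \<in> carrier M \<Longrightarrow> h (a \<odot>\<^bsub>M\<^esub> x) = a \<odot>\<^bsub>N\<^esub> h x"
  using assms unfolding linear_def by auto

lemma linear_zero:
  assumes "module R M" "module R N" "linear R M N h" shows "h \<zero>\<^bsub>M\<^esub> = \<zero>\<^bsub>N\<^esub>"
proof -
  interpret M: module R M by fact
  interpret N: module R N by fact
  have "h (\<zero>\<^bsub>R\<^esub> \<odot>\<^bsub>M\<^esub> \<zero>\<^bsub>M\<^esub>) = \<zero>\<^bsub>R\<^esub> \<odot>\<^bsub>N\<^esub> h \<zero>\<^bsub>M\<^esub>" by (rule linearD[OF assms(3)]) auto
  then show ?thesis using linearD(1)[OF assms(3), of "\<zero>\<^bsub>M\<^esub>"] by simp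
qed

lemma linear_minus:
  assumes "module R M" "module R N" "linear R M N h" "x \<in> carrier M" shows "h (\<ominus>\<^bsub>M\<^esub> x) = \<ominus>\<^bsub>N\<^esub> h x"
proof -
  interpret M: module R M by fact
  interpret N: module R N by fact
  show ?thesis using assms(4) linearD(1,3)[OF assms(3)] M.minus_smult N.minus_smult by simp
qed

lemma linear_diff:
  assumes "module R M" "module R N" "linear R M N h" "x \<in> carrier M" "y \<in> carrier M"
  shows "h (x \<ominus>\<^bsub>M\<^esub> y) = h x \<ominus>\<^bsub>N\<^esub> h y"
proof -
  interpret M: module R M by fact
  interpret N: module R N by fact
  show ?thesis using assms(4,5) linearD(2)[OF assms(3)] linear_minus[OF assms(1-3)] by (simp add: a_minus_def)
qed

lemma linear_finsum:
  assumes "module R M" "module R N" "linear R M N h" "\<And>x. x \<in> A \<Longrightarrow> f x \<in> carrier M"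
  shows "h (\<Oplus>\<^bsub>M\<^esub>x\<in>A. f x) = (\<Oplus>\<^bsub>N\<^esub>x\<in>A. h (f x))"
proof -
  interpret M: module R M by fact
  interpret N: module R N by fact
  note h = linearD[OF assms(3)]
  show ?thesis using assms(4)
  proof (induction A rule: infinite_finite_induct)
    case (insert x A)
    then have "f \<in> A \<rightarrow> carrier M" "f x \<in> carrier M" "(\<lambda>x. h (f x)) \<in> A \<rightarrow> carrier N" using h(1) by auto
    then show ?case using insert h by simp
  qed (auto simp: linear_zero[OF assms(1-3)])
qed

lemma linear_preimage_submodule:
  assumes "module R M" "module R N" "linear R M N h" "submodule K R N"
  shows "submodule {x \<in> carrier M. h x \<in> K} R M"
proof -
  interpret M: module R M by fact
  interpret N: module R N by fact
  note h = linearD[OF assms(3)] and K = N.submoduleD[OF assms(4)]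
  show ?thesis
    by (rule M.submoduleI)
      (auto simp: h K linear_minus[OF assms(1-3)] linear_zero[OF assms(1-3)])
qed

lemma linear_image_submodule:
  assumes "module R M" "module R N" "linear R M N h"
  shows "submodule (h ` carrier M) R N"
proof -
  interpret M: module R M by fact
  interpret N: module R N by fact
  note h = linearD[OF assms(3)]
  show ?thesis
  proof (rule N.submoduleI)
    show "\<zero>\<^bsub>N\<^esub> \<in> h ` carrier M" using linear_zero[OF assms] by (metis M.zero_closed imageI)
    show "\<ominus>\<^bsub>N\<^esub> a \<in> h ` carrier M" if "a \<in> h ` carrier M" for a
    proof -
      obtain x where "x \<in> carrier M" "a = h x" using \<open>a \<in> h ` carrier M\<close> by blast
      then show ?thesis using linear_minus[OF assms, of x] M.a_inv_closed[of x] by (metis imageI)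
    qed
    show "a \<oplus>\<^bsub>N\<^esub> b \<in> h ` carrier M" if ab: "a \<in> h ` carrier M" "b \<in> h ` carrier M" for a b
    proof -
      obtain x where "x \<in> carrier M" "a = h x" using ab(1) by blast
      moreover obtain y where "y \<in> carrier M" "b = h y" using ab(2) by blast
      ultimately show ?thesis using h(2)[of x y] M.a_closed[of x y] by (metis imageI)
    qed
    show "a \<odot>\<^bsub>N\<^esub> x \<in> h ` carrier M" if ax: "a \<in> carrier R" "x \<in> h ` carrier M" for a x
    proof -
      obtain y where "y \<in> carrier M" "x = h y" using ax(2) by blast
      then show ?thesis using h(3)[of a y] ax(1) M.smult_closed[of a y] by (metis imageI)
    qed
  qed (use h in auto)
qed

lemma (in module) span_module_submodule:
  assumes "S \<subseteq> carrier M" shows "submodule (span_module R M S) R M"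
proof (rule submoduleI)
  show "span_module R M S \<subseteq> carrier M" using carrier_is_submodule assms by (auto simp: span_module_def)
qed (auto simp: span_module_def submoduleD)

lemma span_module_superset: "S \<subseteq> span_module R M S"
  by (auto simp: span_module_def)

lemma span_module_least: "submodule K R M \<Longrightarrow> S \<subseteq> K \<Longrightarrow> span_module R M S \<subseteq> K"
  by (auto simp: span_module_def)

subsection \<open>Quotients\<close>

lemma (in module) coset_eq_iff:
  assumes K: "submodule K R M" and "x \<in> carrier M" "y \<in> carrier M"
  shows "K +>\<^bsub>M\<^esub> x = K +>\<^bsub>M\<^esub> y \<longleftrightarrow> x \<ominus>\<^bsub>M\<^esub> y \<in> K"
proof -
  interpret K: abelian_subgroup K M by (rule submodule_abelian_subgroup[OF K])
  have "x \<in> K +>\<^bsub>M\<^esub> y \<longleftrightarrow> x \<ominus>\<^bsub>M\<^esub> y \<in> K"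
    using K.a_rcos_module[of y x] assms by (simp add: a_minus_def)
  then show ?thesis
    using K.a_repr_independence'[of x y] K.a_repr_independenceD[of x y] assms by metis
qed

lemma (in module) coset_zero: "submodule K R M \<Longrightarrow> K +>\<^bsub>M\<^esub> \<zero>\<^bsub>M\<^esub> = K"
  by (simp add: submoduleE(1))

lemma (in module) coset_eq_self_iff:
  assumes K: "submodule K R M" and "x \<in> carrier M"
  shows "K +>\<^bsub>M\<^esub> x = K \<longleftrightarrow> x \<in> K"
  using coset_eq_iff[OF K assms(2), of "\<zero>\<^bsub>M\<^esub>"] coset_zero[OF K] assms
  M.minus_equality[of "\<zero>\<^bsub>M\<^esub>" "\<zero>\<^bsub>M\<^esub>"] by (simp add: a_minus_def)

lemma (in module) coset_mem_iff:
  assumes K: "submodule K R M" and "x \<in> carrier M"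
  shows "y \<in> K +>\<^bsub>M\<^esub> x \<longleftrightarrow> y \<in> carrier M \<and> y \<ominus>\<^bsub>M\<^esub> x \<in> K"
proof -
  interpret K: abelian_subgroup K M by (rule submodule_abelian_subgroup[OF K])
  show ?thesis
    using K.a_rcos_module[of x y] assms K.a_elemrcos_carrier[of x y] by (auto simp: a_minus_def)
qed

lemma (in module) coset_self: "submodule K R M \<Longrightarrow> x \<in> carrier M \<Longrightarrow> x \<in> K +>\<^bsub>M\<^esub> x"
  by (simp add: coset_mem_iff a_minus_def M.r_neg submoduleD)

lemma (in module) quot_carrier: "carrier (quot_module M K) = (\<lambda>x. K +>\<^bsub>M\<^esub> x) ` carrier M"
  by (auto simp: quot_module_def A_RCOSETS_def')

lemma quot_zero: "\<zero>\<^bsub>quot_module M K\<^esub> = K"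
  by (simp add: quot_module_def)

lemma (in module) quot_add:
  assumes K: "submodule K R M" and "x \<in> carrier M" "y \<in> carrier M"
  shows "(K +>\<^bsub>M\<^esub> x) \<oplus>\<^bsub>quot_module M K\<^esub> (K +>\<^bsub>M\<^esub> y) = K +>\<^bsub>M\<^esub> (x \<oplus>\<^bsub>M\<^esub> y)"
proof -
  interpret K: abelian_subgroup K M by (rule submodule_abelian_subgroup[OF K])
  show ?thesis using K.a_rcos_sum assms by (simp add: quot_module_def)
qed

lemma coset_map_coset:
  assumes "module R M" "module R N" "linear R M N h" "submodule K R M" "submodule L R N"
    and "\<And>x. x \<in> K \<Longrightarrow> h x \<in> L" and "x \<in> carrier M"
  shows "coset_map N L h (K +>\<^bsub>M\<^esub> x) = L +>\<^bsub>N\<^esub> h x"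
proof -
  interpret M: module R M by fact
  interpret N: module R N by fact
  have "L +>\<^bsub>N\<^esub> h y = L +>\<^bsub>N\<^esub> h x" if "y \<in> K +>\<^bsub>M\<^esub> x" for y
  proof -
    have y: "y \<in> carrier M" "y \<ominus>\<^bsub>M\<^esub> x \<in> K" using M.coset_mem_iff[OF assms(4,7)] that by auto
    then have "h y \<ominus>\<^bsub>N\<^esub> h x \<in> L" using assms(6)[OF y(2)] linear_diff[OF assms(1-3) y(1) assms(7)] by simp
    then show ?thesis using N.coset_eq_iff[OF assms(5)] linearD(1)[OF assms(3)] y(1) assms(7) by blast
  qed
  then show ?thesis using M.coset_self[OF assms(4,7)] unfolding coset_map_def by blast
qed

lemma (in module) quot_smult:
  assumes K: "submodule K R M" and "x \<in> carrier M" and a: "a \<in> carrier R"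
  shows "a \<odot>\<^bsub>quot_module M K\<^esub> (K +>\<^bsub>M\<^esub> x) = K +>\<^bsub>M\<^esub> (a \<odot>\<^bsub>M\<^esub> x)"
proof -
  have "linear R M M (\<lambda>x. a \<odot>\<^bsub>M\<^esub> x)"
    unfolding linear_def using a by (auto simp: smult_r_distr R.m_comm simp flip: smult_assoc1)
  from coset_map_coset[OF module_axioms module_axioms this K K _ assms(2)]
  show ?thesis using submoduleD(4)[OF K a] by (simp add: coset_map_def quot_module_def)
qed

lemma (in module) quot_module_module:
  assumes K: "submodule K R M"
  shows "module R (quot_module M K)"
proof (rule moduleI)
  note c = quot_carrier[of K] and z = quot_zero[of M K] and add = quot_add[OF K] and sm = quot_smult[OF K]
    and K0 = coset_zero[OF K]
  show "cring R" by (rule R.is_cring)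
  show "abelian_group (quot_module M K)"
  proof (rule abelian_groupI)
    show "\<zero>\<^bsub>quot_module M K\<^esub> \<in> carrier (quot_module M K)" using K0 unfolding c z by (metis M.zero_closed imageI)
    fix x assume "x \<in> carrier (quot_module M K)"
    then obtain u where u: "u \<in> carrier M" "x = K +>\<^bsub>M\<^esub> u" unfolding c by auto
    show "\<zero>\<^bsub>quot_module M K\<^esub> \<oplus>\<^bsub>quot_module M K\<^esub> x = x"
      using add[of "\<zero>\<^bsub>M\<^esub>" u] u K0 by (simp add: z)
    show "\<exists>y\<in>carrier (quot_module M K). y \<oplus>\<^bsub>quot_module M K\<^esub> x = \<zero>\<^bsub>quot_module M K\<^esub>"
      using add[of "\<ominus>\<^bsub>M\<^esub> u" u] u K0 by (intro bexI[of _ "K +>\<^bsub>M\<^esub> (\<ominus>\<^bsub>M\<^esub> u)"]) (auto simp: z c M.l_neg)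
  qed (auto simp: c add M.a_ac)
qed (auto simp: quot_carrier quot_add[OF K] quot_smult[OF K] smult_l_distr smult_r_distr smult_assoc1)

lemma (in module) quot_coset_linear: "submodule K R M \<Longrightarrow> linear R M (quot_module M K) (\<lambda>x. K +>\<^bsub>M\<^esub> x)"
  unfolding linear_def by (auto simp: quot_carrier quot_add quot_smult)

subsection \<open>Free modules\<close>

lemma (in cring) self_module_module: "module R (self_module R)"
proof (rule moduleI)
  show "abelian_group (self_module R)"
    by (rule abelian_groupI) (auto simp: self_module_def a_ac intro!: bexI[of _ "\<ominus> x" for x] l_neg)
qed (auto simp: self_module_def m_assoc l_distr r_distr is_cring)

context cring
begin

lemma free_carrierD:
  assumes "f \<in> carrier (free_module R B)"
  shows "f x \<in> carrier R" "finite {x. f x \<noteq> \<zero>}" "x \<notin> B \<Longrightarrow> f x = \<zero>" "{x. f x \<noteq> \<zero>} \<subseteq> B"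
  using assms by (auto simp: free_module_def)

lemma free_module_module:
  fixes B :: "'x set" shows "module R (free_module R B)"
proof (rule moduleI)
  have sub: "finite {x. h x \<noteq> \<zero>} \<and> {x. h x \<noteq> \<zero>} \<subseteq> B"
    if "finite {x. f x \<noteq> \<zero>}" "{x. f x \<noteq> \<zero>} \<subseteq> B" "finite {x. g x \<noteq> \<zero>}" "{x. g x \<noteq> \<zero>} \<subseteq> B"
      "\<And>x. f x = \<zero> \<Longrightarrow> g x = \<zero> \<Longrightarrow> h x = \<zero>" for f g h :: "'x \<Rightarrow> 'a"
  proof -
    have "{x. h x \<noteq> \<zero>} \<subseteq> {x. f x \<noteq> \<zero>} \<union> {x. g x \<noteq> \<zero>}" using that(5) by auto
    then show ?thesis using that(1-4) by (meson finite_UnI finite_subset le_sup_iff order_trans Un_least)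
  qed
  have add: "(\<lambda>x. f x \<oplus> g x) \<in> carrier (free_module R B)"
    if "f \<in> carrier (free_module R B)" "g \<in> carrier (free_module R B)" for f g
    using that sub[of f g "\<lambda>x. f x \<oplus> g x"] unfolding free_module_def by (auto simp: image_subset_iff)
  have smult: "(\<lambda>x. a \<otimes> f x) \<in> carrier (free_module R B)"
    if "f \<in> carrier (free_module R B)" "a \<in> carrier R" for f a
    using that sub[of f f "\<lambda>x. a \<otimes> f x"] unfolding free_module_def by (auto simp: image_subset_iff)
  have zero: "(\<lambda>x. \<zero>) \<in> carrier (free_module R B)" by (auto simp: free_module_def)
  note car = free_carrierD(1)
  have ops: "\<zero>\<^bsub>free_module R B\<^esub> = (\<lambda>_. \<zero>)" "f \<oplus>\<^bsub>free_module R B\<^esub> g = (\<lambda>x. f x \<oplus> g x)"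
    "a \<odot>\<^bsub>free_module R B\<^esub> f = (\<lambda>x. a \<otimes> f x)" for f g a
    by (simp_all add: free_module_def)
  show "abelian_group (free_module R B)"
  proof (rule abelian_groupI)
    fix f assume f: "f \<in> carrier (free_module R B)"
    show "\<exists>g\<in>carrier (free_module R B). g \<oplus>\<^bsub>free_module R B\<^esub> f = \<zero>\<^bsub>free_module R B\<^esub>"
      by (intro bexI[of _ "\<lambda>x. \<ominus> \<one> \<otimes> f x"] smult f) (auto simp: ops car[OF f] l_minus l_neg)
  qed (auto simp: ops add zero car a_ac)
qed (auto simp: free_module_def m_assoc l_distr r_distr is_cring image_subset_iff elim!: finite_subset[rotated])

lemma free_ops:
  "\<zero>\<^bsub>free_module R B\<^esub> = (\<lambda>_. \<zero>)" "(f \<oplus>\<^bsub>free_module R B\<^esub> g) x = f x \<oplus> g x"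
  "(a \<odot>\<^bsub>free_module R B\<^esub> f) x = a \<otimes> f x"
  by (simp_all add: free_module_def)

lemma unit_vec_carrier: "x \<in> B \<Longrightarrow> unit_vec R x \<in> carrier (free_module R B)"
  unfolding free_module_def unit_vec_def by (auto elim!: finite_subset[rotated])

lemma free_eval_linear: "linear R (free_module R B) (self_module R) (\<lambda>f. f x)"
  unfolding linear_def by (auto simp: free_ops self_module_def free_carrierD)

lemma self_module_finsum: "finsum (self_module R) f A = finsum R f A"
  by (simp add: finsum_def finprod_def self_module_def)

lemma free_finsum_apply:
  assumes "\<And>i. i \<in> A \<Longrightarrow> f i \<in> carrier (free_module R B)"
  shows "(\<Oplus>\<^bsub>free_module R B\<^esub>i\<in>A. f i) x = (\<Oplus>i\<in>A. f i x)"
  using linear_finsum[OF free_module_module self_module_module free_eval_linear, of A f B x] assms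
  by (simp add: self_module_finsum)

end

text \<open>
  The linear extension of \<open>c\<close> to the free module on a set of arguments of \<open>c\<close>. The Koszul differential
  on the free modules has this form by definition.
\<close>

definition lext :: "('a, 'p) ring_scheme \<Rightarrow> ('a, 'b, 'q) module_scheme \<Rightarrow> ('x \<Rightarrow> 'b) \<Rightarrow> ('x \<Rightarrow> 'a) \<Rightarrow> 'b" where
  "lext R N c f = (\<Oplus>\<^bsub>N\<^esub>x\<in>{x. f x \<noteq> \<zero>\<^bsub>R\<^esub>}. f x \<odot>\<^bsub>N\<^esub> c x)"

context module
begin

lemma lext_superset:
  assumes f: "f \<in> carrier (free_module R B)" and c: "\<And>x. x \<in> B \<Longrightarrow> c x \<in> carrier M"
    and A: "finite A" "{x. f x \<noteq> \<zero>} \<subseteq> A" "A \<subseteq> B"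
  shows "lext R M c f = (\<Oplus>\<^bsub>M\<^esub>x\<in>A. f x \<odot>\<^bsub>M\<^esub> c x)"
  unfolding lext_def
  by (rule M.add.finprod_mono_neutral_cong_left) (use A c free_carrierD(1)[OF f] in auto)

lemma lext_linear:
  assumes c: "\<And>x. x \<in> B \<Longrightarrow> c x \<in> carrier M"
  shows "linear R (free_module R B) M (lext R M c)"
proof -
  interpret F: module R "free_module R B" by (rule R.free_module_module)
  note car = R.free_carrierD
  show ?thesis
    unfolding linear_def
  proof (intro conjI ballI)
    fix f assume f: "f \<in> carrier (free_module R B)"
    have "f x \<odot>\<^bsub>M\<^esub> c x \<in> carrier M" if "f x \<noteq> \<zero>" for x
      using c car(1)[OF f] car(4)[OF f] that by blast
    then show "lext R M c f \<in> carrier M" unfolding lext_def by (intro M.finsum_closed) auto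
    {
      fix g assume g: "g \<in> carrier (free_module R B)"
      let ?A = "{x. f x \<noteq> \<zero>} \<union> {x. g x \<noteq> \<zero>}"
      have A: "finite ?A" "?A \<subseteq> B" using car(2,4)[OF f] car(2,4)[OF g] by auto
      have fg: "f \<oplus>\<^bsub>free_module R B\<^esub> g \<in> carrier (free_module R B)" using f g by (rule F.a_closed)
      have "lext R M c (f \<oplus>\<^bsub>free_module R B\<^esub> g) = (\<Oplus>\<^bsub>M\<^esub>x\<in>?A. (f \<oplus>\<^bsub>free_module R B\<^esub> g) x \<odot>\<^bsub>M\<^esub> c x)"
        by (rule lext_superset[OF fg c A(1) _ A(2)]) (auto simp: R.free_ops)
      also have "\<dots> = (\<Oplus>\<^bsub>M\<^esub>x\<in>?A. f x \<odot>\<^bsub>M\<^esub> c x \<oplus>\<^bsub>M\<^esub> g x \<odot>\<^bsub>M\<^esub> c x)"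
        by (rule M.finsum_cong') (use A(2) c car(1)[OF f] car(1)[OF g] in \<open>auto simp: R.free_ops smult_l_distr subset_iff\<close>)
      also have "\<dots> = (\<Oplus>\<^bsub>M\<^esub>x\<in>?A. f x \<odot>\<^bsub>M\<^esub> c x) \<oplus>\<^bsub>M\<^esub> (\<Oplus>\<^bsub>M\<^esub>x\<in>?A. g x \<odot>\<^bsub>M\<^esub> c x)"
        by (rule M.finsum_addf) (use A(2) c car(1)[OF f] car(1)[OF g] in \<open>auto simp: subset_iff\<close>)
      also have "(\<Oplus>\<^bsub>M\<^esub>x\<in>?A. f x \<odot>\<^bsub>M\<^esub> c x) = lext R M c f"
        by (rule lext_superset[OF f c A(1) _ A(2), symmetric]) auto
      also have "(\<Oplus>\<^bsub>M\<^esub>x\<in>?A. g x \<odot>\<^bsub>M\<^esub> c x) = lext R M c g"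
        by (rule lext_superset[OF g c A(1) _ A(2), symmetric]) auto
      finally show "lext R M c (f \<oplus>\<^bsub>free_module R B\<^esub> g) = lext R M c f \<oplus>\<^bsub>M\<^esub> lext R M c g" .
    }
    fix a assume a: "a \<in> carrier R"
    let ?A = "{x. f x \<noteq> \<zero>}"
    have af: "a \<odot>\<^bsub>free_module R B\<^esub> f \<in> carrier (free_module R B)" using a f by (rule F.smult_closed)
    have "lext R M c (a \<odot>\<^bsub>free_module R B\<^esub> f) = (\<Oplus>\<^bsub>M\<^esub>x\<in>?A. (a \<odot>\<^bsub>free_module R B\<^esub> f) x \<odot>\<^bsub>M\<^esub> c x)"
      by (rule lext_superset[OF af c car(2)[OF f] _ car(4)[OF f]]) (use a in \<open>auto simp: R.free_ops\<close>)
    also have "\<dots> = (\<Oplus>\<^bsub>M\<^esub>x\<in>?A. a \<odot>\<^bsub>M\<^esub> (f x \<odot>\<^bsub>M\<^esub> c x))"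
      by (rule M.finsum_cong') (use car(4)[OF f] c car(1)[OF f] a in \<open>auto simp: R.free_ops smult_assoc1 subset_iff\<close>)
    also have "\<dots> = a \<odot>\<^bsub>M\<^esub> lext R M c f"
      unfolding lext_def
      by (rule finsum_smult_ldistr[symmetric]) (use car(2,4)[OF f] c car(1)[OF f] a in auto)
    finally show "lext R M c (a \<odot>\<^bsub>free_module R B\<^esub> f) = a \<odot>\<^bsub>M\<^esub> lext R M c f" .
  qed
qed

lemma lext_unit_vec:
  assumes c: "\<And>x. x \<in> B \<Longrightarrow> c x \<in> carrier M" and x: "x \<in> B"
  shows "lext R M c (unit_vec R x) = c x"
proof -
  have "lext R M c (unit_vec R x) = (\<Oplus>\<^bsub>M\<^esub>y\<in>{x}. unit_vec R x y \<odot>\<^bsub>M\<^esub> c y)"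
    by (rule lext_superset[OF R.unit_vec_carrier[OF x] c]) (use x in \<open>auto simp: unit_vec_def split: if_splits\<close>)
  also have "\<dots> = unit_vec R x x \<odot>\<^bsub>M\<^esub> c x" using c[OF x] by (simp add: unit_vec_def)
  finally show ?thesis using c[OF x] by (simp add: unit_vec_def)
qed

end

context cring
begin

lemma free_module_expand:
  assumes f: "f \<in> carrier (free_module R B)"
  shows "f = (\<Oplus>\<^bsub>free_module R B\<^esub>x\<in>{x. f x \<noteq> \<zero>}. f x \<odot>\<^bsub>free_module R B\<^esub> unit_vec R x)"
proof
  interpret F: module R "free_module R B" by (rule free_module_module)
  note car = free_carrierD[OF f]
  fix y
  have "(\<Oplus>\<^bsub>free_module R B\<^esub>x\<in>{x. f x \<noteq> \<zero>}. f x \<odot>\<^bsub>free_module R B\<^esub> unit_vec R x) y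
      = (\<Oplus>x\<in>{x. f x \<noteq> \<zero>}. (f x \<odot>\<^bsub>free_module R B\<^esub> unit_vec R x) y)"
    by (rule free_finsum_apply) (intro F.smult_closed car(1) unit_vec_carrier subsetD[OF car(4)])
  also have "\<dots> = (\<Oplus>x\<in>{x. f x \<noteq> \<zero>}. if y = x then f x else \<zero>)"
    by (rule finsum_cong') (auto simp: free_ops unit_vec_def car(1))
  also have "\<dots> = f y"
  proof (cases "f y = \<zero>")
    case True
    then have "(\<Oplus>x\<in>{x. f x \<noteq> \<zero>}. if y = x then f x else \<zero>) = (\<Oplus>x\<in>{x. f x \<noteq> \<zero>}. \<zero>)"
      by (intro finsum_cong') (auto simp: car(1))
    then show ?thesis using True by simp
  next
    case False
    then show ?thesis using finsum_singleton[of y "{x. f x \<noteq> \<zero>}" f] car(1,2) by auto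
  qed
  finally show "f y = (\<Oplus>\<^bsub>free_module R B\<^esub>x\<in>{x. f x \<noteq> \<zero>}. f x \<odot>\<^bsub>free_module R B\<^esub> unit_vec R x) y" by simp
qed

lemma free_module_generated:
  assumes K: "submodule K R (free_module R B)" and "\<And>x. x \<in> B \<Longrightarrow> unit_vec R x \<in> K"
  shows "carrier (free_module R B) \<subseteq> K"
proof
  interpret F: module R "free_module R B" by (rule free_module_module)
  fix f assume f: "f \<in> carrier (free_module R B)"
  have "(\<Oplus>\<^bsub>free_module R B\<^esub>x\<in>{x. f x \<noteq> \<zero>}. f x \<odot>\<^bsub>free_module R B\<^esub> unit_vec R x) \<in> K"
    by (rule F.submodule_finsum[OF K], rule F.submoduleD(4)[OF K])
      (auto intro: free_carrierD(1)[OF f] assms(2) subsetD[OF free_carrierD(4)[OF f]])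
  then show "f \<in> K" using free_module_expand[OF f] by simp
qed

end

section \<open>Exterior powers\<close>

lemma linear_free_ext:
  assumes "module R N" "linear R (free_module R B) N h" "linear R (free_module R B) N k"
    and "\<And>x. x \<in> B \<Longrightarrow> h (unit_vec R x) = k (unit_vec R x)" and "f \<in> carrier (free_module R B)"
  shows "h f = k f"
proof -
  interpret N: module R N by fact
  interpret F: module R "free_module R B" by (rule N.R.free_module_module)
  have "submodule {f \<in> carrier (free_module R B). h f = k f} R (free_module R B)"
    by (rule F.submoduleI)
      (auto simp: linear_zero[OF F.module_axioms assms(1)] linear_minus[OF F.module_axioms assms(1)]
        linearD[OF assms(2)] linearD[OF assms(3)] assms(2,3))
  then have "carrier (free_module R B) \<subseteq> {f \<in> carrier (free_module R B). h f = k f}"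
    by (rule N.R.free_module_generated) (simp add: assms(4) N.R.unit_vec_carrier)
  then show ?thesis using assms(5) by auto
qed

lemma tuples_iff: "xs \<in> tuples M i \<longleftrightarrow> length xs = i \<and> set xs \<subseteq> carrier M"
  by (simp add: tuples_def)

text \<open>
  One entry of a tuple is singled out by splitting the tuple, instead of by an index.
\<close>

definition multilinear :: "('a, 'p) ring_scheme \<Rightarrow> ('a, 'b, 'q) module_scheme \<Rightarrow> ('a, 'c, 's) module_scheme \<Rightarrow> nat \<Rightarrow> ('b list \<Rightarrow> 'c) \<Rightarrow> bool"
  where "multilinear R M N i \<phi> \<longleftrightarrow> (\<forall>xs\<in>tuples M i. \<phi> xs \<in> carrier N) \<and>
    (\<forall>as x y bs. as @ x # bs \<in> tuples M i \<longrightarrow> y \<in> carrier M \<longrightarrow>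
      \<phi> (as @ (x \<oplus>\<^bsub>M\<^esub> y) # bs) = \<phi> (as @ x # bs) \<oplus>\<^bsub>N\<^esub> \<phi> (as @ y # bs)) \<and>
    (\<forall>as x bs. \<forall>a\<in>carrier R. as @ x # bs \<in> tuples M i \<longrightarrow>
      \<phi> (as @ (a \<odot>\<^bsub>M\<^esub> x) # bs) = a \<odot>\<^bsub>N\<^esub> \<phi> (as @ x # bs))"

definition alternating :: "('a, 'p) ring_scheme \<Rightarrow> ('a, 'b, 'q) module_scheme \<Rightarrow> ('a, 'c, 's) module_scheme \<Rightarrow> nat \<Rightarrow> ('b list \<Rightarrow> 'c) \<Rightarrow> bool"
  where "alternating R M N i \<phi> \<longleftrightarrow> multilinear R M N i \<phi> \<and>
    (\<forall>xs\<in>tuples M i. \<not> distinct xs \<longrightarrow> \<phi> xs = \<zero>\<^bsub>N\<^esub>)"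

lemma multilinearD:
  assumes "multilinear R M N i \<phi>"
  shows "xs \<in> tuples M i \<Longrightarrow> \<phi> xs \<in> carrier N"
    "as @ x # bs \<in> tuples M i \<Longrightarrow> y \<in> carrier M \<Longrightarrow>
      \<phi> (as @ (x \<oplus>\<^bsub>M\<^esub> y) # bs) = \<phi> (as @ x # bs) \<oplus>\<^bsub>N\<^esub> \<phi> (as @ y # bs)"
    "a \<in> carrier R \<Longrightarrow> as @ x # bs \<in> tuples M i \<Longrightarrow>
      \<phi> (as @ (a \<odot>\<^bsub>M\<^esub> x) # bs) = a \<odot>\<^bsub>N\<^esub> \<phi> (as @ x # bs)"
  using assms unfolding multilinear_def by blast+

lemma alternatingD:
  assumes "alternating R M N i \<phi>"
  shows "multilinear R M N i \<phi>" "xs \<in> tuples M i \<Longrightarrow> \<not> distinct xs \<Longrightarrow> \<phi> xs = \<zero>\<^bsub>N\<^esub>"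
  using assms unfolding alternating_def by blast+

lemma tuple_split:
  assumes "xs \<in> tuples M i" "k < i"
  shows "\<exists>as u bs. xs = as @ u # bs \<and> (\<forall>v. xs[k := v] = as @ v # bs)"
proof -
  have "k < length xs" using assms by (simp add: tuples_iff)
  then have "xs = take k xs @ xs ! k # drop (Suc k) xs" "\<forall>v. xs[k := v] = take k xs @ v # drop (Suc k) xs"
    by (simp_all add: id_take_nth_drop upd_conv_take_nth_drop)
  then show ?thesis by blast
qed

context module
begin

lemma free_tuples_module: "module R (free_tuples R M i)"
  by (rule R.free_module_module)

lemma multilinear_rels_carrier: "multilinear_rels R M i \<subseteq> carrier (free_tuples R M i)"
proof -
  interpret F: module R "free_tuples R M i" by (rule free_tuples_module)
  have u: "unit_vec R (xs[k := x]) \<in> carrier (free_tuples R M i)" if "xs \<in> tuples M i" "x \<in> carrier M" for xs k x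
    using that set_update_subset_insert[of xs k x] by (intro R.unit_vec_carrier) (auto simp: tuples_iff)
  show ?thesis unfolding multilinear_rels_def by (auto intro!: F.minus_closed F.smult_closed F.a_closed u)
qed

lemma ext_gens_carrier:
  "multilinear_rels R M i \<union> {unit_vec R xs | xs. xs \<in> tuples M i \<and> \<not> distinct xs} \<subseteq> carrier (free_tuples R M i)"
  by (auto intro: subsetD[OF multilinear_rels_carrier] R.unit_vec_carrier)

lemma sym_gens_carrier:
  "multilinear_rels R M i \<union> {unit_vec R xs \<ominus>\<^bsub>free_tuples R M i\<^esub> unit_vec R ys | xs ys. xs \<in> tuples M i \<and> mset ys = mset xs}
     \<subseteq> carrier (free_tuples R M i)"
proof -
  interpret F: module R "free_tuples R M i" by (rule free_tuples_module)
  have "ys \<in> tuples M i" if "xs \<in> tuples M i" "mset ys = mset xs" for xs ys :: "'c list"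
    using that mset_eq_setD[of ys xs] mset_eq_length[of ys xs] by (auto simp: tuples_iff)
  then show ?thesis
    by (intro Un_least multilinear_rels_carrier) (auto intro!: F.minus_closed R.unit_vec_carrier)
qed

lemma ext_rels_submodule: "submodule (ext_rels R M i) R (free_tuples R M i)"
  unfolding ext_rels_def by (rule module.span_module_submodule[OF free_tuples_module ext_gens_carrier])

lemma sym_rels_submodule: "submodule (sym_rels R M i) R (free_tuples R M i)"
  unfolding sym_rels_def by (rule module.span_module_submodule[OF free_tuples_module sym_gens_carrier])

lemma ext_power_module: "module R (ext_power R M i)"
  unfolding ext_power_def by (rule module.quot_module_module[OF free_tuples_module ext_rels_submodule])

lemma multilinear_coset:
  assumes K: "submodule K R (free_tuples R M i)" and rels: "multilinear_rels R M i \<subseteq> K"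
  shows "multilinear R M (quot_module (free_tuples R M i) K) i (\<lambda>xs. K +>\<^bsub>free_tuples R M i\<^esub> unit_vec R xs)"
proof -
  interpret F: module R "free_tuples R M i" by (rule free_tuples_module)
  note u = R.unit_vec_carrier[of _ "tuples M i"]
  note q = F.quot_carrier F.quot_add[OF K, symmetric] F.quot_smult[OF K, symmetric]
  show ?thesis
    unfolding multilinear_def
  proof (intro conjI ballI allI impI)
    fix xs assume "xs \<in> tuples M i"
    then show "K +>\<^bsub>free_tuples R M i\<^esub> unit_vec R xs \<in> carrier (quot_module (free_tuples R M i) K)"
      by (simp add: F.quot_carrier u)
  next
    fix as x y bs assume t: "as @ x # bs \<in> tuples M i" and y: "y \<in> carrier M"
    have tt: "as @ y # bs \<in> tuples M i" "as @ (x \<oplus>\<^bsub>M\<^esub> y) # bs \<in> tuples M i" using t y by (auto simp: tuples_iff)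
    have "unit_vec R ((as @ x # bs)[length as := x \<oplus>\<^bsub>M\<^esub> y]) \<ominus>\<^bsub>free_tuples R M i\<^esub>
       (unit_vec R ((as @ x # bs)[length as := x]) \<oplus>\<^bsub>free_tuples R M i\<^esub> unit_vec R ((as @ x # bs)[length as := y])) \<in> multilinear_rels R M i"
      unfolding multilinear_rels_def
      by (rule UnI1, rule CollectI, rule exI[of _ "as @ x # bs"], rule exI[of _ "length as"], rule exI[of _ x], rule exI[of _ y])
        (use t y in \<open>auto simp: tuples_iff\<close>)
    then have "unit_vec R (as @ (x \<oplus>\<^bsub>M\<^esub> y) # bs) \<ominus>\<^bsub>free_tuples R M i\<^esub>
       (unit_vec R (as @ x # bs) \<oplus>\<^bsub>free_tuples R M i\<^esub> unit_vec R (as @ y # bs)) \<in> K"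
      using rels by auto
    then show "K +>\<^bsub>free_tuples R M i\<^esub> unit_vec R (as @ (x \<oplus>\<^bsub>M\<^esub> y) # bs) =
       (K +>\<^bsub>free_tuples R M i\<^esub> unit_vec R (as @ x # bs)) \<oplus>\<^bsub>quot_module (free_tuples R M i) K\<^esub>
       (K +>\<^bsub>free_tuples R M i\<^esub> unit_vec R (as @ y # bs))"
      using F.coset_eq_iff[OF K u[OF tt(2)] F.a_closed[OF u[OF t] u[OF tt(1)]]] F.quot_add[OF K u[OF t] u[OF tt(1)]] by simp
  next
    fix as x bs a assume a: "a \<in> carrier R" and t: "as @ x # bs \<in> tuples M i"
    have tt: "as @ (a \<odot>\<^bsub>M\<^esub> x) # bs \<in> tuples M i" using t a by (auto simp: tuples_iff)
    have "unit_vec R ((as @ x # bs)[length as := a \<odot>\<^bsub>M\<^esub> x]) \<ominus>\<^bsub>free_tuples R M i\<^esub>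
       (a \<odot>\<^bsub>free_tuples R M i\<^esub> unit_vec R ((as @ x # bs)[length as := x])) \<in> multilinear_rels R M i"
      unfolding multilinear_rels_def
      by (rule UnI2, rule CollectI, rule exI[of _ "as @ x # bs"], rule exI[of _ "length as"], rule exI[of _ a], rule exI[of _ x])
        (use t a in \<open>auto simp: tuples_iff\<close>)
    then have "unit_vec R (as @ (a \<odot>\<^bsub>M\<^esub> x) # bs) \<ominus>\<^bsub>free_tuples R M i\<^esub>
       (a \<odot>\<^bsub>free_tuples R M i\<^esub> unit_vec R (as @ x # bs)) \<in> K"
      using rels by auto
    then show "K +>\<^bsub>free_tuples R M i\<^esub> unit_vec R (as @ (a \<odot>\<^bsub>M\<^esub> x) # bs) =
       a \<odot>\<^bsub>quot_module (free_tuples R M i) K\<^esub> (K +>\<^bsub>free_tuples R M i\<^esub> unit_vec R (as @ x # bs))"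
      using F.coset_eq_iff[OF K u[OF tt] F.smult_closed[OF a u[OF t]]] F.quot_smult[OF K u[OF t] a] by simp
  qed
qed

lemma ext_class_alternating:
  "alternating R M (ext_power R M i) i (\<lambda>xs. ext_rels R M i +>\<^bsub>free_tuples R M i\<^esub> unit_vec R xs)"
  unfolding alternating_def
proof (intro conjI ballI impI)
  interpret F: module R "free_tuples R M i" by (rule free_tuples_module)
  have gens: "multilinear_rels R M i \<union> {unit_vec R xs | xs. xs \<in> tuples M i \<and> \<not> distinct xs} \<subseteq> ext_rels R M i"
    unfolding ext_rels_def by (rule span_module_superset)
  then show "multilinear R M (ext_power R M i) i (\<lambda>xs. ext_rels R M i +>\<^bsub>free_tuples R M i\<^esub> unit_vec R xs)"
    unfolding ext_power_def by (intro multilinear_coset ext_rels_submodule) simp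
  fix xs assume xs: "xs \<in> tuples M i" "\<not> distinct xs"
  then have "unit_vec R xs \<in> ext_rels R M i" by (intro subsetD[OF gens, OF UnI2]) auto
  then show "ext_rels R M i +>\<^bsub>free_tuples R M i\<^esub> unit_vec R xs = \<zero>\<^bsub>ext_power R M i\<^esub>"
    using F.coset_eq_self_iff[OF ext_rels_submodule R.unit_vec_carrier[OF xs(1)]] by (simp add: ext_power_def quot_zero)
qed

lemma multilinear_kills_rels:
  assumes N: "module R N" and \<phi>: "multilinear R M N i \<phi>" and f: "f \<in> multilinear_rels R M i"
  shows "lext R N \<phi> f = \<zero>\<^bsub>N\<^esub>"
proof -
  interpret N: module R N by fact
  interpret F: module R "free_tuples R M i" by (rule free_tuples_module)
  note D = multilinearD[OF \<phi>]
  have lin: "linear R (free_tuples R M i) N (lext R N \<phi>)" by (rule N.lext_linear) (rule D(1))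
  note L = linearD[OF lin] linear_diff[OF F.module_axioms N lin]
  have e: "lext R N \<phi> (unit_vec R xs) = \<phi> xs" if "xs \<in> tuples M i" for xs
    by (rule N.lext_unit_vec[of "tuples M i"]) (use D(1) that in auto)
  note u = R.unit_vec_carrier[of _ "tuples M i"]
  have cancel: "x \<ominus>\<^bsub>N\<^esub> x = \<zero>\<^bsub>N\<^esub>" if "x \<in> carrier N" for x using that by (simp add: a_minus_def N.M.r_neg)
  from f[unfolded multilinear_rels_def] show ?thesis
  proof (elim UnE CollectE exE conjE)
    fix xs k x y
    assume add: "f = unit_vec R (xs[k := x \<oplus>\<^bsub>M\<^esub> y])
        \<ominus>\<^bsub>free_tuples R M i\<^esub> (unit_vec R (xs[k := x]) \<oplus>\<^bsub>free_tuples R M i\<^esub> unit_vec R (xs[k := y]))"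
      "xs \<in> tuples M i" "k < i" "x \<in> carrier M" "y \<in> carrier M"
    obtain as v bs where s1: "xs = as @ v # bs" and "\<forall>v. xs[k := v] = as @ v # bs"
      using tuple_split[OF add(2,3)] by blast
    then have s2: "xs[k := v] = as @ v # bs" for v by blast
    have t: "as @ x # bs \<in> tuples M i" "as @ y # bs \<in> tuples M i" "as @ (x \<oplus>\<^bsub>M\<^esub> y) # bs \<in> tuples M i"
      using add(2,4,5) unfolding s1 by (auto simp: tuples_iff)
    show ?thesis
      unfolding add(1) s2 using D(2)[OF t(1) add(5)] D(1) t
      by (simp add: L u e cancel)
  next
    fix xs k a x
    assume smult: "f = unit_vec R (xs[k := a \<odot>\<^bsub>M\<^esub> x])
        \<ominus>\<^bsub>free_tuples R M i\<^esub> (a \<odot>\<^bsub>free_tuples R M i\<^esub> unit_vec R (xs[k := x]))"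
      "xs \<in> tuples M i" "k < i" "a \<in> carrier R" "x \<in> carrier M"
    obtain as v bs where s1: "xs = as @ v # bs" and "\<forall>v. xs[k := v] = as @ v # bs"
      using tuple_split[OF smult(2,3)] by blast
    then have s2: "xs[k := v] = as @ v # bs" for v by blast
    have t: "as @ x # bs \<in> tuples M i" "as @ (a \<odot>\<^bsub>M\<^esub> x) # bs \<in> tuples M i"
      using smult(2,4,5) unfolding s1 by (auto simp: tuples_iff)
    show ?thesis
      unfolding smult(1) s2 using D(3)[OF smult(4) t(1)] D(1) t smult(4)
      by (simp add: L u e cancel)
  qed
qed

lemma zero_submodule: "submodule {\<zero>\<^bsub>M\<^esub>} R M"
  by (rule submoduleI) (auto simp: M.minus_equality)

lemma alternating_kills_ext_rels:
  assumes N: "module R N" and \<phi>: "alternating R M N i \<phi>" and f: "f \<in> ext_rels R M i"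
  shows "lext R N \<phi> f = \<zero>\<^bsub>N\<^esub>"
proof -
  interpret N: module R N by fact
  interpret F: module R "free_tuples R M i" by (rule free_tuples_module)
  note D = alternatingD[OF \<phi>]
  have lin: "linear R (free_tuples R M i) N (lext R N \<phi>)" by (rule N.lext_linear) (rule multilinearD(1)[OF D(1)])
  let ?K = "{f \<in> carrier (free_tuples R M i). lext R N \<phi> f \<in> {\<zero>\<^bsub>N\<^esub>}}"
  have "submodule ?K R (free_tuples R M i)"
    by (rule linear_preimage_submodule[OF F.module_axioms N lin N.zero_submodule])
  moreover have unit: "lext R N \<phi> (unit_vec R xs) = \<zero>\<^bsub>N\<^esub>" if "xs \<in> tuples M i" "\<not> distinct xs" for xs
    using N.lext_unit_vec[of "tuples M i" \<phi> xs] multilinearD(1)[OF D(1)] D(2) that by simp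
  have "multilinear_rels R M i \<union> {unit_vec R xs | xs. xs \<in> tuples M i \<and> \<not> distinct xs} \<subseteq> ?K"
  proof
    fix f assume f: "f \<in> multilinear_rels R M i \<union> {unit_vec R xs | xs. xs \<in> tuples M i \<and> \<not> distinct xs}"
    then have "lext R N \<phi> f = \<zero>\<^bsub>N\<^esub>" by (elim UnE CollectE exE conjE) (simp_all add: unit multilinear_kills_rels[OF N D(1)])
    then show "f \<in> ?K" using subsetD[OF ext_gens_carrier f] by simp
  qed
  ultimately have "ext_rels R M i \<subseteq> ?K" unfolding ext_rels_def by (rule span_module_least)
  then show ?thesis using f by blast
qed

lemma alternating_swap:
  assumes N: "module R N" and \<phi>: "alternating R M N i \<phi>" and t: "as @ x # y # bs \<in> tuples M i"
  shows "\<phi> (as @ x # y # bs) = \<ominus>\<^bsub>N\<^esub> \<phi> (as @ y # x # bs)"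
proof -
  interpret N: module R N by fact
  note A = alternatingD[OF \<phi>]
  note D = multilinearD[OF A(1)]
  have xy: "x \<in> carrier M" "y \<in> carrier M" using t by (auto simp: tuples_iff)
  have t': "as @ u # v # bs \<in> tuples M i" if "u \<in> carrier M" "v \<in> carrier M" for u v
    using t that by (auto simp: tuples_iff)
  have c: "\<phi> (as @ u # v # bs) \<in> carrier N" if "u \<in> carrier M" "v \<in> carrier M" for u v
    using D(1) t' that by blast
  have 0: "\<phi> (as @ u # u # bs) = \<zero>\<^bsub>N\<^esub>" if "u \<in> carrier M" for u
    using A(2)[OF t'[OF that that]] by simp
  have add2: "\<phi> (as @ u # (x \<oplus>\<^bsub>M\<^esub> y) # bs) = \<phi> (as @ u # x # bs) \<oplus>\<^bsub>N\<^esub> \<phi> (as @ u # y # bs)" if "u \<in> carrier M" for u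
    using D(2)[of "as @ [u]" x bs y] t'[OF that xy(1)] xy by simp
  have "\<zero>\<^bsub>N\<^esub> = \<phi> (as @ (x \<oplus>\<^bsub>M\<^esub> y) # (x \<oplus>\<^bsub>M\<^esub> y) # bs)" using 0 xy by simp
  also have "\<dots> = \<phi> (as @ x # (x \<oplus>\<^bsub>M\<^esub> y) # bs) \<oplus>\<^bsub>N\<^esub> \<phi> (as @ y # (x \<oplus>\<^bsub>M\<^esub> y) # bs)"
    using D(2)[of as x "(x \<oplus>\<^bsub>M\<^esub> y) # bs" y] t' xy by simp
  also have "\<dots> = \<phi> (as @ x # y # bs) \<oplus>\<^bsub>N\<^esub> \<phi> (as @ y # x # bs)"
    using add2 0 xy c by simp
  finally show ?thesis using N.M.minus_equality[of "\<phi> (as @ x # y # bs)" "\<phi> (as @ y # x # bs)"] c xy by simp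
qed

lemma alternating_move:
  assumes N: "module R N" and \<phi>: "alternating R M N i \<phi>" and t: "as @ v # bs @ cs \<in> tuples M i"
  shows "\<phi> (as @ bs @ v # cs) = (if even (length bs) then \<phi> (as @ v # bs @ cs) else \<ominus>\<^bsub>N\<^esub> \<phi> (as @ v # bs @ cs))"
  using t
proof (induction bs arbitrary: as)
  case (Cons b bs)
  interpret N: module R N by fact
  have c: "\<phi> (as @ v # b # bs @ cs) \<in> carrier N"
    using multilinearD(1)[OF alternatingD(1)[OF \<phi>]] Cons.prems by simp
  have "(as @ [b]) @ v # bs @ cs \<in> tuples M i" using Cons.prems by (auto simp: tuples_iff)
  from Cons.IH[OF this] alternating_swap[OF N \<phi>, of as b v "bs @ cs"] Cons.prems c
  show ?case by (auto simp: tuples_iff)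
qed simp

end

section \<open>The Koszul differential on exterior powers\<close>

definition del_nth :: "nat \<Rightarrow> 'b list \<Rightarrow> 'b list" where
  "del_nth j xs = take j xs @ drop (Suc j) xs"

lemma del_nth_append:
  "j < length as \<Longrightarrow> del_nth j (as @ bs) = del_nth j as @ bs"
  "del_nth (length as) (as @ x # bs) = as @ bs"
  "length as < j \<Longrightarrow> del_nth j (as @ x # bs) = as @ x # del_nth (j - Suc (length as)) bs"
  by (auto simp: del_nth_def Suc_diff_Suc drop_Cons' take_Cons')

lemma length_del_nth: "j < length xs \<Longrightarrow> length (del_nth j xs) = length xs - 1"
  by (simp add: del_nth_def)

lemma set_del_nth: "set (del_nth j xs) \<subseteq> set xs"
  by (auto simp: del_nth_def dest: in_set_takeD in_set_dropD)

lemma del_nth_tuples: "xs \<in> tuples M (Suc i) \<Longrightarrow> j < Suc i \<Longrightarrow> del_nth j xs \<in> tuples M i"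
  using set_del_nth[of j xs] by (auto simp: tuples_iff length_del_nth)

lemma linear_comp: "linear R M N h \<Longrightarrow> linear R N P k \<Longrightarrow> linear R M P (\<lambda>x. k (h x))"
  unfolding linear_def by simp

text \<open>
  The differential applied to an alternating map in place of the tuples themselves. With the universal
  alternating map it is the differential of the exterior powers, and \<open>contraction_alternating\<close> is the
  reason why that differential is well defined.
\<close>

definition contraction :: "('a, 'p) ring_scheme \<Rightarrow> ('a, 'c, 's) module_scheme \<Rightarrow> ('b \<Rightarrow> 'a) \<Rightarrow> nat \<Rightarrow> ('b list \<Rightarrow> 'c) \<Rightarrow> 'b list \<Rightarrow> 'c"
  where "contraction R N \<chi> i \<phi> xs = (\<Oplus>\<^bsub>N\<^esub>j\<in>{..<i}.
     (if even j then \<chi> (xs ! j) else \<ominus>\<^bsub>R\<^esub> \<chi> (xs ! j)) \<odot>\<^bsub>N\<^esub> \<phi> (del_nth j xs))"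

locale module_form = module +
  fixes \<chi> assumes form: "linear R M (self_module R) \<chi>"
begin

lemma form_simps:
  "x \<in> carrier M \<Longrightarrow> \<chi> x \<in> carrier R"
  "x \<in> carrier M \<Longrightarrow> y \<in> carrier M \<Longrightarrow> \<chi> (x \<oplus>\<^bsub>M\<^esub> y) = \<chi> x \<oplus> \<chi> y"
  "a \<in> carrier R \<Longrightarrow> x \<in> carrier M \<Longrightarrow> \<chi> (a \<odot>\<^bsub>M\<^esub> x) = a \<otimes> \<chi> x"
  using linearD[OF form] by (simp_all add: self_module_def)

text \<open>
  If two entries of the tuple coincide, only the two summands that delete one of them survive. They
  differ by moving the remaining entry past those in between, and cancel.
\<close>

lemma contraction_alternating:
  assumes N: "module R N" and \<phi>: "alternating R M N i \<phi>"
  shows "alternating R M N (Suc i) (contraction R N \<chi> (Suc i) \<phi>)"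
proof -
  interpret N: module R N by fact
  note A = alternatingD[OF \<phi>]
  note D = multilinearD[OF A(1)]
  define T where "T xs j = (if even j then \<chi> (xs ! j) else \<ominus> \<chi> (xs ! j)) \<odot>\<^bsub>N\<^esub> \<phi> (del_nth j xs)" for xs j
  have sum: "contraction R N \<chi> (Suc i) \<phi> xs = (\<Oplus>\<^bsub>N\<^esub>j\<in>{..<Suc i}. T xs j)" for xs
    by (simp add: contraction_def T_def)
  have nth: "xs ! j \<in> carrier M" if "xs \<in> tuples M k" "j < k" for xs j k
    using that by (auto simp: tuples_iff)
  have coeff: "(if even j then \<chi> (xs ! j) else \<ominus> \<chi> (xs ! j)) \<in> carrier R" if "xs \<in> tuples M k" "j < k" for xs j k
    using nth[OF that] form_simps(1) by simp
  have T_closed: "T xs j \<in> carrier N" if "xs \<in> tuples M (Suc i)" "j < Suc i" for xs j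
    unfolding T_def by (intro N.smult_closed coeff[OF that] D(1) del_nth_tuples that)
  have T_add: "T (as @ (x \<oplus>\<^bsub>M\<^esub> y) # bs) j = T (as @ x # bs) j \<oplus>\<^bsub>N\<^esub> T (as @ y # bs) j"
    and T_smult: "a \<in> carrier R \<Longrightarrow> T (as @ (a \<odot>\<^bsub>M\<^esub> x) # bs) j = a \<odot>\<^bsub>N\<^esub> T (as @ x # bs) j"
    if t: "as @ x # bs \<in> tuples M (Suc i)" and y: "y \<in> carrier M" and j: "j < Suc i" for as x y bs j a
  proof -
    have x: "x \<in> carrier M" using t by (auto simp: tuples_iff)
    note d = del_nth_tuples[OF t j]
    have ty: "as @ y # bs \<in> tuples M (Suc i)" using t y by (auto simp: tuples_iff)
    note dy = del_nth_tuples[OF ty j]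
    note cf = coeff[OF t j]
    consider "j < length as" | "j = length as" | "length as < j" by linarith
    then have "T (as @ (x \<oplus>\<^bsub>M\<^esub> y) # bs) j = T (as @ x # bs) j \<oplus>\<^bsub>N\<^esub> T (as @ y # bs) j \<and>
      (a \<in> carrier R \<longrightarrow> T (as @ (a \<odot>\<^bsub>M\<^esub> x) # bs) j = a \<odot>\<^bsub>N\<^esub> T (as @ x # bs) j)"
    proof cases
      case 1
      define c where "c = (if even j then \<chi> (as ! j) else \<ominus> \<chi> (as ! j))"
      have "(as @ x # bs) ! j = as ! j" using 1 by (simp add: nth_append)
      with cf have c: "c \<in> carrier R" by (simp only: c_def)
      have T: "T (as @ u # bs) j = c \<odot>\<^bsub>N\<^esub> \<phi> (del_nth j as @ u # bs)" for u
        using 1 by (simp add: T_def c_def nth_append del_nth_append)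
      have d': "del_nth j as @ x # bs \<in> tuples M i" "del_nth j as @ y # bs \<in> tuples M i"
        using d dy 1 by (simp_all add: del_nth_append)
      show ?thesis
        unfolding T using D(2)[OF d'(1) y] D(3)[OF _ d'(1)] D(1)[OF d'(1)] D(1)[OF d'(2)] c
        by (simp add: N.smult_r_distr R.m_comm flip: N.smult_assoc1)
    next
      case 2
      define p where "p = \<phi> (as @ bs)"
      have p: "p \<in> carrier N" using D(1)[OF d] 2 by (simp add: p_def del_nth_append)
      have T: "T (as @ u # bs) j = (if even j then \<chi> u else \<ominus> \<chi> u) \<odot>\<^bsub>N\<^esub> p" for u
        using 2 by (simp add: T_def p_def del_nth_append)
      show ?thesis
        unfolding T using p x y
        by (simp add: form_simps N.smult_l_distr N.smult_assoc1 R.minus_add flip: R.r_minus)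
    next
      case 3
      define k where "k = j - Suc (length as)"
      define c where "c = (if even j then \<chi> (bs ! k) else \<ominus> \<chi> (bs ! k))"
      have n: "(as @ u # bs) ! j = bs ! k" for u using 3 by (simp add: nth_append nth_Cons' k_def)
      have c: "c \<in> carrier R" using cf by (simp only: c_def n)
      have T: "T (as @ u # bs) j = c \<odot>\<^bsub>N\<^esub> \<phi> (as @ u # del_nth k bs)" for u
        using 3 by (simp add: T_def c_def n del_nth_append k_def)
      have d': "as @ x # del_nth k bs \<in> tuples M i" "as @ y # del_nth k bs \<in> tuples M i"
        using d dy 3 by (simp_all add: del_nth_append k_def)
      show ?thesis
        unfolding T using D(2)[OF d'(1) y] D(3)[OF _ d'(1)] D(1)[OF d'(1)] D(1)[OF d'(2)] c
        by (simp add: N.smult_r_distr R.m_comm flip: N.smult_assoc1)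
    qed
    then show "T (as @ (x \<oplus>\<^bsub>M\<^esub> y) # bs) j = T (as @ x # bs) j \<oplus>\<^bsub>N\<^esub> T (as @ y # bs) j"
      and "a \<in> carrier R \<Longrightarrow> T (as @ (a \<odot>\<^bsub>M\<^esub> x) # bs) j = a \<odot>\<^bsub>N\<^esub> T (as @ x # bs) j" by blast+
  qed
  show ?thesis
    unfolding alternating_def multilinear_def sum
  proof (intro conjI ballI allI impI)
    fix xs assume "xs \<in> tuples M (Suc i)"
    then show "(\<Oplus>\<^bsub>N\<^esub>j\<in>{..<Suc i}. T xs j) \<in> carrier N" by (intro N.M.finsum_closed) (auto simp: T_closed)
  next
    fix as x y bs assume t: "as @ x # bs \<in> tuples M (Suc i)" and y: "y \<in> carrier M"
    have ty: "as @ y # bs \<in> tuples M (Suc i)" using t y by (auto simp: tuples_iff)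
    have "(\<Oplus>\<^bsub>N\<^esub>j\<in>{..<Suc i}. T (as @ (x \<oplus>\<^bsub>M\<^esub> y) # bs) j) = (\<Oplus>\<^bsub>N\<^esub>j\<in>{..<Suc i}. T (as @ x # bs) j \<oplus>\<^bsub>N\<^esub> T (as @ y # bs) j)"
      by (rule N.M.finsum_cong') (auto simp: T_add[OF t y] T_closed[OF t] T_closed[OF ty])
    also have "\<dots> = (\<Oplus>\<^bsub>N\<^esub>j\<in>{..<Suc i}. T (as @ x # bs) j) \<oplus>\<^bsub>N\<^esub> (\<Oplus>\<^bsub>N\<^esub>j\<in>{..<Suc i}. T (as @ y # bs) j)"
      by (rule N.M.finsum_addf) (auto simp: T_closed[OF t] T_closed[OF ty])
    finally show "(\<Oplus>\<^bsub>N\<^esub>j\<in>{..<Suc i}. T (as @ (x \<oplus>\<^bsub>M\<^esub> y) # bs) j) =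
      (\<Oplus>\<^bsub>N\<^esub>j\<in>{..<Suc i}. T (as @ x # bs) j) \<oplus>\<^bsub>N\<^esub> (\<Oplus>\<^bsub>N\<^esub>j\<in>{..<Suc i}. T (as @ y # bs) j)" .
  next
    fix as x bs a assume a: "a \<in> carrier R" and t: "as @ x # bs \<in> tuples M (Suc i)"
    have x: "x \<in> carrier M" using t by (auto simp: tuples_iff)
    have "(\<Oplus>\<^bsub>N\<^esub>j\<in>{..<Suc i}. T (as @ (a \<odot>\<^bsub>M\<^esub> x) # bs) j) = (\<Oplus>\<^bsub>N\<^esub>j\<in>{..<Suc i}. a \<odot>\<^bsub>N\<^esub> T (as @ x # bs) j)"
      by (rule N.M.finsum_cong') (auto simp: T_smult[OF t x _ a] T_closed[OF t] a)
    also have "\<dots> = a \<odot>\<^bsub>N\<^esub> (\<Oplus>\<^bsub>N\<^esub>j\<in>{..<Suc i}. T (as @ x # bs) j)"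
      by (rule N.finsum_smult_ldistr[symmetric]) (auto simp: T_closed[OF t] a)
    finally show "(\<Oplus>\<^bsub>N\<^esub>j\<in>{..<Suc i}. T (as @ (a \<odot>\<^bsub>M\<^esub> x) # bs) j) = a \<odot>\<^bsub>N\<^esub> (\<Oplus>\<^bsub>N\<^esub>j\<in>{..<Suc i}. T (as @ x # bs) j)" .
  next
    fix xs assume t: "xs \<in> tuples M (Suc i)" and "\<not> distinct xs"
    then obtain as v bs cs where xs: "xs = as @ [v] @ bs @ [v] @ cs" using not_distinct_decomp by blast
    define p q where "p = length as" and "q = Suc (length as + length bs)"
    have v: "v \<in> carrier M" using t xs by (auto simp: tuples_iff)
    have pq: "p < q" "q < Suc i" using t xs by (auto simp: tuples_iff p_def q_def)
    have "as @ v # bs @ cs \<in> tuples M i" using t xs by (auto simp: tuples_iff)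
    note mv = alternating_move[OF N \<phi> this] and cl = D(1)[OF this]
    have zero: "T xs j = \<zero>\<^bsub>N\<^esub>" if j: "j < Suc i" "j \<noteq> p" "j \<noteq> q" for j
    proof -
      consider "j < p" | "p < j" "j < q" | "q < j" using j by linarith
      then have "\<not> distinct (del_nth j xs)"
      proof cases
        case 1
        then show ?thesis unfolding xs by (simp add: del_nth_append p_def)
      next
        case 2
        then have "del_nth j xs = as @ v # del_nth (j - Suc (length as)) bs @ v # cs"
          unfolding xs by (simp add: del_nth_append p_def q_def)
        then show ?thesis by simp
      next
        case 3
        then have "del_nth j xs = as @ v # bs @ v # del_nth (j - Suc (length (as @ v # bs))) cs"
          unfolding xs using del_nth_append(3)[of "as @ v # bs" j v cs] by (simp add: q_def)
        then show ?thesis by simp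
      qed
      then have "\<phi> (del_nth j xs) = \<zero>\<^bsub>N\<^esub>" using A(2) del_nth_tuples[OF t j(1)] by blast
      then show ?thesis unfolding T_def using coeff[OF t j(1)] by simp
    qed
    have dp: "del_nth p xs = as @ bs @ v # cs" "xs ! p = v"
      unfolding xs p_def by (simp_all add: del_nth_append)
    have dq: "del_nth q xs = as @ v # bs @ cs" "xs ! q = v"
      unfolding xs q_def using del_nth_append(2)[of "as @ v # bs" v cs] nth_append_length[of "as @ v # bs" v cs] by simp_all
    have "T xs p \<oplus>\<^bsub>N\<^esub> T xs q = \<zero>\<^bsub>N\<^esub>"
      unfolding T_def dp dq mv using cl form_simps(1)[OF v]
      by (auto simp: p_def q_def N.smult_l_minus N.smult_r_minus N.M.r_neg N.M.l_neg)
    moreover have "(\<Oplus>\<^bsub>N\<^esub>j\<in>{..<Suc i}. T xs j) = (\<Oplus>\<^bsub>N\<^esub>j\<in>{p, q}. T xs j)"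
      by (rule N.M.add.finprod_mono_neutral_cong_right) (use pq zero T_closed[OF t] in auto)
    moreover have "(\<Oplus>\<^bsub>N\<^esub>j\<in>{p, q}. T xs j) = T xs p \<oplus>\<^bsub>N\<^esub> T xs q"
      using pq T_closed[OF t] by simp
    ultimately show "(\<Oplus>\<^bsub>N\<^esub>j\<in>{..<Suc i}. T xs j) = \<zero>\<^bsub>N\<^esub>" by simp
  qed
qed

lemma koszul_on_tuple_contraction:
  "koszul_on_tuple R M \<chi> (Suc i) xs = contraction R (free_tuples R M i) \<chi> (Suc i) (unit_vec R) xs"
  by (simp add: koszul_on_tuple_def contraction_def del_nth_def)

lemma koszul_on_free_lext:
  "koszul_on_free R M \<chi> (Suc i) = lext R (free_tuples R M i) (koszul_on_tuple R M \<chi> (Suc i))"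
  by (simp add: koszul_on_free_def lext_def fun_eq_iff)

lemma koszul_term_closed:
  assumes "xs \<in> tuples M (Suc i)" "j < Suc i"
  shows "(if even j then \<chi> (xs ! j) else \<ominus> \<chi> (xs ! j)) \<in> carrier R"
    "unit_vec R (del_nth j xs) \<in> carrier (free_tuples R M i)"
proof -
  have "xs ! j \<in> carrier M" using assms by (auto simp: tuples_iff)
  then show "(if even j then \<chi> (xs ! j) else \<ominus> \<chi> (xs ! j)) \<in> carrier R" using form_simps(1) by simp
  show "unit_vec R (del_nth j xs) \<in> carrier (free_tuples R M i)"
    by (rule R.unit_vec_carrier[OF del_nth_tuples[OF assms]])
qed

lemma koszul_on_tuple_closed:
  assumes xs: "xs \<in> tuples M (Suc i)"
  shows "koszul_on_tuple R M \<chi> (Suc i) xs \<in> carrier (free_tuples R M i)"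
proof -
  interpret F: module R "free_tuples R M i" by (rule free_tuples_module)
  show ?thesis
    unfolding koszul_on_tuple_contraction contraction_def
    by (rule F.finsum_closed) (use koszul_term_closed[OF xs] in auto)
qed

lemma koszul_on_free_linear:
  "linear R (free_tuples R M (Suc i)) (free_tuples R M i) (koszul_on_free R M \<chi> (Suc i))"
  unfolding koszul_on_free_lext
  by (rule module.lext_linear[OF free_tuples_module koszul_on_tuple_closed])

lemma koszul_on_free_unit_vec:
  "xs \<in> tuples M (Suc i) \<Longrightarrow> koszul_on_free R M \<chi> (Suc i) (unit_vec R xs) = koszul_on_tuple R M \<chi> (Suc i) xs"
  unfolding koszul_on_free_lext
  by (rule module.lext_unit_vec[OF free_tuples_module koszul_on_tuple_closed])

text \<open>
  Identities between maps out of the complex are checked on tuples, where linear maps turn the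
  differential into a contraction.
\<close>

lemma linear_koszul_on_tuple:
  assumes N: "module R N" and k: "linear R (free_tuples R M i) N k" and xs: "xs \<in> tuples M (Suc i)"
  shows "k (koszul_on_tuple R M \<chi> (Suc i) xs) = contraction R N \<chi> (Suc i) (\<lambda>ys. k (unit_vec R ys)) xs"
proof -
  interpret F: module R "free_tuples R M i" by (rule free_tuples_module)
  interpret N: module R N by fact
  note c = koszul_term_closed[OF xs]
  have "k (koszul_on_tuple R M \<chi> (Suc i) xs) = (\<Oplus>\<^bsub>N\<^esub>j\<in>{..<Suc i}.
      k ((if even j then \<chi> (xs ! j) else \<ominus> \<chi> (xs ! j)) \<odot>\<^bsub>free_tuples R M i\<^esub> unit_vec R (del_nth j xs)))"
    unfolding koszul_on_tuple_contraction contraction_def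
    by (rule linear_finsum[OF F.module_axioms N k]) (use c in auto)
  also have "\<dots> = contraction R N \<chi> (Suc i) (\<lambda>ys. k (unit_vec R ys)) xs"
    unfolding contraction_def
    by (rule N.M.finsum_cong') (use c linearD(1,3)[OF k] in auto)
  finally show ?thesis .
qed

lemma koszul_on_free_ext_rels:
  assumes f: "f \<in> ext_rels R M (Suc i)"
  shows "koszul_on_free R M \<chi> (Suc i) f \<in> ext_rels R M i"
proof -
  interpret F: module R "free_tuples R M i" by (rule free_tuples_module)
  interpret F': module R "free_tuples R M (Suc i)" by (rule free_tuples_module)
  interpret X: module R "ext_power R M i" by (rule ext_power_module)
  let ?Q = "\<lambda>f. ext_rels R M i +>\<^bsub>free_tuples R M i\<^esub> f"
  let ?\<phi> = "contraction R (ext_power R M i) \<chi> (Suc i) (\<lambda>xs. ?Q (unit_vec R xs))"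
  have Q: "linear R (free_tuples R M i) (ext_power R M i) ?Q"
    unfolding ext_power_def by (rule F.quot_coset_linear[OF ext_rels_submodule])
  have alt: "alternating R M (ext_power R M i) (Suc i) ?\<phi>"
    by (rule contraction_alternating[OF X.module_axioms ext_class_alternating])
  note cl = multilinearD(1)[OF alternatingD(1)[OF alt]]
  have fc: "f \<in> carrier (free_tuples R M (Suc i))" using F'.submoduleD(2)[OF ext_rels_submodule f] .
  have "?Q (koszul_on_free R M \<chi> (Suc i) f) = lext R (ext_power R M i) ?\<phi> f"
  proof (rule linear_free_ext[OF X.module_axioms linear_comp[OF koszul_on_free_linear Q] _ _ fc])
    show "linear R (free_tuples R M (Suc i)) (ext_power R M i) (lext R (ext_power R M i) ?\<phi>)"
      by (rule X.lext_linear[OF cl])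
    fix xs assume xs: "xs \<in> tuples M (Suc i)"
    show "?Q (koszul_on_free R M \<chi> (Suc i) (unit_vec R xs)) = lext R (ext_power R M i) ?\<phi> (unit_vec R xs)"
      using koszul_on_free_unit_vec[OF xs] linear_koszul_on_tuple[OF X.module_axioms Q xs] X.lext_unit_vec[OF cl xs] by simp
  qed
  also have "\<dots> = \<zero>\<^bsub>ext_power R M i\<^esub>" by (rule alternating_kills_ext_rels[OF X.module_axioms alt f])
  finally show ?thesis
    using F.coset_eq_self_iff[OF ext_rels_submodule linearD(1)[OF koszul_on_free_linear fc]]
    by (simp add: ext_power_def quot_zero)
qed

lemma koszul_diff_coset:
  assumes "f \<in> carrier (free_tuples R M (Suc i))"
  shows "koszul_diff R M \<chi> (Suc i) (ext_rels R M (Suc i) +>\<^bsub>free_tuples R M (Suc i)\<^esub> f)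
    = ext_rels R M i +>\<^bsub>free_tuples R M i\<^esub> koszul_on_free R M \<chi> (Suc i) f"
  unfolding koszul_diff_def
  using coset_map_coset[OF free_tuples_module free_tuples_module koszul_on_free_linear
      ext_rels_submodule ext_rels_submodule koszul_on_free_ext_rels assms] by simp

lemma ext_power_carrier:
  "carrier (ext_power R M i) = (\<lambda>f. ext_rels R M i +>\<^bsub>free_tuples R M i\<^esub> f) ` carrier (free_tuples R M i)"
  unfolding ext_power_def by (rule module.quot_carrier[OF free_tuples_module])

definition free_cycles :: "nat \<Rightarrow> ('c list \<Rightarrow> 'a) set" where
  "free_cycles i = {f \<in> carrier (free_tuples R M i). i = 0 \<or> koszul_on_free R M \<chi> i f \<in> ext_rels R M (i - 1)}"

lemma koszul_cycles_eq:
  "koszul_cycles R M \<chi> i = (\<lambda>f. ext_rels R M i +>\<^bsub>free_tuples R M i\<^esub> f) ` free_cycles i"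
proof (cases i)
  case 0
  then show ?thesis by (auto simp: koszul_cycles_def free_cycles_def ext_power_carrier)
next
  case (Suc k)
  interpret F: module R "free_tuples R M k" by (rule free_tuples_module)
  have "koszul_diff R M \<chi> (Suc k) (ext_rels R M (Suc k) +>\<^bsub>free_tuples R M (Suc k)\<^esub> f) = \<zero>\<^bsub>ext_power R M k\<^esub>
      \<longleftrightarrow> koszul_on_free R M \<chi> (Suc k) f \<in> ext_rels R M k"
    if "f \<in> carrier (free_tuples R M (Suc k))" for f
    using F.coset_eq_self_iff[OF ext_rels_submodule linearD(1)[OF koszul_on_free_linear that]] koszul_diff_coset[OF that]
    by (simp add: ext_power_def quot_zero)
  then show ?thesis unfolding Suc koszul_cycles_def free_cycles_def ext_power_carrier by auto
qed

lemma free_cycles_smult: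
  assumes "f \<in> free_cycles i" "a \<in> carrier R"
  shows "a \<odot>\<^bsub>free_tuples R M i\<^esub> f \<in> free_cycles i"
proof -
  interpret F: module R "free_tuples R M i" by (rule free_tuples_module)
  show ?thesis
  proof (cases i)
    case 0
    then show ?thesis using assms by (simp add: free_cycles_def F.smult_closed[unfolded 0])
  next
    case (Suc k)
    interpret G: module R "free_tuples R M k" by (rule free_tuples_module)
    show ?thesis
      using assms F.smult_closed linearD(3)[OF koszul_on_free_linear, of a f k] G.submoduleD(4)[OF ext_rels_submodule]
      unfolding free_cycles_def Suc by simp
  qed
qed

text \<open>
  Cosets of the boundaries are formed in all of \<open>\<And>\<^sup>iM\<close>; those of cycles make up the homology.
\<close>

lemma trunc_koszul_boundaries_submodule:
  "submodule (trunc_koszul_boundaries R M \<chi> r i) R (ext_power R M i)"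
proof (cases "i < r")
  case True
  interpret F: module R "free_tuples R M i" by (rule free_tuples_module)
  have "trunc_koszul_boundaries R M \<chi> r i =
      (\<lambda>g. ext_rels R M i +>\<^bsub>free_tuples R M i\<^esub> koszul_on_free R M \<chi> (Suc i) g) ` carrier (free_tuples R M (Suc i))"
    using True koszul_diff_coset by (simp add: trunc_koszul_boundaries_def ext_power_carrier image_image)
  moreover have "linear R (free_tuples R M i) (ext_power R M i) (\<lambda>f. ext_rels R M i +>\<^bsub>free_tuples R M i\<^esub> f)"
    unfolding ext_power_def by (rule F.quot_coset_linear[OF ext_rels_submodule])
  ultimately show ?thesis
    using linear_image_submodule[OF free_tuples_module ext_power_module linear_comp[OF koszul_on_free_linear]] by simp
next
  case False
  then show ?thesis using module.zero_submodule[OF ext_power_module] by (simp add: trunc_koszul_boundaries_def)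
qed

lemma coset_carrier_update: "K +>\<^bsub>N\<lparr>carrier := Z\<rparr>\<^esub> y = K +>\<^bsub>N\<^esub> y"
  by (simp add: a_r_coset_def r_coset_def)

lemma quot_smult_update:
  "a \<odot>\<^bsub>quot_module (N\<lparr>carrier := Z\<rparr>) K\<^esub> Y = a \<odot>\<^bsub>quot_module N K\<^esub> Y"
  by (simp add: quot_module_def coset_carrier_update)

lemma homology_carrier:
  "carrier (trunc_koszul_homology R M \<chi> r i) =
    (\<lambda>y. trunc_koszul_boundaries R M \<chi> r i +>\<^bsub>ext_power R M i\<^esub> y) ` koszul_cycles R M \<chi> i"
  unfolding trunc_koszul_homology_def quot_module_def by (auto simp: A_RCOSETS_def' coset_carrier_update)

lemma homology_smult:
  assumes a: "a \<in> carrier R" and f: "f \<in> free_cycles i"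
  shows "a \<odot>\<^bsub>trunc_koszul_homology R M \<chi> r i\<^esub>
      (trunc_koszul_boundaries R M \<chi> r i +>\<^bsub>ext_power R M i\<^esub> (ext_rels R M i +>\<^bsub>free_tuples R M i\<^esub> f))
    = trunc_koszul_boundaries R M \<chi> r i +>\<^bsub>ext_power R M i\<^esub> (ext_rels R M i +>\<^bsub>free_tuples R M i\<^esub> (a \<odot>\<^bsub>free_tuples R M i\<^esub> f))"
proof -
  interpret F: module R "free_tuples R M i" by (rule free_tuples_module)
  interpret X: module R "ext_power R M i" by (rule ext_power_module)
  have fc: "f \<in> carrier (free_tuples R M i)" using f by (simp add: free_cycles_def)
  then have "ext_rels R M i +>\<^bsub>free_tuples R M i\<^esub> f \<in> carrier (ext_power R M i)" by (simp add: ext_power_carrier)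
  from X.quot_smult[OF trunc_koszul_boundaries_submodule this a]
  show ?thesis
    using F.quot_smult[OF ext_rels_submodule fc a]
    unfolding trunc_koszul_homology_def quot_smult_update ext_power_def[symmetric] by simp
qed

lemma homology_smult_closed:
  assumes "a \<in> carrier R" "Y \<in> carrier (trunc_koszul_homology R M \<chi> r i)"
  shows "a \<odot>\<^bsub>trunc_koszul_homology R M \<chi> r i\<^esub> Y \<in> carrier (trunc_koszul_homology R M \<chi> r i)"
proof -
  obtain f where f: "f \<in> free_cycles i"
    "Y = trunc_koszul_boundaries R M \<chi> r i +>\<^bsub>ext_power R M i\<^esub> (ext_rels R M i +>\<^bsub>free_tuples R M i\<^esub> f)"
    using assms(2) unfolding homology_carrier koszul_cycles_eq by blast
  show ?thesis
    unfolding f(2) homology_smult[OF assms(1) f(1)] unfolding homology_carrier koszul_cycles_eq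
    using free_cycles_smult[OF f(1) assms(1)] by blast
qed

text \<open>
  The two cases are the two definitions of the boundaries in the truncated complex: in degree \<open>r\<close> nothing
  comes from the left.
\<close>

lemma homology_killed:
  assumes d: "d \<in> carrier R" and f: "f \<in> free_cycles i"
    and kill: "\<And>Y. Y \<in> carrier (trunc_koszul_homology R M \<chi> r i) \<Longrightarrow>
      d \<odot>\<^bsub>trunc_koszul_homology R M \<chi> r i\<^esub> Y = \<zero> \<odot>\<^bsub>trunc_koszul_homology R M \<chi> r i\<^esub> Y"
  shows "i < r \<Longrightarrow> \<exists>g\<in>carrier (free_tuples R M (Suc i)).
      d \<odot>\<^bsub>free_tuples R M i\<^esub> f \<ominus>\<^bsub>free_tuples R M i\<^esub> koszul_on_free R M \<chi> (Suc i) g \<in> ext_rels R M i"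
    and "i = r \<Longrightarrow> d \<odot>\<^bsub>free_tuples R M i\<^esub> f \<in> ext_rels R M i"
proof -
  interpret F: module R "free_tuples R M i" by (rule free_tuples_module)
  interpret X: module R "ext_power R M i" by (rule ext_power_module)
  let ?K = "trunc_koszul_boundaries R M \<chi> r i" and ?E = "ext_rels R M i" and ?F = "free_tuples R M i"
  have fc: "f \<in> carrier ?F" using f by (simp add: free_cycles_def)
  then have dfc: "d \<odot>\<^bsub>?F\<^esub> f \<in> carrier ?F" using d by simp
  have "?K +>\<^bsub>ext_power R M i\<^esub> (?E +>\<^bsub>?F\<^esub> f) \<in> carrier (trunc_koszul_homology R M \<chi> r i)"
    unfolding homology_carrier koszul_cycles_eq using f by blast
  from kill[OF this] have "?K +>\<^bsub>ext_power R M i\<^esub> (?E +>\<^bsub>?F\<^esub> (d \<odot>\<^bsub>?F\<^esub> f)) = ?K +>\<^bsub>ext_power R M i\<^esub> (?E +>\<^bsub>?F\<^esub> (\<zero> \<odot>\<^bsub>?F\<^esub> f))"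
    by (simp only: homology_smult[OF d f] homology_smult[OF R.zero_closed f])
  also have "?E +>\<^bsub>?F\<^esub> (\<zero> \<odot>\<^bsub>?F\<^esub> f) = \<zero>\<^bsub>ext_power R M i\<^esub>"
    using F.coset_zero[OF ext_rels_submodule] fc by (simp add: ext_power_def quot_zero)
  finally have "?K +>\<^bsub>ext_power R M i\<^esub> (?E +>\<^bsub>?F\<^esub> (d \<odot>\<^bsub>?F\<^esub> f)) = ?K"
    using X.coset_zero[OF trunc_koszul_boundaries_submodule] by simp
  then have mem: "?E +>\<^bsub>?F\<^esub> (d \<odot>\<^bsub>?F\<^esub> f) \<in> ?K"
    using X.coset_eq_self_iff[OF trunc_koszul_boundaries_submodule] dfc by (simp add: ext_power_carrier)
  show "\<exists>g\<in>carrier (free_tuples R M (Suc i)). d \<odot>\<^bsub>?F\<^esub> f \<ominus>\<^bsub>?F\<^esub> koszul_on_free R M \<chi> (Suc i) g \<in> ?E" if "i < r"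
  proof -
    obtain g where g: "g \<in> carrier (free_tuples R M (Suc i))"
      "?E +>\<^bsub>?F\<^esub> (d \<odot>\<^bsub>?F\<^esub> f) = ?E +>\<^bsub>?F\<^esub> koszul_on_free R M \<chi> (Suc i) g"
      using mem \<open>i < r\<close> koszul_diff_coset by (auto simp: trunc_koszul_boundaries_def ext_power_carrier)
    then show ?thesis
      using F.coset_eq_iff[OF ext_rels_submodule dfc linearD(1)[OF koszul_on_free_linear g(1)]] by blast
  qed
  show "d \<odot>\<^bsub>?F\<^esub> f \<in> ?E" if "i = r"
    using mem that F.coset_eq_self_iff[OF ext_rels_submodule dfc]
    by (simp add: trunc_koszul_boundaries_def ext_power_def quot_zero)
qed

end

text \<open>
  An isomorphism carries over the equality of the actions of two scalars. The second one will be zero,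
  which expresses being killed by \<open>a\<close> through the scalar multiplication alone.
\<close>

lemma module_isomorphic_killed:
  assumes iso: "module_isomorphic R H N" and "a \<in> carrier R" "b \<in> carrier R"
    and closed: "\<And>c Y. c \<in> carrier R \<Longrightarrow> Y \<in> carrier H \<Longrightarrow> c \<odot>\<^bsub>H\<^esub> Y \<in> carrier H"
    and kill: "\<And>Z. Z \<in> carrier N \<Longrightarrow> a \<odot>\<^bsub>N\<^esub> Z = b \<odot>\<^bsub>N\<^esub> Z"
    and Y: "Y \<in> carrier H"
  shows "a \<odot>\<^bsub>H\<^esub> Y = b \<odot>\<^bsub>H\<^esub> Y"
proof -
  obtain h where h: "linear R H N h" "inj_on h (carrier H)"
    using iso linear_mapsD unfolding module_isomorphic_def bij_betw_def by blast
  have "h (a \<odot>\<^bsub>H\<^esub> Y) = h (b \<odot>\<^bsub>H\<^esub> Y)"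
    using linearD[OF h(1)] Y assms(2,3) kill by simp
  then show ?thesis using h(2) closed Y assms(2,3) by (auto dest: inj_onD)
qed

section \<open>Wedge products in the explicit complex\<close>

abbreviation subsets_of_card :: "nat \<Rightarrow> nat \<Rightarrow> nat set set" where
  "subsets_of_card r i \<equiv> {S. S \<subseteq> {..<r} \<and> card S = i}"

definition wedges :: "nat \<Rightarrow> (nat \<Rightarrow> 's) list \<Rightarrow> (nat set \<Rightarrow> 's) \<Rightarrow> nat set \<Rightarrow> 's::comm_ring_1" where
  "wedges r us Y = foldr (wedge r) us Y"

abbreviation unit_chain :: "nat set \<Rightarrow> nat set \<Rightarrow> 's::comm_ring_1" where
  "unit_chain U \<equiv> \<lambda>S. if S = U then 1 else 0"

lemma wedges_simps [simp]:
  "wedges r [] Y = Y" "wedges r (u # us) Y = wedge r u (wedges r us Y)"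
  "wedges r (us @ vs) Y = wedges r us (wedges r vs Y)"
  by (simp_all add: wedges_def)

lemma wedges_chains: "Y \<in> koszul_chains r i \<Longrightarrow> wedges r us Y \<in> koszul_chains r (length us + i)"
  by (induction us) (auto intro: chains_wedge)

lemma unit_chain_chains: "U \<subseteq> {..<r} \<Longrightarrow> card U = i \<Longrightarrow> unit_chain U \<in> koszul_chains r i"
  by (simp add: koszul_chains_def)

lemma wedge_cong_mod:
  assumes K: "ideal_on K" and u: "\<And>t. t < r \<Longrightarrow> u t - v t \<in> K" and Y: "\<And>S. Y S - Z S \<in> K"
  shows "wedge r u Y S - wedge r v Z S \<in> K"
proof -
  note I = ideal_onD[OF K]
  have "wedge r u Y S - wedge r v Z S = (\<Sum>t<r. u t * (wedge1 t Y S - wedge1 t Z S) + (u t - v t) * wedge1 t Z S)"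
    by (simp add: wedge_def algebra_simps sum_subtractf sum.distrib)
  also have "\<dots> \<in> K"
  proof (intro ideal_on_sum[OF K] I(2))
    fix t assume t: "t \<in> {..<r}"
    have "wedge1 t Y S - wedge1 t Z S = (if t \<in> S then koszul_sign t S * (Y (S - {t}) - Z (S - {t})) else 0)"
      by (simp add: wedge1_def right_diff_distrib)
    then have "wedge1 t Y S - wedge1 t Z S \<in> K" using I(1) I(3)[OF Y] by auto
    then show "u t * (wedge1 t Y S - wedge1 t Z S) \<in> K" using I(3) by blast
    show "(u t - v t) * wedge1 t Z S \<in> K" using I(4) u t by blast
  qed
  finally show ?thesis .
qed

lemma wedges_cong_mod:
  assumes K: "ideal_on K" and Y: "\<And>S. Y S - Z S \<in> K"
  shows "wedges r us Y S - wedges r us Z S \<in> K"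
proof (induction us arbitrary: S)
  case (Cons u us)
  have "u t - u t \<in> K" for t using ideal_onD(1)[OF K] by simp
  then show ?case using wedge_cong_mod[OF K, of r u u "wedges r us Y" "wedges r us Z"] Cons.IH by simp
qed (use Y in simp)

lemma wedge_cong_finite:
  assumes "\<And>S. finite S \<Longrightarrow> Y S = Z S" "finite S" shows "wedge r u Y S = wedge r u Z S"
  using assms by (auto simp: wedge_def wedge1_def intro!: sum.cong)

lemma wedges_cong_finite:
  assumes "\<And>S. finite S \<Longrightarrow> Y S = Z S" "finite S" shows "wedges r us Y S = wedges r us Z S"
  using assms(2)
proof (induction us arbitrary: S)
  case (Cons u us)
  then show ?case using wedge_cong_finite[of "wedges r us Y" "wedges r us Z"] by simp
qed (use assms(1) in simp)

lemma wedge_lincomb: "wedge r u (\<lambda>S. x * Y S + y * Z S) S = x * wedge r u Y S + y * wedge r u Z S"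
  unfolding wedge_def sum_distrib_left sum.distrib[symmetric]
  by (intro sum.cong refl) (simp add: wedge1_def algebra_simps)

lemma wedges_lincomb: "wedges r us (\<lambda>S. x * Y S + y * Z S) S = x * wedges r us Y S + y * wedges r us Z S"
proof (induction us arbitrary: S)
  case (Cons u us)
  have "wedges r us (\<lambda>S. x * Y S + y * Z S) = (\<lambda>S. x * wedges r us Y S + y * wedges r us Z S)"
    using Cons.IH by blast
  then show ?case by (simp add: wedge_lincomb)
qed simp

lemma wedge_coeff_add: "wedge r (\<lambda>t. x * u t + y * v t) Y S = x * wedge r u Y S + y * wedge r v Y S"
  unfolding wedge_def sum_distrib_left sum.distrib[symmetric]
  by (intro sum.cong refl) (simp add: algebra_simps)

lemma wedge_anticommute:
  assumes "finite S" shows "wedge r u (wedge r v Y) S = - wedge r v (wedge r u Y) S"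
proof -
  have w: "wedge r u (wedge r v Y) S = (\<Sum>s<r. \<Sum>t<r. u s * v t * wedge1 s (wedge1 t Y) S)" for u v
    unfolding wedge_def[of r u "wedge r v Y"] unfolding wedge_def[of r v Y, abs_def] wedge1_sum
    by (simp add: sum_distrib_left mult_ac)
  have "(\<Sum>s<r. \<Sum>t<r. u s * v t * wedge1 s (wedge1 t Y) S) = (\<Sum>s<r. \<Sum>t<r. - (v t * u s * wedge1 t (wedge1 s Y) S))"
  proof (intro sum.cong refl)
    fix s t show "u s * v t * wedge1 s (wedge1 t Y) S = - (v t * u s * wedge1 t (wedge1 s Y) S)"
      using wedge1_wedge1[OF assms, of s t Y] by (simp add: mult.commute)
  qed
  also have "\<dots> = - (\<Sum>t<r. \<Sum>s<r. v t * u s * wedge1 t (wedge1 s Y) S)"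
    by (subst sum.swap) (simp add: sum_negf)
  finally show ?thesis unfolding w .
qed

lemma wedge_wedges:
  assumes "finite S" shows "wedge r u (wedges r us Y) S = (- 1) ^ length us * wedges r us (wedge r u Y) S"
  using assms
proof (induction us arbitrary: S)
  case (Cons v us)
  have "wedge r u (wedge r v (wedges r us Y)) S = - wedge r v (wedge r u (wedges r us Y)) S"
    by (rule wedge_anticommute[OF Cons.prems])
  also have "wedge r v (wedge r u (wedges r us Y)) S
      = wedge r v (\<lambda>S. (- 1) ^ length us * wedges r us (wedge r u Y) S + 0 * Y S) S"
    by (rule wedge_cong_finite[OF _ Cons.prems]) (simp add: Cons.IH)
  also have "\<dots> = (- 1) ^ length us * wedge r v (wedges r us (wedge r u Y)) S"
    unfolding wedge_lincomb by simp
  finally show ?case by simp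
qed simp

lemma wedges_repeated:
  assumes "finite S" shows "wedges r (us @ [v] @ vs @ [v] @ ws) Y S = 0"
proof -
  have "wedge r v (wedges r vs (wedge r v Z)) S = 0" if "finite S" for S Z
  proof -
    have "wedges r vs (wedge r v (wedge r v Z)) S = wedges r vs (\<lambda>S. 0 * Z S + 0 * Z S) S"
      by (rule wedges_cong_finite[OF _ that]) (simp add: wedge_wedge_self)
    also have "\<dots> = 0" unfolding wedges_lincomb by simp
    finally show ?thesis using wedge_wedges[OF that, of r v vs "wedge r v Z"] by simp
  qed
  then have "wedges r us (wedge r v (wedges r vs (wedge r v (wedges r ws Y)))) S = wedges r us (\<lambda>S. 0 * Y S + 0 * Y S) S"
    by (intro wedges_cong_finite[OF _ assms]) simp
  also have "\<dots> = 0" unfolding wedges_lincomb by simp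
  finally show ?thesis by simp
qed

text \<open>
  By induction from the homotopy formula: the differential of a product of vectors is the alternating
  sum over the deleted factors. The values \<open>c u\<close> of the linear form matter only modulo \<open>K\<close>.
\<close>

lemma bd_wedges:
  assumes K: "ideal_on K" and c: "\<And>u. u \<in> set us \<Longrightarrow> (\<Sum>t<r. u t * a t) - c u \<in> K" and "finite S"
  shows "bd r a (wedges r us (unit_chain {})) S
    - (\<Sum>j<length us. (- 1) ^ j * c (us ! j) * wedges r (take j us @ drop (Suc j) us) (unit_chain {}) S) \<in> K"
  using c assms(3)
proof (induction us arbitrary: S)
  case Nil
  have "(unit_chain {} :: nat set \<Rightarrow> 'a) \<in> koszul_chains r 0" by (simp add: koszul_chains_def)
  from bd_zero_chains[OF this] show ?case using ideal_onD(1)[OF K] by simp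
next
  case (Cons u us)
  note I = ideal_onD[OF K]
  define Y where "Y = wedges r us (unit_chain {})"
  define Z where "Z j = wedges r (take j us @ drop (Suc j) us) (unit_chain {})" for j
  define Q where "Q S = (\<Sum>j<length us. (- 1) ^ j * c (us ! j) * Z j S)" for S
  define Q' where "Q' S = (if finite S then Q S else bd r a Y S)" for S
  have Q: "bd r a Y S - Q' S \<in> K" for S
    unfolding Q'_def Q_def Y_def Z_def using Cons.IH[of S] Cons.prems(1) I(1) by simp
  have "(\<Sum>j<length (u # us). (- 1) ^ j * c ((u # us) ! j) * wedges r (take j (u # us) @ drop (Suc j) (u # us)) (unit_chain {}) S)
      = c u * Y S - (\<Sum>j<length us. (- 1) ^ j * c (us ! j) * wedge r u (Z j) S)"
    unfolding Y_def Z_def by (simp add: sum.lessThan_Suc_shift sum_negf del: sum.lessThan_Suc)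
  also have "(\<Sum>j<length us. (- 1) ^ j * c (us ! j) * wedge r u (Z j) S) = wedge r u Q S"
    unfolding Q_def wedge_sum ..
  also have "wedge r u Q S = wedge r u Q' S"
    by (rule wedge_cong_finite[OF _ Cons.prems(2)]) (simp add: Q'_def)
  finally have R: "(\<Sum>j<length (u # us). (- 1) ^ j * c ((u # us) ! j) * wedges r (take j (u # us) @ drop (Suc j) (u # us)) (unit_chain {}) S)
      = c u * Y S - wedge r u Q' S" .
  have "bd r a (wedges r (u # us) (unit_chain {})) S - (c u * Y S - wedge r u Q' S)
      = ((\<Sum>t<r. u t * a t) - c u) * Y S - (wedge r u (bd r a Y) S - wedge r u Q' S)"
    unfolding wedges_simps Y_def[symmetric] bd_wedge[OF Cons.prems(2)] by (simp add: algebra_simps)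
  also have "\<dots> \<in> K"
  proof (rule I(6))
    have "(\<Sum>t<r. u t * a t) - c u \<in> K" by (rule Cons.prems(1)) simp
    then show "((\<Sum>t<r. u t * a t) - c u) * Y S \<in> K" by (rule I(4))
    show "wedge r u (bd r a Y) S - wedge r u Q' S \<in> K"
      by (rule wedge_cong_mod[OF K _ Q]) (simp add: I(1))
  qed
  finally show ?case unfolding R .
qed

lemma wedge_unit_chain:
  assumes s: "s < r" "\<forall>x\<in>U. s < x" and u: "\<And>t. u t = (if t = s then d else 0)"
  shows "wedge r u (\<lambda>S. x * unit_chain U S) S = d * x * unit_chain (insert s U) S"
proof -
  have "wedge r u (\<lambda>S. x * unit_chain U S) S = (\<Sum>t<r. if t = s then d * wedge1 s (\<lambda>S. x * unit_chain U S) S else 0)"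
    unfolding wedge_def by (intro sum.cong refl) (simp add: u)
  also have "\<dots> = d * wedge1 s (\<lambda>S. x * unit_chain U S) S" using s(1) by simp
  also have "wedge1 s (\<lambda>S. x * unit_chain U S) S = x * unit_chain (insert s U) S"
  proof (cases "S = insert s U")
    case True
    have e: "{y \<in> S. y < s} = {}" using True s(2) by auto
    have "koszul_sign s S = (1::'a)" by (simp only: koszul_sign_def e card.empty power_0)
    moreover have "S - {s} = U" using True s(2) by auto
    ultimately show ?thesis using True by (simp add: wedge1_def)
  next
    case False
    then have "\<not> (s \<in> S \<and> S - {s} = U)" by auto
    then show ?thesis using False by (auto simp: wedge1_def)
  qed
  finally show ?thesis by (simp add: mult.assoc)
qed

lemma wedges_sorted:
  assumes K: "ideal_on K" and "sorted ss" "distinct ss" "set ss \<subseteq> {..<r}"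
    and u: "\<And>s t. s \<in> set ss \<Longrightarrow> t < r \<Longrightarrow> u s t - (if t = s then d else 0) \<in> K"
  shows "wedges r (map u ss) (unit_chain {}) S - d ^ length ss * unit_chain (set ss) S \<in> K"
  using assms(2-)
proof (induction ss arbitrary: S)
  case Nil
  then show ?case using ideal_onD(1)[OF K] by simp
next
  case (Cons s ss)
  have s: "s < r" "\<forall>x\<in>set ss. s < x" using Cons.prems by (auto simp: order.strict_iff_order)
  have IH: "wedges r (map u ss) (unit_chain {}) S - d ^ length ss * unit_chain (set ss) S \<in> K" for S
    by (rule Cons.IH) (use Cons.prems in auto)
  have "wedge r (u s) (wedges r (map u ss) (unit_chain {})) S
     - wedge r (\<lambda>t. if t = s then d else 0) (\<lambda>S. d ^ length ss * unit_chain (set ss) S) S \<in> K"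
    by (rule wedge_cong_mod[OF K _ IH]) (use Cons.prems(4) in auto)
  then show ?case
    using wedge_unit_chain[OF s, of "\<lambda>t. if t = s then d else 0" d "d ^ length ss" S] by simp
qed

lemma koszul_sign_nth:
  assumes "finite S" "j < card S"
  shows "koszul_sign (sorted_list_of_set S ! j) S = ((- 1) ^ j :: 's::comm_ring_1)"
proof -
  define ss where "ss = sorted_list_of_set S"
  have ss: "sorted ss" "distinct ss" "set ss = S" "length ss = card S"
    using assms by (auto simp: ss_def)
  have lt: "ss ! i < ss ! j \<longleftrightarrow> i < j" if "i < card S" for i
    using sorted_wrt_nth_less[of "(<)" ss] strict_sorted_iff ss assms(2) that
    by (metis (no_types, lifting) linorder_neqE_nat order.asym order.irrefl)
  have "{s \<in> S. s < ss ! j} = (\<lambda>i. ss ! i) ` {..<j}"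
  proof safe
    fix s assume "s \<in> S" "s < ss ! j"
    then obtain i where "i < card S" "s = ss ! i" using ss by (metis in_set_conv_nth)
    then show "s \<in> (\<lambda>i. ss ! i) ` {..<j}" using lt \<open>s < ss ! j\<close> by auto
  next
    fix i assume "i < j"
    then show "ss ! i \<in> S" "ss ! i < ss ! j" using assms(2) ss lt[of i] nth_mem[of i ss] by auto
  qed
  moreover have "inj_on (\<lambda>i. ss ! i) {..<j}"
    using ss assms(2) by (auto simp: inj_on_def nth_eq_iff_index_eq)
  ultimately show ?thesis by (simp add: koszul_sign_def ss_def[symmetric] card_image)
qed

text \<open>
  The differential described on basis elements (left) and on coefficients (right), both paired with an
  arbitrary function \<open>g\<close>. The bijection matches a set \<open>S\<close> with a chosen element \<open>t\<close> to \<open>S - {t}\<close> and \<open>t\<close>.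
\<close>

lemma bd_adjoint:
  fixes Y :: "nat set \<Rightarrow> 's::comm_ring_1"
  shows "(\<Sum>S\<in>subsets_of_card r (Suc i). Y S * (\<Sum>j<Suc i. (- 1) ^ j * a (sorted_list_of_set S ! j) * g (S - {sorted_list_of_set S ! j})))
    = (\<Sum>T\<in>subsets_of_card r i. g T * bd r a Y T)"
proof -
  have fin: "finite S" if "S \<in> subsets_of_card r k" for S k using that finite_subset by auto
  have finA: "finite (subsets_of_card r k)" for k
    by (rule finite_subset[of _ "Pow {..<r}"]) auto
  have "(\<Sum>S\<in>subsets_of_card r (Suc i). Y S * (\<Sum>j<Suc i. (- 1) ^ j * a (sorted_list_of_set S ! j) * g (S - {sorted_list_of_set S ! j})))
    = (\<Sum>S\<in>subsets_of_card r (Suc i). \<Sum>t\<in>S. Y S * (koszul_sign t S * a t * g (S - {t})))"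
  proof (rule sum.cong[OF refl])
    fix S assume S: "S \<in> subsets_of_card r (Suc i)"
    have f: "finite S" using fin[OF S] .
    have c: "card S = Suc i" using S by simp
    have bij: "bij_betw (\<lambda>j. sorted_list_of_set S ! j) {..<Suc i} S"
      using f c by (intro bij_betw_nth) auto
    have "(\<Sum>t\<in>S. koszul_sign t S * a t * g (S - {t})) = (\<Sum>j<Suc i. (- 1) ^ j * a (sorted_list_of_set S ! j) * g (S - {sorted_list_of_set S ! j}))"
      unfolding sum.reindex_bij_betw[OF bij, symmetric]
      by (rule sum.cong[OF refl]) (simp add: koszul_sign_nth[OF f] c)
    then show "Y S * (\<Sum>j<Suc i. (- 1) ^ j * a (sorted_list_of_set S ! j) * g (S - {sorted_list_of_set S ! j}))
      = (\<Sum>t\<in>S. Y S * (koszul_sign t S * a t * g (S - {t})))" by (simp only: sum_distrib_left[symmetric])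
  qed
  also have "\<dots> = (\<Sum>(S, t)\<in>Sigma (subsets_of_card r (Suc i)) (\<lambda>S. S). Y S * (koszul_sign t S * a t * g (S - {t})))"
  proof (rule sum.Sigma)
    show "finite (subsets_of_card r (Suc i))" by (rule finA)
    show "\<forall>S\<in>subsets_of_card r (Suc i). finite S" using fin by (intro ballI)
  qed
  also have "\<dots> = (\<Sum>(T, t)\<in>Sigma (subsets_of_card r i) (\<lambda>T. {..<r} - T). Y (insert t T) * (koszul_sign t T * a t * g T))"
  proof (rule sum.reindex_bij_witness[of _ "\<lambda>(T, t). (insert t T, t)" "\<lambda>(S, t). (S - {t}, t)"])
    fix p assume "p \<in> Sigma (subsets_of_card r (Suc i)) (\<lambda>S. S)"
    then obtain S t where p: "p = (S, t)" "S \<in> subsets_of_card r (Suc i)" "t \<in> S" by auto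
    have f: "finite S" using fin[OF p(2)] .
    show "(case case p of (S, t) \<Rightarrow> (S - {t}, t) of (T, t) \<Rightarrow> (insert t T, t)) = p" using p by auto
    show "(case p of (S, t) \<Rightarrow> (S - {t}, t)) \<in> Sigma (subsets_of_card r i) (\<lambda>T. {..<r} - T)"
      using p f by auto
    show "(case case p of (S, t) \<Rightarrow> (S - {t}, t) of (T, t) \<Rightarrow> Y (insert t T) * (koszul_sign t T * a t * g T)) =
      (case p of (S, t) \<Rightarrow> Y S * (koszul_sign t S * a t * g (S - {t})))"
      using p f by (simp add: insert_absorb koszul_sign_remove)
  next
    fix q assume "q \<in> Sigma (subsets_of_card r i) (\<lambda>T. {..<r} - T)"
    then obtain T t where q: "q = (T, t)" "T \<in> subsets_of_card r i" "t < r" "t \<notin> T" by auto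
    have f: "finite T" using fin[OF q(2)] .
    show "(case case q of (T, t) \<Rightarrow> (insert t T, t) of (S, t) \<Rightarrow> (S - {t}, t)) = q" using q by auto
    show "(case q of (T, t) \<Rightarrow> (insert t T, t)) \<in> Sigma (subsets_of_card r (Suc i)) (\<lambda>S. S)"
      using q f by auto
  qed
  also have "\<dots> = (\<Sum>T\<in>subsets_of_card r i. \<Sum>t\<in>{..<r} - T. Y (insert t T) * (koszul_sign t T * a t * g T))"
  proof (rule sum.Sigma[symmetric])
    show "finite (subsets_of_card r i)" by (rule finA)
  qed simp
  also have "\<dots> = (\<Sum>T\<in>subsets_of_card r i. g T * bd r a Y T)"
  proof (rule sum.cong[OF refl])
    fix T
    have "g T * bd r a Y T = (\<Sum>t<r. g T * (a t * contr t Y T))" by (simp add: bd_def sum_distrib_left)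
    also have "\<dots> = (\<Sum>t\<in>{..<r} - T. g T * (a t * contr t Y T))"
      by (rule sum.mono_neutral_right) (auto simp: contr_def)
    also have "\<dots> = (\<Sum>t\<in>{..<r} - T. Y (insert t T) * (koszul_sign t T * a t * g T))"
      by (rule sum.cong[OF refl]) (simp add: contr_def mult_ac)
    finally show "(\<Sum>t\<in>{..<r} - T. Y (insert t T) * (koszul_sign t T * a t * g T)) = g T * bd r a Y T" by simp
  qed
  finally show ?thesis .
qed

section \<open>Comparison of the two Koszul complexes\<close>

text \<open>
  The data provided by a module \<open>M\<close> that becomes free with basis \<open>e\<^sub>0, \<dots>, e\<^bsub>r-1\<^esub>\<close> after inverting \<open>d\<close>: the linear forms \<open>p\<^sub>t\<close>
  are \<open>d\<close> times the coordinates. Only the consequence of \<open>d x = \<Sum>\<^sub>t p\<^sub>t(x) e\<^sub>t\<close> for the values of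
  \<open>\<chi>\<close> is recorded.
\<close>

locale split_form = module_form +
  fixes d :: "'a fcring" and r :: nat and e :: "nat \<Rightarrow> 'c" and p :: "nat \<Rightarrow> 'c \<Rightarrow> 'a"
  assumes e_closed: "t < r \<Longrightarrow> e t \<in> carrier M"
    and p_linear: "t < r \<Longrightarrow> linear R M (self_module R) (p t)"
    and p_e: "s < r \<Longrightarrow> t < r \<Longrightarrow> p t (e s) = (if t = s then ev d else \<zero>)"
    and p_form: "x \<in> carrier M \<Longrightarrow> (\<Oplus>t\<in>{..<r}. p t x \<otimes> \<chi> (e t)) = ev d \<otimes> \<chi> x"
begin

definition a :: "nat \<Rightarrow> 'a fcring" where "a t = fcring_var (\<chi> (e t))"
definition u :: "'c \<Rightarrow> nat \<Rightarrow> 'a fcring" where "u x t = fcring_var (p t x)"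
text \<open>
  The product of the images of the entries under \<open>p\<close>, built from left multiplications, which supply
  multilinearity and the alternating property.
\<close>

definition w :: "'c list \<Rightarrow> nat set \<Rightarrow> 'a fcring" where "w xs = wedges r (map u xs) (unit_chain {})"
definition \<phi> :: "'c list \<Rightarrow> nat set \<Rightarrow> 'a" where "\<phi> xs = (\<lambda>S. ev (w xs S))"
abbreviation N :: "nat \<Rightarrow> ('a, nat set \<Rightarrow> 'a) module" where "N i \<equiv> free_module R (subsets_of_card r i)"

lemma ev_a: "t < r \<Longrightarrow> ev (a t) = \<chi> (e t)"
  by (simp add: a_def form_simps e_closed)

lemma p_simps:
  assumes "t < r"
  shows "x \<in> carrier M \<Longrightarrow> p t x \<in> carrier R"
    "x \<in> carrier M \<Longrightarrow> y \<in> carrier M \<Longrightarrow> p t (x \<oplus>\<^bsub>M\<^esub> y) = p t x \<oplus> p t y"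
    "c \<in> carrier R \<Longrightarrow> x \<in> carrier M \<Longrightarrow> p t (c \<odot>\<^bsub>M\<^esub> x) = c \<otimes> p t x"
  using linearD[OF p_linear[OF assms]] by (simp_all add: self_module_def)

lemma ev_u: "t < r \<Longrightarrow> x \<in> carrier M \<Longrightarrow> ev (u x t) = p t x"
  by (simp add: u_def p_simps)

lemma w_append: "w (as @ x # bs) = wedges r (map u as) (wedge r (u x) (w bs))"
  by (simp add: w_def)

lemma w_chains: "w xs \<in> koszul_chains r (length xs)"
  using wedges_chains[OF unit_chain_chains[of "{}" r 0], of "map u xs"] by (simp add: w_def)

lemma finite_subsets_of_card: "finite (subsets_of_card r i)"
  by (rule finite_subset[of _ "Pow {..<r}"]) auto

lemma chain_carrier:
  assumes "Y \<in> koszul_chains r i" shows "(\<lambda>S. ev (Y S)) \<in> carrier (N i)"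
proof -
  have s: "{S. ev (Y S) \<noteq> \<zero>} \<subseteq> subsets_of_card r i"
  proof
    fix S assume "S \<in> {S. ev (Y S) \<noteq> \<zero>}"
    then have "Y S \<noteq> 0" by auto
    then show "S \<in> subsets_of_card r i" using assms by (simp add: koszul_chains_def)
  qed
  then show ?thesis using finite_subset[OF s finite_subsets_of_card] by (auto simp: free_module_def)
qed

lemma N_module: "module R (N i)"
  by (rule R.free_module_module)

lemma wedge_slot:
  assumes "\<And>t. t < r \<Longrightarrow> u z t - (x * u v t + y * u v' t) \<in> R.ker"
  shows "ev (w (as @ z # bs) S) = ev x \<otimes> ev (w (as @ v # bs) S) \<oplus> ev y \<otimes> ev (w (as @ v' # bs) S)"
proof -
  have "wedge r (u z) (w bs) S - wedge r (\<lambda>t. x * u v t + y * u v' t) (w bs) S \<in> R.ker" for S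
    by (rule wedge_cong_mod[OF R.ker_ideal assms]) (simp_all add: ideal_onD(1)[OF R.ker_ideal])
  then have "wedge r (u z) (w bs) S - (x * wedge r (u v) (w bs) S + y * wedge r (u v') (w bs) S) \<in> R.ker" for S
    unfolding wedge_coeff_add .
  from wedges_cong_mod[OF R.ker_ideal this, of r "map u as"]
  have "w (as @ z # bs) S - (x * w (as @ v # bs) S + y * w (as @ v' # bs) S) \<in> R.ker"
    unfolding w_append wedges_lincomb .
  then show ?thesis unfolding R.ker_diff_iff by simp
qed

lemma \<phi>_alternating: "alternating R M (N i) i \<phi>"
  unfolding alternating_def multilinear_def
proof (intro conjI ballI allI impI)
  interpret N: module R "N i" by (rule N_module)
  fix xs assume "xs \<in> tuples M i"
  then show "\<phi> xs \<in> carrier (N i)"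
    using chain_carrier[OF w_chains[of xs]] by (simp add: \<phi>_def tuples_iff)
next
  fix as x y bs assume t: "as @ x # bs \<in> tuples M i" and y: "y \<in> carrier M"
  have x: "x \<in> carrier M" using t by (auto simp: tuples_iff)
  have "u (x \<oplus>\<^bsub>M\<^esub> y) t - (1 * u x t + 1 * u y t) \<in> R.ker" if "t < r" for t
    unfolding R.ker_diff_iff using that x y by (simp add: ev_u p_simps)
  from wedge_slot[OF this, of as bs]
  show "\<phi> (as @ (x \<oplus>\<^bsub>M\<^esub> y) # bs) = \<phi> (as @ x # bs) \<oplus>\<^bsub>N i\<^esub> \<phi> (as @ y # bs)"
    by (intro ext) (simp add: \<phi>_def R.free_ops)
next
  fix as x bs c assume c: "c \<in> carrier R" and t: "as @ x # bs \<in> tuples M i"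
  have x: "x \<in> carrier M" using t by (auto simp: tuples_iff)
  have "u (c \<odot>\<^bsub>M\<^esub> x) t - (fcring_var c * u x t + 0 * u x t) \<in> R.ker" if "t < r" for t
    unfolding R.ker_diff_iff using that x c by (simp add: ev_u p_simps)
  from wedge_slot[OF this, of as bs]
  show "\<phi> (as @ (c \<odot>\<^bsub>M\<^esub> x) # bs) = c \<odot>\<^bsub>N i\<^esub> \<phi> (as @ x # bs)"
    using c by (intro ext) (simp add: \<phi>_def R.free_ops)
next
  fix xs assume "xs \<in> tuples M i" "\<not> distinct xs"
  then obtain as v bs cs where xs: "xs = as @ [v] @ bs @ [v] @ cs" using not_distinct_decomp by blast
  have "w xs S = 0" for S
  proof (cases "finite S")
    case True
    then show ?thesis using wedges_repeated[of S r "map u as" "u v" "map u bs" "map u cs"] by (simp add: w_def xs)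
  next
    case False
    then show ?thesis using chains_finite[OF w_chains] by blast
  qed
  then show "\<phi> xs = \<zero>\<^bsub>N i\<^esub>" by (simp add: \<phi>_def R.free_ops)
qed

text \<open>
  The induced map from \<open>\<And>\<^sup>iM\<close> to the explicit complex, on the level of representatives.
\<close>

definition P :: "nat \<Rightarrow> ('c list \<Rightarrow> 'a) \<Rightarrow> nat set \<Rightarrow> 'a" where "P i = lext R (N i) \<phi>"

lemmas \<phi>_closed = multilinearD(1)[OF alternatingD(1)[OF \<phi>_alternating]]

lemma P_linear: "linear R (free_tuples R M i) (N i) (P i)"
  unfolding P_def by (rule module.lext_linear[OF N_module \<phi>_closed])

lemma P_unit_vec: "xs \<in> tuples M i \<Longrightarrow> P i (unit_vec R xs) = \<phi> xs"
  unfolding P_def by (rule module.lext_unit_vec[OF N_module \<phi>_closed])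

lemma P_ext_rels: "f \<in> ext_rels R M i \<Longrightarrow> P i f = \<zero>\<^bsub>N i\<^esub>"
  unfolding P_def by (rule alternating_kills_ext_rels[OF N_module \<phi>_alternating])

definition lift :: "(nat set \<Rightarrow> 'a) \<Rightarrow> nat set \<Rightarrow> 'a fcring" where
  "lift g S = (if g S = \<zero> then 0 else fcring_var (g S))"

lemma ev_lift: "g \<in> carrier (N i) \<Longrightarrow> ev (lift g S) = g S"
  using R.free_carrierD(1)[of g] by (simp add: lift_def)

lemma lift_chains: "g \<in> carrier (N i) \<Longrightarrow> lift g \<in> koszul_chains r i"
  using R.free_carrierD(3)[of g "subsets_of_card r i"] unfolding koszul_chains_def lift_def by auto

text \<open>
  The explicit differential, as a map between free modules over the record ring.
\<close>

definition B :: "(nat set \<Rightarrow> 'a) \<Rightarrow> nat set \<Rightarrow> 'a" where "B g S = ev (bd r a (lift g) S)"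

lemma B_ev:
  assumes "\<And>S. ev (Y S) = g S" "g \<in> carrier (N i)"
  shows "B g S = ev (bd r a Y S)"
proof -
  have "bd r a (lift g) S - bd r a Y S \<in> R.ker"
    by (rule bd_cong_mod[OF R.ker_ideal]) (simp add: R.ker_diff_iff ev_lift[OF assms(2)] assms(1))
  then show ?thesis by (simp add: B_def R.ker_diff_iff)
qed

lemma B_linear: "linear R (N (Suc i)) (N i) B"
  unfolding linear_def
proof (intro conjI ballI)
  interpret N: module R "N (Suc i)" by (rule N_module)
  fix g assume g: "g \<in> carrier (N (Suc i))"
  show "B g \<in> carrier (N i)"
    using chain_carrier[OF chains_bd[OF lift_chains[OF g]]] by (simp add: B_def[abs_def])
  {
    fix h assume h: "h \<in> carrier (N (Suc i))"
    have "B (g \<oplus>\<^bsub>N (Suc i)\<^esub> h) S = ev (bd r a (\<lambda>S. 1 * lift g S - (- 1) * lift h S) S)" for S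
      by (rule B_ev[OF _ N.a_closed[OF g h]]) (simp add: R.free_ops ev_lift[OF g] ev_lift[OF h])
    then show "B (g \<oplus>\<^bsub>N (Suc i)\<^esub> h) = B g \<oplus>\<^bsub>N i\<^esub> B h"
      unfolding bd_lin by (intro ext) (simp add: R.free_ops B_def)
  }
  fix c assume c: "c \<in> carrier R"
  have "B (c \<odot>\<^bsub>N (Suc i)\<^esub> g) S = ev (bd r a (\<lambda>S. fcring_var c * lift g S - 0 * lift g S) S)" for S
    by (rule B_ev[OF _ N.smult_closed[OF c g]]) (simp add: R.free_ops ev_lift[OF g] c)
  then show "B (c \<odot>\<^bsub>N (Suc i)\<^esub> g) = c \<odot>\<^bsub>N i\<^esub> B g"
    unfolding bd_lin using c by (intro ext) (simp add: R.free_ops B_def)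
qed

lemma B_\<phi>:
  assumes xs: "xs \<in> tuples M (Suc i)"
  shows "B (\<phi> xs) = ev d \<odot>\<^bsub>N i\<^esub> P i (koszul_on_tuple R M \<chi> (Suc i) xs)"
proof (rule ext)
  fix S
  interpret N: module R "N i" by (rule N_module)
  have len: "length xs = Suc i" and xc: "\<And>j. j < Suc i \<Longrightarrow> xs ! j \<in> carrier M" using xs by (auto simp: tuples_iff)
  define c where "c j = (if even j then \<chi> (xs ! j) else \<ominus> \<chi> (xs ! j))" for j
  have c: "c j \<in> carrier R" if "j < Suc i" for j using xc[OF that] by (simp add: c_def form_simps)
  have \<phi>c: "\<phi> (del_nth j xs) \<in> carrier (N i)" if "j < Suc i" for j
    by (rule \<phi>_closed[OF del_nth_tuples[OF xs that]])
  have "P i (koszul_on_tuple R M \<chi> (Suc i) xs) = (\<Oplus>\<^bsub>N i\<^esub>j\<in>{..<Suc i}. c j \<odot>\<^bsub>N i\<^esub> P i (unit_vec R (del_nth j xs)))"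
    unfolding linear_koszul_on_tuple[OF N_module P_linear xs] contraction_def c_def ..
  also have "\<dots> = (\<Oplus>\<^bsub>N i\<^esub>j\<in>{..<Suc i}. c j \<odot>\<^bsub>N i\<^esub> \<phi> (del_nth j xs))"
    by (rule N.finsum_cong') (auto simp: P_unit_vec del_nth_tuples[OF xs] c \<phi>c)
  finally have "P i (koszul_on_tuple R M \<chi> (Suc i) xs) S = (\<Oplus>j\<in>{..<Suc i}. (c j \<odot>\<^bsub>N i\<^esub> \<phi> (del_nth j xs)) S)"
    using R.free_finsum_apply[of "{..<Suc i}" "\<lambda>j. c j \<odot>\<^bsub>N i\<^esub> \<phi> (del_nth j xs)"] c \<phi>c by auto
  also have "\<dots> = (\<Oplus>j\<in>{..<Suc i}. ev ((- 1) ^ j * fcring_var (\<chi> (xs ! j)) * w (del_nth j xs) S))"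
  proof (rule R.finsum_cong')
    fix j assume "j \<in> {..<Suc i}"
    then have "\<chi> (xs ! j) \<in> carrier R" using xc form_simps by simp
    then show "(c j \<odot>\<^bsub>N i\<^esub> \<phi> (del_nth j xs)) S = ev ((- 1) ^ j * fcring_var (\<chi> (xs ! j)) * w (del_nth j xs) S)"
      by (simp add: R.free_ops c_def \<phi>_def R.l_minus)
  qed auto
  finally have rhs: "P i (koszul_on_tuple R M \<chi> (Suc i) xs) S
      = ev (\<Sum>j<Suc i. (- 1) ^ j * fcring_var (\<chi> (xs ! j)) * w (del_nth j xs) S)" by (simp only: R.ev_sum)
  show "B (\<phi> xs) S = (ev d \<odot>\<^bsub>N i\<^esub> P i (koszul_on_tuple R M \<chi> (Suc i) xs)) S"
  proof (cases "finite S")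
    case False
    have 1: "B (\<phi> xs) \<in> carrier (N i)" by (rule linearD(1)[OF B_linear \<phi>_closed[OF xs]])
    have 2: "ev d \<odot>\<^bsub>N i\<^esub> P i (koszul_on_tuple R M \<chi> (Suc i) xs) \<in> carrier (N i)"
      by (intro N.smult_closed linearD(1)[OF P_linear] koszul_on_tuple_closed xs) simp
    have 3: "S \<notin> subsets_of_card r i" using False finite_subset by auto
    show ?thesis unfolding R.free_carrierD(3)[OF 1 3] R.free_carrierD(3)[OF 2 3] ..
  next
    case True
    define us where "us = map u xs"
    have "B (\<phi> xs) S = ev (bd r a (w xs) S)"
      by (rule B_ev[OF _ \<phi>_closed[OF xs]]) (simp add: \<phi>_def)
    also have "\<dots> = ev (\<Sum>j<length us. (- 1) ^ j * (\<Sum>t<r. (us ! j) t * a t) * wedges r (take j us @ drop (Suc j) us) (unit_chain {}) S)"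
      using bd_wedges[OF R.ker_ideal _ True, where us = us and r = r and a = a and c = "\<lambda>v. \<Sum>t<r. v t * a t"]
      by (simp add: ideal_onD(1)[OF R.ker_ideal] R.ker_diff_iff w_def us_def)
    also have "\<dots> = (\<Oplus>j\<in>{..<Suc i}. ev ((- 1) ^ j) \<otimes> ev (\<Sum>t<r. u (xs ! j) t * a t) \<otimes> ev (w (del_nth j xs) S))"
      unfolding R.ev_sum
      by (intro R.finsum_cong') (auto simp: us_def len w_def del_nth_def take_map drop_map R.ev_sum)
    also have "\<dots> = (\<Oplus>j\<in>{..<Suc i}. ev (d * ((- 1) ^ j * fcring_var (\<chi> (xs ! j)) * w (del_nth j xs) S)))"
    proof (rule R.finsum_cong')
      fix j assume "j \<in> {..<Suc i}"
      then have x: "xs ! j \<in> carrier M" using xc by simp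
      have "ev (\<Sum>t<r. u (xs ! j) t * a t) = (\<Oplus>t\<in>{..<r}. p t (xs ! j) \<otimes> \<chi> (e t))"
        unfolding R.ev_sum by (rule R.finsum_cong') (auto simp: ev_u ev_a x p_simps form_simps e_closed)
      then show "ev ((- 1) ^ j) \<otimes> ev (\<Sum>t<r. u (xs ! j) t * a t) \<otimes> ev (w (del_nth j xs) S)
        = ev (d * ((- 1) ^ j * fcring_var (\<chi> (xs ! j)) * w (del_nth j xs) S))"
        using x form_simps(1)[OF x] by (simp add: p_form R.m_ac)
    qed auto
    also have "\<dots> = ev (d * (\<Sum>j<Suc i. (- 1) ^ j * fcring_var (\<chi> (xs ! j)) * w (del_nth j xs) S))"
      by (simp only: R.ev_sum[symmetric] sum_distrib_left)
    finally show ?thesis by (simp add: R.free_ops rhs)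
  qed
qed

text \<open>
  Since \<open>p\<close> maps \<open>e\<^sub>t\<close> to \<open>d\<close> times a basis vector, the linear form \<open>\<chi>\<close> corresponds to \<open>d \<chi>\<close>; hence the
  factor.
\<close>

lemma P_chain_map:
  assumes "f \<in> carrier (free_tuples R M (Suc i))"
  shows "B (P (Suc i) f) = ev d \<odot>\<^bsub>N i\<^esub> P i (koszul_on_free R M \<chi> (Suc i) f)"
proof -
  interpret N: module R "N i" by (rule N_module)
  have "linear R (N i) (N i) (\<lambda>g. ev d \<odot>\<^bsub>N i\<^esub> g)"
    unfolding linear_def by (simp add: N.smult_r_distr R.m_comm flip: N.smult_assoc1)
  from linear_comp[OF linear_comp[OF koszul_on_free_linear P_linear] this]
  show ?thesis
    by (rule linear_free_ext[OF N_module linear_comp[OF P_linear B_linear] _ _ assms])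
      (simp add: P_unit_vec koszul_on_free_unit_vec B_\<phi>)
qed

text \<open>
  The chain map in the other direction sends a basis element to the wedge product of the corresponding
  \<open>e\<^sub>t\<close>, in increasing order. Its composition with \<open>P\<close> is multiplication by \<open>d\<^sup>i\<close>.
\<close>

definition lst :: "nat set \<Rightarrow> 'c list" where "lst S = map e (sorted_list_of_set S)"

lemma lst_tuples: "S \<in> subsets_of_card r i \<Longrightarrow> lst S \<in> tuples M i"
  using e_closed finite_subset[of S "{..<r}"] by (auto simp: lst_def tuples_iff)

lemma \<phi>_lst:
  assumes S: "S \<in> subsets_of_card r i"
  shows "\<phi> (lst S) T = ev (d ^ i * unit_chain S T)"
proof -
  have fin: "finite S" using S finite_subset by auto
  have "wedges r (map (\<lambda>s. u (e s)) (sorted_list_of_set S)) (unit_chain {}) T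
     - d ^ length (sorted_list_of_set S) * unit_chain (set (sorted_list_of_set S)) T \<in> R.ker"
  proof (rule wedges_sorted[OF R.ker_ideal])
    fix s t assume "s \<in> set (sorted_list_of_set S)" "t < r"
    then show "u (e s) t - (if t = s then d else 0) \<in> R.ker"
      unfolding R.ker_diff_iff using S fin by (auto simp: ev_u e_closed p_e subset_iff)
  qed (use S fin in auto)
  then show ?thesis
    unfolding R.ker_diff_iff using S fin by (simp add: \<phi>_def w_def lst_def comp_def)
qed

definition \<iota> :: "nat \<Rightarrow> (nat set \<Rightarrow> 'a fcring) \<Rightarrow> 'c list \<Rightarrow> 'a" where
  "\<iota> i Y = (\<Oplus>\<^bsub>free_tuples R M i\<^esub>S\<in>subsets_of_card r i. ev (Y S) \<odot>\<^bsub>free_tuples R M i\<^esub> unit_vec R (lst S))"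

lemma \<iota>_terms: "S \<in> subsets_of_card r i \<Longrightarrow> ev (Y S) \<odot>\<^bsub>free_tuples R M i\<^esub> unit_vec R (lst S) \<in> carrier (free_tuples R M i)"
  by (intro module.smult_closed[OF free_tuples_module] R.unit_vec_carrier lst_tuples) auto

lemma \<iota>_closed: "\<iota> i Y \<in> carrier (free_tuples R M i)"
proof -
  interpret F: module R "free_tuples R M i" by (rule free_tuples_module)
  show ?thesis unfolding \<iota>_def by (rule F.finsum_closed) (use \<iota>_terms in blast)
qed

lemma linear_\<iota>:
  assumes N: "module R Q" and h: "linear R (free_tuples R M i) Q h"
  shows "h (\<iota> i Y) = (\<Oplus>\<^bsub>Q\<^esub>S\<in>subsets_of_card r i. ev (Y S) \<odot>\<^bsub>Q\<^esub> h (unit_vec R (lst S)))"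
proof -
  interpret Q: module R Q by fact
  have "h (\<iota> i Y) = (\<Oplus>\<^bsub>Q\<^esub>S\<in>subsets_of_card r i. h (ev (Y S) \<odot>\<^bsub>free_tuples R M i\<^esub> unit_vec R (lst S)))"
    unfolding \<iota>_def by (rule linear_finsum[OF free_tuples_module N h \<iota>_terms])
  also have "\<dots> = (\<Oplus>\<^bsub>Q\<^esub>S\<in>subsets_of_card r i. ev (Y S) \<odot>\<^bsub>Q\<^esub> h (unit_vec R (lst S)))"
  proof (rule Q.finsum_cong')
    show "(\<lambda>S. ev (Y S) \<odot>\<^bsub>Q\<^esub> h (unit_vec R (lst S))) \<in> subsets_of_card r i \<rightarrow> carrier Q"
      using linearD(1)[OF h R.unit_vec_carrier[OF lst_tuples]] by auto
    fix S assume "S \<in> subsets_of_card r i"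
    then show "h (ev (Y S) \<odot>\<^bsub>free_tuples R M i\<^esub> unit_vec R (lst S)) = ev (Y S) \<odot>\<^bsub>Q\<^esub> h (unit_vec R (lst S))"
      using linearD(3)[OF h _ R.unit_vec_carrier[OF lst_tuples]] by simp
  qed simp
  finally show ?thesis .
qed

lemma P_\<iota>:
  assumes Y: "Y \<in> koszul_chains r i"
  shows "P i (\<iota> i Y) T = ev (d ^ i * Y T)"
proof -
  interpret N: module R "N i" by (rule N_module)
  have \<phi>c: "\<phi> (lst S) \<in> carrier (N i)" if "S \<in> subsets_of_card r i" for S
    by (rule \<phi>_closed[OF lst_tuples[OF that]])
  have "P i (\<iota> i Y) = (\<Oplus>\<^bsub>N i\<^esub>S\<in>subsets_of_card r i. ev (Y S) \<odot>\<^bsub>N i\<^esub> P i (unit_vec R (lst S)))"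
    by (rule linear_\<iota>[OF N_module P_linear])
  then have "P i (\<iota> i Y) T = (\<Oplus>\<^bsub>N i\<^esub>S\<in>subsets_of_card r i. ev (Y S) \<odot>\<^bsub>N i\<^esub> P i (unit_vec R (lst S))) T"
    by (rule fun_cong)
  also have "\<dots> = (\<Oplus>S\<in>subsets_of_card r i. (ev (Y S) \<odot>\<^bsub>N i\<^esub> P i (unit_vec R (lst S))) T)"
    by (rule R.free_finsum_apply) (intro N.smult_closed linearD(1)[OF P_linear] R.unit_vec_carrier lst_tuples R.ev_simps)
  also have "\<dots> = (\<Oplus>S\<in>subsets_of_card r i. ev (Y S * (d ^ i * unit_chain S T)))"
    by (rule R.finsum_cong') (auto simp: R.free_ops P_unit_vec[OF lst_tuples] \<phi>_lst)
  also have "\<dots> = ev (\<Sum>S\<in>subsets_of_card r i. Y S * (d ^ i * unit_chain S T))" by (simp only: R.ev_sum)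
  also have "(\<Sum>S\<in>subsets_of_card r i. Y S * (d ^ i * unit_chain S T)) = (\<Sum>S\<in>subsets_of_card r i. if S = T then d ^ i * Y T else 0)"
    by (rule sum.cong) auto
  also have "\<dots> = d ^ i * Y T"
  proof (cases "T \<in> subsets_of_card r i")
    case True
    then show ?thesis using finite_subsets_of_card[of i] by simp
  next
    case False
    then have "Y T = 0" using Y unfolding koszul_chains_def by blast
    then show ?thesis using False by (simp add: sum.neutral)
  qed
  finally show ?thesis .
qed

lemma del_nth_lst:
  assumes S: "S \<in> subsets_of_card r i" and "j < i"
  shows "del_nth j (lst S) = lst (S - {sorted_list_of_set S ! j})"
proof -
  define ss where "ss = sorted_list_of_set S"
  have fin: "finite S" using S finite_subset by auto
  then have ss: "sorted ss" "distinct ss" "set ss = S" "length ss = i" using S by (auto simp: ss_def)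
  have s: "ss = take j ss @ ss ! j # drop (Suc j) ss" using \<open>j < i\<close> ss(4) by (simp add: id_take_nth_drop)
  have "del_nth j ss = remove1 (ss ! j) ss"
  proof -
    have "ss ! j \<notin> set (take j ss)" using ss(2) s by (metis disjoint_iff distinct_append list.set_intros(1))
    then show ?thesis using s unfolding del_nth_def by (metis remove1.simps(2) remove1_append)
  qed
  also have "\<dots> = sorted_list_of_set (S - {ss ! j})"
    unfolding ss_def by (rule sorted_list_of_set.sorted_key_list_of_set_remove[OF fin, symmetric])
  finally have "map e (del_nth j ss) = lst (S - {ss ! j})" by (simp add: lst_def)
  then show ?thesis by (simp add: lst_def ss_def[symmetric] del_nth_def take_map drop_map)
qed

lemma koszul_\<iota>:
  assumes cyc: "\<And>S. bd r a Y S \<in> R.ker"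
  shows "koszul_on_free R M \<chi> (Suc i) (\<iota> (Suc i) Y) = \<zero>\<^bsub>free_tuples R M i\<^esub>"
proof (rule ext)
  fix ys
  interpret F: module R "free_tuples R M i" by (rule free_tuples_module)
  define g :: "nat set \<Rightarrow> 'a fcring" where "g T = (if ys = lst T then 1 else 0)" for T
  have kt: "koszul_on_tuple R M \<chi> (Suc i) (lst S) ys
      = ev (\<Sum>j<Suc i. (- 1) ^ j * a (sorted_list_of_set S ! j) * g (S - {sorted_list_of_set S ! j}))"
    if S: "S \<in> subsets_of_card r (Suc i)" for S
  proof -
    have fin: "finite S" using S finite_subset by auto
    note tc = koszul_term_closed[OF lst_tuples[OF S]]
    have "koszul_on_tuple R M \<chi> (Suc i) (lst S) ys = (\<Oplus>j\<in>{..<Suc i}. ((if even j then \<chi> (lst S ! j) else \<ominus> \<chi> (lst S ! j))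
        \<odot>\<^bsub>free_tuples R M i\<^esub> unit_vec R (del_nth j (lst S))) ys)"
      unfolding koszul_on_tuple_contraction contraction_def
      by (rule R.free_finsum_apply) (intro F.smult_closed tc; simp)
    also have "\<dots> = (\<Oplus>j\<in>{..<Suc i}. ev ((- 1) ^ j * a (sorted_list_of_set S ! j) * g (S - {sorted_list_of_set S ! j})))"
    proof (rule R.finsum_cong')
      fix j assume j: "j \<in> {..<Suc i}"
      have "sorted_list_of_set S ! j \<in> S" using fin S j nth_mem[of j "sorted_list_of_set S"] by simp
      then have lt: "sorted_list_of_set S ! j < r" using S by auto
      have l: "lst S ! j = e (sorted_list_of_set S ! j)" using S fin j by (simp add: lst_def)
      have del: "del_nth j (lst S) = lst (S - {sorted_list_of_set S ! j})" by (rule del_nth_lst[OF S]) (use j in simp)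
      show "((if even j then \<chi> (lst S ! j) else \<ominus> \<chi> (lst S ! j)) \<odot>\<^bsub>free_tuples R M i\<^esub> unit_vec R (del_nth j (lst S))) ys
        = ev ((- 1) ^ j * a (sorted_list_of_set S ! j) * g (S - {sorted_list_of_set S ! j}))"
        unfolding l del using ev_a[OF lt] form_simps(1)[OF e_closed[OF lt]]
        by (simp add: R.free_ops unit_vec_def g_def R.l_minus)
    qed auto
    finally show ?thesis by (simp only: R.ev_sum)
  qed
  have "koszul_on_free R M \<chi> (Suc i) (\<iota> (Suc i) Y)
      = (\<Oplus>\<^bsub>free_tuples R M i\<^esub>S\<in>subsets_of_card r (Suc i). ev (Y S) \<odot>\<^bsub>free_tuples R M i\<^esub> koszul_on_free R M \<chi> (Suc i) (unit_vec R (lst S)))"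
    by (rule linear_\<iota>[OF F.module_axioms koszul_on_free_linear])
  then have "koszul_on_free R M \<chi> (Suc i) (\<iota> (Suc i) Y) ys
      = (\<Oplus>\<^bsub>free_tuples R M i\<^esub>S\<in>subsets_of_card r (Suc i). ev (Y S) \<odot>\<^bsub>free_tuples R M i\<^esub> koszul_on_free R M \<chi> (Suc i) (unit_vec R (lst S))) ys"
    by (rule fun_cong)
  also have "\<dots> = (\<Oplus>S\<in>subsets_of_card r (Suc i). (ev (Y S) \<odot>\<^bsub>free_tuples R M i\<^esub> koszul_on_free R M \<chi> (Suc i) (unit_vec R (lst S))) ys)"
    by (rule R.free_finsum_apply) (intro F.smult_closed linearD(1)[OF koszul_on_free_linear] R.unit_vec_carrier lst_tuples R.ev_simps)
  also have "\<dots> = (\<Oplus>S\<in>subsets_of_card r (Suc i). ev (Y S * (\<Sum>j<Suc i. (- 1) ^ j * a (sorted_list_of_set S ! j) * g (S - {sorted_list_of_set S ! j}))))"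
  proof (rule R.finsum_cong')
    fix S assume S: "S \<in> subsets_of_card r (Suc i)"
    show "(ev (Y S) \<odot>\<^bsub>free_tuples R M i\<^esub> koszul_on_free R M \<chi> (Suc i) (unit_vec R (lst S))) ys
      = ev (Y S * (\<Sum>j<Suc i. (- 1) ^ j * a (sorted_list_of_set S ! j) * g (S - {sorted_list_of_set S ! j})))"
      unfolding koszul_on_free_unit_vec[OF lst_tuples[OF S]] by (simp only: R.free_ops kt[OF S] R.ev_simps)
  qed auto
  also have "\<dots> = ev (\<Sum>T\<in>subsets_of_card r i. g T * bd r a Y T)"
    unfolding R.ev_sum[symmetric] bd_adjoint ..
  also have "\<dots> = \<zero>"
    unfolding R.ker_iff[symmetric]
    by (intro ideal_on_sum[OF R.ker_ideal] ideal_onD(3)[OF R.ker_ideal] cyc)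
  finally show "koszul_on_free R M \<chi> (Suc i) (\<iota> (Suc i) Y) ys = \<zero>\<^bsub>free_tuples R M i\<^esub> ys"
    by (simp add: R.free_ops)
qed

text \<open>
  A cycle \<open>Y\<close> of the explicit complex gives a cycle of \<open>\<And>M\<close>. If \<open>d\<close> times it is a boundary, then
  applying \<open>P\<close>, which restores \<open>d\<^sup>i Y\<close> and commutes with the differentials up to one more factor \<open>d\<close>,
  exhibits a multiple of \<open>Y\<close> by a power of \<open>d\<close> as a boundary.
\<close>

lemma killed_homology_imp_torsion:
  assumes i: "i \<le> r"
    and kill: "\<And>Y. Y \<in> carrier (trunc_koszul_homology R M \<chi> r i) \<Longrightarrow>
      ev d \<odot>\<^bsub>trunc_koszul_homology R M \<chi> r i\<^esub> Y = \<zero> \<odot>\<^bsub>trunc_koszul_homology R M \<chi> r i\<^esub> Y"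
  shows "torsion_homology d r a R.ker i"
  unfolding torsion_homology_def
proof (intro ballI impI)
  interpret F: module R "free_tuples R M i" by (rule free_tuples_module)
  interpret N: module R "N i" by (rule N_module)
  fix Y assume Y: "Y \<in> koszul_chains r i" and cyc: "\<forall>S. bd r a Y S \<in> R.ker"
  define f where "f = \<iota> i Y"
  have fc: "f \<in> carrier (free_tuples R M i)" unfolding f_def by (rule \<iota>_closed)
  have f: "f \<in> free_cycles i"
  proof (cases i)
    case (Suc k)
    interpret G: module R "free_tuples R M k" by (rule free_tuples_module)
    show ?thesis
      using fc koszul_\<iota>[of Y k] cyc G.submoduleD(1)[OF ext_rels_submodule]
      unfolding free_cycles_def f_def Suc by simp
  qed (use fc in \<open>simp add: free_cycles_def\<close>)
  have Pf: "P i f S = ev (d ^ i * Y S)" for S unfolding f_def by (rule P_\<iota>[OF Y])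
  have dfc: "ev d \<odot>\<^bsub>free_tuples R M i\<^esub> f \<in> carrier (free_tuples R M i)" using fc by simp
  have Pdf: "P i (ev d \<odot>\<^bsub>free_tuples R M i\<^esub> f) S = ev (d * (d ^ i * Y S))" for S
    using linearD(3)[OF P_linear _ fc, of "ev d"] by (simp add: R.free_ops Pf)
  show "\<exists>n. \<exists>W\<in>koszul_chains r (Suc i). \<forall>S. d ^ n * Y S - bd r a W S \<in> R.ker"
  proof (cases "i = r")
    case True
    from homology_killed(2)[OF _ f kill this] have "P i (ev d \<odot>\<^bsub>free_tuples R M i\<^esub> f) = \<zero>\<^bsub>N i\<^esub>"
      by (intro P_ext_rels) simp
    then have "ev (d ^ Suc i * Y S) = \<zero>" for S using Pdf[of S] by (simp add: R.free_ops R.m_assoc)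
    then have "d ^ Suc i * Y S \<in> R.ker" for S by (simp add: R.ker_iff)
    moreover have "bd r a (\<lambda>_. 0) S = 0" for S unfolding bd_def contr_def by (intro sum.neutral) auto
    ultimately show ?thesis by (intro exI[of _ "Suc i"] bexI[of _ "\<lambda>_. 0"]) (auto simp: chains_zero)
  next
    case False
    then have "i < r" using i by simp
    from homology_killed(1)[OF _ f kill this]
    obtain g where g: "g \<in> carrier (free_tuples R M (Suc i))"
      and "ev d \<odot>\<^bsub>free_tuples R M i\<^esub> f \<ominus>\<^bsub>free_tuples R M i\<^esub> koszul_on_free R M \<chi> (Suc i) g \<in> ext_rels R M i"
      by auto
    then have "P i (ev d \<odot>\<^bsub>free_tuples R M i\<^esub> f) \<ominus>\<^bsub>N i\<^esub> P i (koszul_on_free R M \<chi> (Suc i) g) = \<zero>\<^bsub>N i\<^esub>"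
      using P_ext_rels linear_diff[OF F.module_axioms N_module P_linear dfc linearD(1)[OF koszul_on_free_linear g]] by simp
    then have eq: "P i (ev d \<odot>\<^bsub>free_tuples R M i\<^esub> f) = P i (koszul_on_free R M \<chi> (Suc i) g)"
      using N.minus_equality[of "P i (ev d \<odot>\<^bsub>free_tuples R M i\<^esub> f)" "\<ominus>\<^bsub>N i\<^esub> P i (koszul_on_free R M \<chi> (Suc i) g)"]
        linearD(1)[OF P_linear dfc] linearD(1)[OF P_linear linearD(1)[OF koszul_on_free_linear g]]
      by (simp add: a_minus_def)
    have Pg: "P (Suc i) g \<in> carrier (N (Suc i))" by (rule linearD(1)[OF P_linear g])
    define W where "W = lift (P (Suc i) g)"
    have "ev (d ^ Suc (Suc i) * Y S) = ev (bd r a W S)" for S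
    proof -
      have "ev (bd r a W S) = (ev d \<odot>\<^bsub>N i\<^esub> P i (ev d \<odot>\<^bsub>free_tuples R M i\<^esub> f)) S"
        unfolding eq P_chain_map[OF g, symmetric] by (simp add: B_def W_def)
      also have "\<dots> = ev (d ^ Suc (Suc i) * Y S)" by (simp add: R.free_ops Pdf R.m_assoc)
      finally show ?thesis by simp
    qed
    then have "d ^ Suc (Suc i) * Y S - bd r a W S \<in> R.ker" for S by (simp only: R.ker_diff_iff)
    moreover have "W \<in> koszul_chains r (Suc i)" unfolding W_def by (rule lift_chains[OF Pg])
    ultimately show ?thesis by blast
  qed
qed

end

section \<open>Bases, duals and cokernels\<close>

lemma (in module) linear_quot_lift:
  assumes K: "submodule K R M" and N: "module R N" and h: "linear R M N h" and kill: "\<And>x. x \<in> K \<Longrightarrow> h x = \<zero>\<^bsub>N\<^esub>"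
  shows "\<exists>k. linear R (quot_module M K) N k \<and> (\<forall>x\<in>carrier M. k (K +>\<^bsub>M\<^esub> x) = h x)"
proof -
  interpret N: module R N by fact
  define k where "k Y = h (SOME x. x \<in> Y)" for Y
  have k: "k (K +>\<^bsub>M\<^esub> x) = h x" if x: "x \<in> carrier M" for x
  proof -
    define y where "y = (SOME y. y \<in> K +>\<^bsub>M\<^esub> x)"
    have "y \<in> K +>\<^bsub>M\<^esub> x" unfolding y_def by (rule someI[of _ x]) (rule coset_self[OF K x])
    then have y: "y \<in> carrier M" "y \<ominus>\<^bsub>M\<^esub> x \<in> K" using coset_mem_iff[OF K x] by auto
    then have "h y \<ominus>\<^bsub>N\<^esub> h x = \<zero>\<^bsub>N\<^esub>" using kill linear_diff[OF module_axioms N h y(1) x] by simp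
    then have "h y = h x"
      using N.minus_equality[of "h y" "\<ominus>\<^bsub>N\<^esub> h x"] linearD(1)[OF h] x y(1) by (simp add: a_minus_def)
    then show ?thesis by (simp add: k_def y_def)
  qed
  have "linear R (quot_module M K) N k"
    unfolding linear_def quot_carrier
    by (auto simp: k quot_add[OF K] quot_smult[OF K] linearD[OF h])
  with k show ?thesis by blast
qed

lemma dual_ops:
  "carrier (dual_module R M) = linear_maps R M (self_module R)"
  "x \<in> carrier M \<Longrightarrow> (\<alpha> \<oplus>\<^bsub>dual_module R M\<^esub> \<beta>) x = \<alpha> x \<oplus>\<^bsub>R\<^esub> \<beta> x"
  "x \<in> carrier M \<Longrightarrow> (c \<odot>\<^bsub>dual_module R M\<^esub> \<alpha>) x = c \<otimes>\<^bsub>R\<^esub> \<alpha> x"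
  "x \<in> carrier M \<Longrightarrow> \<zero>\<^bsub>dual_module R M\<^esub> x = \<zero>\<^bsub>R\<^esub>"
  by (simp_all add: dual_module_def)

lemma form_linear:
  assumes "\<alpha> \<in> carrier (dual_module R M)"
  shows "linear R M (self_module R) \<alpha>" "\<alpha> \<in> extensional (carrier M)"
    "x \<in> carrier M \<Longrightarrow> \<alpha> x \<in> carrier R"
    "x \<in> carrier M \<Longrightarrow> y \<in> carrier M \<Longrightarrow> \<alpha> (x \<oplus>\<^bsub>M\<^esub> y) = \<alpha> x \<oplus>\<^bsub>R\<^esub> \<alpha> y"
    "c \<in> carrier R \<Longrightarrow> x \<in> carrier M \<Longrightarrow> \<alpha> (c \<odot>\<^bsub>M\<^esub> x) = c \<otimes>\<^bsub>R\<^esub> \<alpha> x"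
proof -
  show l: "linear R M (self_module R) \<alpha>" using assms by (simp add: dual_ops linear_mapsD)
  show "\<alpha> \<in> extensional (carrier M)" using assms by (auto simp: dual_ops linear_maps_def PiE_def)
  show "x \<in> carrier M \<Longrightarrow> \<alpha> x \<in> carrier R"
    "x \<in> carrier M \<Longrightarrow> y \<in> carrier M \<Longrightarrow> \<alpha> (x \<oplus>\<^bsub>M\<^esub> y) = \<alpha> x \<oplus>\<^bsub>R\<^esub> \<alpha> y"
    "c \<in> carrier R \<Longrightarrow> x \<in> carrier M \<Longrightarrow> \<alpha> (c \<odot>\<^bsub>M\<^esub> x) = c \<otimes>\<^bsub>R\<^esub> \<alpha> x"
    using linearD[OF l] by (simp_all add: self_module_def)
qed

context module
begin

lemma dual_memI:
  assumes "\<And>x. x \<in> carrier M \<Longrightarrow> f x \<in> carrier R"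
    "\<And>x y. x \<in> carrier M \<Longrightarrow> y \<in> carrier M \<Longrightarrow> f (x \<oplus>\<^bsub>M\<^esub> y) = f x \<oplus> f y"
    "\<And>c x. c \<in> carrier R \<Longrightarrow> x \<in> carrier M \<Longrightarrow> f (c \<odot>\<^bsub>M\<^esub> x) = c \<otimes> f x"
  shows "(\<lambda>x\<in>carrier M. f x) \<in> carrier (dual_module R M)"
  unfolding dual_ops linear_maps_def self_module_def using assms by auto

lemma dual_module_module: "module R (dual_module R M)"
proof (rule moduleI)
  note F = form_linear[of _ R M]
  have add: "\<alpha> \<oplus>\<^bsub>dual_module R M\<^esub> \<beta> \<in> carrier (dual_module R M)"
    if "\<alpha> \<in> carrier (dual_module R M)" "\<beta> \<in> carrier (dual_module R M)" for \<alpha> \<beta>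
  proof -
    have "(\<lambda>x\<in>carrier M. \<alpha> x \<oplus> \<beta> x) \<in> carrier (dual_module R M)"
      by (rule dual_memI) (use F(3-5)[OF that(1)] F(3-5)[OF that(2)] in \<open>simp_all add: R.a_ac R.r_distr\<close>)
    then show ?thesis by (simp add: dual_module_def)
  qed
  have smult: "c \<odot>\<^bsub>dual_module R M\<^esub> \<alpha> \<in> carrier (dual_module R M)"
    if "\<alpha> \<in> carrier (dual_module R M)" "c \<in> carrier R" for \<alpha> c
  proof -
    have "(\<lambda>x\<in>carrier M. c \<otimes> \<alpha> x) \<in> carrier (dual_module R M)"
      by (rule dual_memI) (use F(3-5)[OF that(1)] that(2) in \<open>simp_all add: R.m_ac R.r_distr\<close>)
    then show ?thesis by (simp add: dual_module_def)
  qed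
  have zero: "\<zero>\<^bsub>dual_module R M\<^esub> \<in> carrier (dual_module R M)"
  proof -
    have "(\<lambda>x\<in>carrier M. \<zero>) \<in> carrier (dual_module R M)" by (rule dual_memI) simp_all
    then show ?thesis by (simp add: dual_module_def)
  qed
  have eqI: "\<alpha> = \<beta>" if "\<alpha> \<in> carrier (dual_module R M)" "\<beta> \<in> carrier (dual_module R M)"
    "\<And>x. x \<in> carrier M \<Longrightarrow> \<alpha> x = \<beta> x" for \<alpha> \<beta>
    by (rule extensionalityI[OF F(2)[OF that(1)] F(2)[OF that(2)]]) (rule that(3))
  show "abelian_group (dual_module R M)"
  proof (rule abelian_groupI)
    fix \<alpha> assume a: "\<alpha> \<in> carrier (dual_module R M)"
    show "\<zero>\<^bsub>dual_module R M\<^esub> \<oplus>\<^bsub>dual_module R M\<^esub> \<alpha> = \<alpha>"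
      by (rule eqI) (simp_all add: a add zero dual_ops(2-) F(3)[OF a])
    show "\<exists>\<beta>\<in>carrier (dual_module R M). \<beta> \<oplus>\<^bsub>dual_module R M\<^esub> \<alpha> = \<zero>\<^bsub>dual_module R M\<^esub>"
    proof
      show s: "(\<ominus> \<one>) \<odot>\<^bsub>dual_module R M\<^esub> \<alpha> \<in> carrier (dual_module R M)" by (rule smult[OF a]) simp
      show "(\<ominus> \<one>) \<odot>\<^bsub>dual_module R M\<^esub> \<alpha> \<oplus>\<^bsub>dual_module R M\<^esub> \<alpha> = \<zero>\<^bsub>dual_module R M\<^esub>"
        by (rule eqI) (simp_all add: a add[OF s a] zero dual_ops(2-) F(3)[OF a] R.l_minus R.l_neg)
    qed
  next
    fix \<alpha> \<beta> assume a: "\<alpha> \<in> carrier (dual_module R M)" "\<beta> \<in> carrier (dual_module R M)"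
    show "\<alpha> \<oplus>\<^bsub>dual_module R M\<^esub> \<beta> = \<beta> \<oplus>\<^bsub>dual_module R M\<^esub> \<alpha>"
      by (rule eqI) (simp_all add: a add dual_ops(2-) F(3)[OF a(1)] F(3)[OF a(2)] R.a_comm)
    fix \<gamma> assume c: "\<gamma> \<in> carrier (dual_module R M)"
    show "\<alpha> \<oplus>\<^bsub>dual_module R M\<^esub> \<beta> \<oplus>\<^bsub>dual_module R M\<^esub> \<gamma> = \<alpha> \<oplus>\<^bsub>dual_module R M\<^esub> (\<beta> \<oplus>\<^bsub>dual_module R M\<^esub> \<gamma>)"
      by (rule eqI) (simp_all add: a c add dual_ops(2-) F(3)[OF a(1)] F(3)[OF a(2)] F(3)[OF c] R.a_assoc)
  qed (auto intro: add zero)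
  note s = add smult dual_ops(2-) F(3)
  show "(c \<oplus> d) \<odot>\<^bsub>dual_module R M\<^esub> \<alpha> = c \<odot>\<^bsub>dual_module R M\<^esub> \<alpha> \<oplus>\<^bsub>dual_module R M\<^esub> d \<odot>\<^bsub>dual_module R M\<^esub> \<alpha>"
    if "c \<in> carrier R" "d \<in> carrier R" "\<alpha> \<in> carrier (dual_module R M)" for c d \<alpha>
    by (rule eqI) (use that in \<open>simp_all add: s R.l_distr\<close>)
  show "c \<odot>\<^bsub>dual_module R M\<^esub> (\<alpha> \<oplus>\<^bsub>dual_module R M\<^esub> \<beta>) = c \<odot>\<^bsub>dual_module R M\<^esub> \<alpha> \<oplus>\<^bsub>dual_module R M\<^esub> c \<odot>\<^bsub>dual_module R M\<^esub> \<beta>"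
    if "c \<in> carrier R" "\<alpha> \<in> carrier (dual_module R M)" "\<beta> \<in> carrier (dual_module R M)" for c \<alpha> \<beta>
    by (rule eqI) (use that in \<open>simp_all add: s R.r_distr\<close>)
  show "(c \<otimes> d) \<odot>\<^bsub>dual_module R M\<^esub> \<alpha> = c \<odot>\<^bsub>dual_module R M\<^esub> (d \<odot>\<^bsub>dual_module R M\<^esub> \<alpha>)"
    if "c \<in> carrier R" "d \<in> carrier R" "\<alpha> \<in> carrier (dual_module R M)" for c d \<alpha>
    by (rule eqI) (use that in \<open>simp_all add: s R.m_assoc\<close>)
  show "c \<odot>\<^bsub>dual_module R M\<^esub> \<alpha> \<in> carrier (dual_module R M)"
    if "c \<in> carrier R" "\<alpha> \<in> carrier (dual_module R M)" for c \<alpha>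
    using smult that by blast
  show "\<one> \<odot>\<^bsub>dual_module R M\<^esub> \<alpha> = \<alpha>" if "\<alpha> \<in> carrier (dual_module R M)" for \<alpha>
    by (rule eqI) (use that in \<open>simp_all add: s\<close>)
qed (rule R.is_cring)

lemma dual_eqI:
  assumes "\<alpha> \<in> carrier (dual_module R M)" "\<beta> \<in> carrier (dual_module R M)" "\<And>x. x \<in> carrier M \<Longrightarrow> \<alpha> x = \<beta> x"
  shows "\<alpha> = \<beta>"
  by (rule extensionalityI[OF form_linear(2)[OF assms(1)] form_linear(2)[OF assms(2)]]) (rule assms(3))

lemma dual_finsum_apply:
  assumes "\<And>i. i \<in> A \<Longrightarrow> f i \<in> carrier (dual_module R M)" and x: "x \<in> carrier M"
  shows "(\<Oplus>\<^bsub>dual_module R M\<^esub>i\<in>A. f i) x = (\<Oplus>i\<in>A. f i x)"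
proof -
  have "linear R (dual_module R M) (self_module R) (\<lambda>\<alpha>. \<alpha> x)"
    unfolding linear_def using x by (auto simp: dual_ops(2-) form_linear(3) self_module_def)
  from linear_finsum[OF dual_module_module R.self_module_module this, of A f]
  show ?thesis using assms by (simp add: R.self_module_finsum)
qed

end

locale based_module = module +
  fixes k :: nat and b :: "nat \<Rightarrow> 'c"
  assumes basis: "is_basis R M k b"
begin

abbreviation "co x \<equiv> coords R M k b x"

lemma b_closed: "i < k \<Longrightarrow> b i \<in> carrier M"
  using basis unfolding is_basis_def by auto

lemma coords_spec:
  assumes "x \<in> carrier M"
  shows "co x \<in> {..<k} \<rightarrow>\<^sub>E carrier R" "x = (\<Oplus>\<^bsub>M\<^esub>i\<in>{..<k}. co x i \<odot>\<^bsub>M\<^esub> b i)"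
proof -
  have "\<exists>!c. c \<in> {..<k} \<rightarrow>\<^sub>E carrier R \<and> x = (\<Oplus>\<^bsub>M\<^esub>i\<in>{..<k}. c i \<odot>\<^bsub>M\<^esub> b i)"
    using basis assms unfolding is_basis_def by blast
  from theI'[OF this] show "co x \<in> {..<k} \<rightarrow>\<^sub>E carrier R" "x = (\<Oplus>\<^bsub>M\<^esub>i\<in>{..<k}. co x i \<odot>\<^bsub>M\<^esub> b i)"
    unfolding coords_def by blast+
qed

lemma coords_closed: "x \<in> carrier M \<Longrightarrow> i < k \<Longrightarrow> co x i \<in> carrier R"
  using coords_spec(1) by blast

lemma coords_eqI:
  assumes "\<And>i. i < k \<Longrightarrow> c i \<in> carrier R" "x = (\<Oplus>\<^bsub>M\<^esub>i\<in>{..<k}. c i \<odot>\<^bsub>M\<^esub> b i)" "i < k"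
  shows "co x i = c i"
proof -
  have x: "x \<in> carrier M" unfolding assms(2) by (rule M.finsum_closed) (use assms(1) b_closed in auto)
  have "x = (\<Oplus>\<^bsub>M\<^esub>i\<in>{..<k}. restrict c {..<k} i \<odot>\<^bsub>M\<^esub> b i)"
    unfolding assms(2) by (rule M.finsum_cong') (use assms(1) b_closed in auto)
  moreover have "restrict c {..<k} \<in> {..<k} \<rightarrow>\<^sub>E carrier R" using assms(1) by auto
  moreover have "\<exists>!c. c \<in> {..<k} \<rightarrow>\<^sub>E carrier R \<and> x = (\<Oplus>\<^bsub>M\<^esub>i\<in>{..<k}. c i \<odot>\<^bsub>M\<^esub> b i)"
    using basis x unfolding is_basis_def by blast
  ultimately have "co x = restrict c {..<k}" using coords_spec[OF x] by blast
  then show ?thesis using assms(3) by simp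
qed

lemma coords_add:
  assumes "x \<in> carrier M" "y \<in> carrier M" "i < k"
  shows "co (x \<oplus>\<^bsub>M\<^esub> y) i = co x i \<oplus> co y i"
proof (rule coords_eqI[OF _ _ assms(3)])
  note c = coords_closed[OF assms(1)] coords_closed[OF assms(2)]
  show "co x i \<oplus> co y i \<in> carrier R" if "i < k" for i using c that by simp
  have "(\<Oplus>\<^bsub>M\<^esub>i\<in>{..<k}. (co x i \<oplus> co y i) \<odot>\<^bsub>M\<^esub> b i) = (\<Oplus>\<^bsub>M\<^esub>i\<in>{..<k}. co x i \<odot>\<^bsub>M\<^esub> b i \<oplus>\<^bsub>M\<^esub> co y i \<odot>\<^bsub>M\<^esub> b i)"
    by (rule M.finsum_cong') (use c b_closed in \<open>auto simp: smult_l_distr\<close>)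
  also have "\<dots> = (\<Oplus>\<^bsub>M\<^esub>i\<in>{..<k}. co x i \<odot>\<^bsub>M\<^esub> b i) \<oplus>\<^bsub>M\<^esub> (\<Oplus>\<^bsub>M\<^esub>i\<in>{..<k}. co y i \<odot>\<^bsub>M\<^esub> b i)"
    by (rule M.finsum_addf) (use c b_closed in auto)
  finally show "x \<oplus>\<^bsub>M\<^esub> y = (\<Oplus>\<^bsub>M\<^esub>i\<in>{..<k}. (co x i \<oplus> co y i) \<odot>\<^bsub>M\<^esub> b i)"
    using coords_spec(2)[OF assms(1)] coords_spec(2)[OF assms(2)] by simp
qed

lemma coords_smult:
  assumes "a \<in> carrier R" "x \<in> carrier M" "i < k"
  shows "co (a \<odot>\<^bsub>M\<^esub> x) i = a \<otimes> co x i"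
proof (rule coords_eqI[OF _ _ assms(3)])
  note c = coords_closed[OF assms(2)]
  show "a \<otimes> co x i \<in> carrier R" if "i < k" for i using c that assms(1) by simp
  have "a \<odot>\<^bsub>M\<^esub> (\<Oplus>\<^bsub>M\<^esub>i\<in>{..<k}. co x i \<odot>\<^bsub>M\<^esub> b i) = (\<Oplus>\<^bsub>M\<^esub>i\<in>{..<k}. a \<odot>\<^bsub>M\<^esub> (co x i \<odot>\<^bsub>M\<^esub> b i))"
    by (rule finsum_smult_ldistr) (use c b_closed assms(1) in auto)
  also have "\<dots> = (\<Oplus>\<^bsub>M\<^esub>i\<in>{..<k}. (a \<otimes> co x i) \<odot>\<^bsub>M\<^esub> b i)"
    by (rule M.finsum_cong') (use c b_closed assms(1) in \<open>auto simp: smult_assoc1\<close>)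
  finally show "a \<odot>\<^bsub>M\<^esub> x = (\<Oplus>\<^bsub>M\<^esub>i\<in>{..<k}. (a \<otimes> co x i) \<odot>\<^bsub>M\<^esub> b i)"
    using coords_spec(2)[OF assms(2)] by simp
qed

lemma coords_basis:
  assumes "i < k" "j < k" shows "co (b j) i = (if i = j then \<one> else \<zero>)"
proof (rule coords_eqI[OF _ _ assms(1)])
  have "(\<Oplus>\<^bsub>M\<^esub>i\<in>{..<k}. (if i = j then \<one> else \<zero>) \<odot>\<^bsub>M\<^esub> b i) = (\<Oplus>\<^bsub>M\<^esub>i\<in>{..<k}. if j = i then b i else \<zero>\<^bsub>M\<^esub>)"
    by (rule M.finsum_cong') (use b_closed in auto)
  also have "\<dots> = b j" by (rule M.add.finprod_singleton) (use assms(2) b_closed in auto)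
  finally show "b j = (\<Oplus>\<^bsub>M\<^esub>i\<in>{..<k}. (if i = j then \<one> else \<zero>) \<odot>\<^bsub>M\<^esub> b i)" by simp
qed auto

definition dual_basis :: "nat \<Rightarrow> 'c \<Rightarrow> 'a" where "dual_basis i = (\<lambda>x\<in>carrier M. co x i)"

lemma dual_basis_closed: "i < k \<Longrightarrow> dual_basis i \<in> carrier (dual_module R M)"
  unfolding dual_basis_def by (rule dual_memI) (auto simp: coords_closed coords_add coords_smult)

lemma linear_expand:
  assumes N: "module R N" and h: "linear R M N h" and x: "x \<in> carrier M"
  shows "h x = (\<Oplus>\<^bsub>N\<^esub>i\<in>{..<k}. co x i \<odot>\<^bsub>N\<^esub> h (b i))"
proof -
  interpret N: module R N by fact
  have "h x = h (\<Oplus>\<^bsub>M\<^esub>i\<in>{..<k}. co x i \<odot>\<^bsub>M\<^esub> b i)" using coords_spec(2)[OF x] by simp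
  also have "\<dots> = (\<Oplus>\<^bsub>N\<^esub>i\<in>{..<k}. h (co x i \<odot>\<^bsub>M\<^esub> b i))"
    by (rule linear_finsum[OF module_axioms N h]) (use coords_closed[OF x] b_closed in auto)
  also have "\<dots> = (\<Oplus>\<^bsub>N\<^esub>i\<in>{..<k}. co x i \<odot>\<^bsub>N\<^esub> h (b i))"
    by (rule N.finsum_cong') (use coords_closed[OF x] b_closed linearD(1,3)[OF h] in auto)
  finally show ?thesis .
qed

lemma form_expand:
  assumes \<alpha>: "\<alpha> \<in> carrier (dual_module R M)" and x: "x \<in> carrier M"
  shows "\<alpha> x = (\<Oplus>i\<in>{..<k}. co x i \<otimes> \<alpha> (b i))"
  using linear_expand[OF R.self_module_module form_linear(1)[OF \<alpha>] x]
  unfolding R.self_module_finsum by (simp add: self_module_def)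

lemma form_dual_expand:
  assumes \<alpha>: "\<alpha> \<in> carrier (dual_module R M)"
  shows "\<alpha> = (\<Oplus>\<^bsub>dual_module R M\<^esub>i\<in>{..<k}. \<alpha> (b i) \<odot>\<^bsub>dual_module R M\<^esub> dual_basis i)"
proof -
  interpret D: module R "dual_module R M" by (rule dual_module_module)
  have t: "\<alpha> (b i) \<odot>\<^bsub>dual_module R M\<^esub> dual_basis i \<in> carrier (dual_module R M)" if "i < k" for i
    by (intro D.smult_closed form_linear(3)[OF \<alpha>] b_closed dual_basis_closed that)
  show ?thesis
  proof (rule dual_eqI[OF \<alpha>])
    show "(\<Oplus>\<^bsub>dual_module R M\<^esub>i\<in>{..<k}. \<alpha> (b i) \<odot>\<^bsub>dual_module R M\<^esub> dual_basis i) \<in> carrier (dual_module R M)"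
      by (rule D.finsum_closed) (use t in auto)
    fix x assume x: "x \<in> carrier M"
    have "(\<Oplus>\<^bsub>dual_module R M\<^esub>i\<in>{..<k}. \<alpha> (b i) \<odot>\<^bsub>dual_module R M\<^esub> dual_basis i) x
        = (\<Oplus>i\<in>{..<k}. (\<alpha> (b i) \<odot>\<^bsub>dual_module R M\<^esub> dual_basis i) x)"
      by (rule dual_finsum_apply[OF _ x]) (use t in auto)
    also have "\<dots> = (\<Oplus>i\<in>{..<k}. co x i \<otimes> \<alpha> (b i))"
      by (rule R.finsum_cong')
        (use form_linear(3)[OF \<alpha>] b_closed coords_closed[OF x] x in \<open>auto simp: dual_ops(3) dual_basis_def R.m_comm\<close>)
    finally show "\<alpha> x = (\<Oplus>\<^bsub>dual_module R M\<^esub>i\<in>{..<k}. \<alpha> (b i) \<odot>\<^bsub>dual_module R M\<^esub> dual_basis i) x"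
      using form_expand[OF \<alpha> x] by simp
  qed
qed

lemma coords_eq:
  assumes "x \<in> carrier M" "y \<in> carrier M" "\<And>i. i < k \<Longrightarrow> co x i = co y i" shows "x = y"
proof -
  have "(\<Oplus>\<^bsub>M\<^esub>i\<in>{..<k}. co x i \<odot>\<^bsub>M\<^esub> b i) = (\<Oplus>\<^bsub>M\<^esub>i\<in>{..<k}. co y i \<odot>\<^bsub>M\<^esub> b i)"
    by (rule M.finsum_cong') (use assms(3) coords_closed[OF assms(2)] b_closed in auto)
  then show ?thesis using coords_spec(2)[OF assms(1)] coords_spec(2)[OF assms(2)] by simp
qed

end

lemma dual_map_linear:
  assumes "module R M" "module R N" "linear R M N h"
  shows "linear R (dual_module R N) (dual_module R M) (dual_map R M N h)"
proof -
  interpret M: module R M by fact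
  interpret N: module R N by fact
  interpret DN: module R "dual_module R N" by (rule N.dual_module_module)
  interpret DM: module R "dual_module R M" by (rule M.dual_module_module)
  note h = linearD[OF assms(3)]
  have ap: "dual_map R M N h \<beta> x = \<beta> (h x)" if "\<beta> \<in> carrier (dual_module R N)" "x \<in> carrier M" for \<beta> x
    using that by (simp add: dual_map_def compose_def)
  have cl: "dual_map R M N h \<beta> \<in> carrier (dual_module R M)" if b: "\<beta> \<in> carrier (dual_module R N)" for \<beta>
  proof -
    have "(\<lambda>x\<in>carrier M. \<beta> (h x)) \<in> carrier (dual_module R M)"
      by (rule M.dual_memI) (simp_all add: h form_linear(3-5)[OF b])
    then show ?thesis using b by (simp add: dual_map_def compose_def)
  qed
  show ?thesis
    unfolding linear_def
  proof (intro conjI ballI)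
    fix \<alpha> assume a: "\<alpha> \<in> carrier (dual_module R N)"
    show "dual_map R M N h \<alpha> \<in> carrier (dual_module R M)" by (rule cl[OF a])
    show "dual_map R M N h (\<alpha> \<oplus>\<^bsub>dual_module R N\<^esub> \<beta>) = dual_map R M N h \<alpha> \<oplus>\<^bsub>dual_module R M\<^esub> dual_map R M N h \<beta>"
      if b: "\<beta> \<in> carrier (dual_module R N)" for \<beta>
      by (rule M.dual_eqI) (simp_all add: cl a b ap dual_ops(2-) h)
    show "dual_map R M N h (c \<odot>\<^bsub>dual_module R N\<^esub> \<alpha>) = c \<odot>\<^bsub>dual_module R M\<^esub> dual_map R M N h \<alpha>"
      if c: "c \<in> carrier R" for c
      by (rule M.dual_eqI) (simp_all add: cl a c ap dual_ops(2-) h)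
  qed
qed

lemma dual_map_apply:
  "\<beta> \<in> carrier (dual_module R N) \<Longrightarrow> x \<in> carrier M \<Longrightarrow> dual_map R M N h \<beta> x = \<beta> (h x)"
  by (simp add: dual_map_def compose_def)

section \<open>Minors\<close>

context cring
begin

text \<open>
  \<open>B\<close> is the adjugate of the matrix of variables that evaluates to \<open>A\<close>; so both equations hold
  already before evaluation.
\<close>

lemma leibniz_adjugate:
  assumes A: "\<And>i j. i < m \<Longrightarrow> j < m \<Longrightarrow> A i j \<in> carrier R"
  obtains d B where "ev d = leibniz_det R m A"
    "\<And>i i'. i < m \<Longrightarrow> i' < m \<Longrightarrow> (\<Sum>k<m. fcring_var (A i k) * B k i') = (if i = i' then d else 0)"
    "\<And>k k'. k < m \<Longrightarrow> k' < m \<Longrightarrow> (\<Sum>i<m. B k i * fcring_var (A i k')) = (if k = k' then d else 0)"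
proof -
  define S where "S = mat m m (\<lambda>(i, k). fcring_var (A i k))"
  have S: "S \<in> carrier_mat m m" by (simp add: S_def)
  define B where "B k i = adj_mat S $$ (k, i)" for k i
  note adj = adj_mat[OF S]
  have 1: "(\<Sum>k<m. fcring_var (A i k) * B k i') = (if i = i' then det S else 0)" if "i < m" "i' < m" for i i'
  proof -
    have "(\<Sum>k<m. fcring_var (A i k) * B k i') = (S * adj_mat S) $$ (i, i')"
      using that S adj(1) by (simp add: times_mat_def scalar_prod_def S_def B_def lessThan_atLeast0)
    also have "\<dots> = (if i = i' then det S else 0)" using that unfolding adj(2) by simp
    finally show ?thesis .
  qed
  have 2: "(\<Sum>i<m. B k i * fcring_var (A i k')) = (if k = k' then det S else 0)" if "k < m" "k' < m" for k k'
  proof -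
    have "(\<Sum>i<m. B k i * fcring_var (A i k')) = (adj_mat S * S) $$ (k, k')"
      using that S adj(1) by (simp add: times_mat_def scalar_prod_def S_def B_def lessThan_atLeast0)
    also have "\<dots> = (if k = k' then det S else 0)" using that unfolding adj(3) by simp
    finally show ?thesis .
  qed
  have "ev (signof \<pi> * (\<Prod>i = 0..<m. S $$ (i, \<pi> i))) =
      (if evenperm \<pi> then (\<Otimes>i\<in>{..<m}. A i (\<pi> i)) else \<ominus> (\<Otimes>i\<in>{..<m}. A i (\<pi> i)))"
    if "\<pi> permutes {..<m}" for \<pi>
  proof -
    have \<pi>: "\<pi> i < m" if "i < m" for i using permutes_in_image[OF \<open>\<pi> permutes {..<m}\<close>, of i] that by simp
    have cl: "(\<lambda>i. A i (\<pi> i)) \<in> {..<m} \<rightarrow> carrier R" using A \<pi> by auto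
    have "ev (\<Prod>i = 0..<m. S $$ (i, \<pi> i)) = (\<Otimes>i\<in>{..<m}. A i (\<pi> i))"
      unfolding ev_prod lessThan_atLeast0[symmetric]
      by (rule finprod_cong') (use A \<pi> cl in \<open>auto simp: S_def\<close>)
    then show ?thesis using finprod_closed[OF cl] by (simp add: sign_def l_minus)
  qed
  note perm = this
  have "ev (det S) = (\<Oplus>\<pi>\<in>{\<pi>. \<pi> permutes {..<m}}. ev (signof \<pi> * (\<Prod>i = 0..<m. S $$ (i, \<pi> i))))"
    unfolding det_def'[OF S] ev_sum lessThan_atLeast0[symmetric] ..
  also have "\<dots> = leibniz_det R m A"
    unfolding leibniz_det_def
  proof (rule finsum_cong')
    show "(\<lambda>\<pi>. if evenperm \<pi> then (\<Otimes>i\<in>{..<m}. A i (\<pi> i)) else \<ominus> (\<Otimes>i\<in>{..<m}. A i (\<pi> i)))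
      \<in> {\<pi>. \<pi> permutes {..<m}} \<rightarrow> carrier R"
      using perm by (auto simp flip: perm)
  qed (use perm in auto)
  finally show thesis using that[OF _ 1 2] by blast
qed

lemma ev_power_cong: "ev s = ev t \<Longrightarrow> ev (s ^ k * z) = ev (t ^ k * z)"
  by (induction k) (simp_all add: m_assoc)

end

locale presented_cokernel = F: based_module R F m bF + G: based_module R G n bG
  for R :: "('a, 'p) ring_scheme" (structure) and F :: "('a, 'f, 'q) module_scheme" and m bF
    and G :: "('a, 'g, 's) module_scheme" and n bG +
  fixes \<psi> :: "'g \<Rightarrow> 'f" and \<chi> :: "('g \<Rightarrow> 'a) set \<Rightarrow> 'a"
  assumes psi: "linear R G F \<psi>"
    and chi: "linear R (coker_module (dual_module R F) (dual_module R G) (dual_map R G F \<psi>)) (self_module R) \<chi>"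
begin

abbreviation "M \<equiv> coker_module (dual_module R F) (dual_module R G) (dual_map R G F \<psi>)"
abbreviation "K \<equiv> dual_map R G F \<psi> ` carrier (dual_module R F)"

definition A :: "nat \<Rightarrow> nat \<Rightarrow> 'a" where "A i j = coords R F m bF (\<psi> (bG j)) i"

lemma A_closed: "i < m \<Longrightarrow> j < n \<Longrightarrow> A i j \<in> carrier R"
  unfolding A_def by (intro F.coords_closed linearD(1)[OF psi] G.b_closed)

lemmas dmap_linear = dual_map_linear[OF G.module_axioms F.module_axioms psi]

lemma K_submodule: "submodule K R (dual_module R G)"
  by (rule linear_image_submodule[OF F.dual_module_module G.dual_module_module dmap_linear])

sublocale DG: module R "dual_module R G"
  by (rule G.dual_module_module)

lemma M_module: "module R M"
  unfolding coker_module_def by (rule DG.quot_module_module[OF K_submodule])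

definition E :: "nat \<Rightarrow> ('g \<Rightarrow> 'a) set" where "E j = K +>\<^bsub>dual_module R G\<^esub> G.dual_basis j"

lemma coset_linear: "linear R (dual_module R G) M (\<lambda>\<alpha>. K +>\<^bsub>dual_module R G\<^esub> \<alpha>)"
  unfolding coker_module_def by (rule DG.quot_coset_linear[OF K_submodule])

lemma E_closed: "j < n \<Longrightarrow> E j \<in> carrier M"
  unfolding E_def by (intro linearD(1)[OF coset_linear] G.dual_basis_closed)

lemma M_carrier: "carrier M = (\<lambda>\<alpha>. K +>\<^bsub>dual_module R G\<^esub> \<alpha>) ` carrier (dual_module R G)"
  unfolding coker_module_def by (rule DG.quot_carrier)

definition c :: "nat \<Rightarrow> 'a" where "c j = \<chi> (E j)"

lemma c_closed: "j < n \<Longrightarrow> c j \<in> carrier R"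
  using linearD(1)[OF chi E_closed] by (simp add: c_def self_module_def)

lemma form_on_coset:
  assumes \<alpha>: "\<alpha> \<in> carrier (dual_module R G)"
  shows "\<chi> (K +>\<^bsub>dual_module R G\<^esub> \<alpha>) = (\<Oplus>\<^bsub>R\<^esub>j\<in>{..<n}. \<alpha> (bG j) \<otimes> c j)"
proof -
  note h = linear_comp[OF coset_linear chi]
  have ab: "\<alpha> (bG j) \<in> carrier R" if "j < n" for j by (rule form_linear(3)[OF \<alpha> G.b_closed[OF that]])
  have "\<chi> (K +>\<^bsub>dual_module R G\<^esub> \<alpha>)
      = \<chi> (K +>\<^bsub>dual_module R G\<^esub> (\<Oplus>\<^bsub>dual_module R G\<^esub>j\<in>{..<n}. \<alpha> (bG j) \<odot>\<^bsub>dual_module R G\<^esub> G.dual_basis j))"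
    using G.form_dual_expand[OF \<alpha>] by simp
  also have "\<dots> = (\<Oplus>\<^bsub>self_module R\<^esub>j\<in>{..<n}. \<chi> (K +>\<^bsub>dual_module R G\<^esub> (\<alpha> (bG j) \<odot>\<^bsub>dual_module R G\<^esub> G.dual_basis j)))"
    by (rule linear_finsum[OF DG.module_axioms F.R.self_module_module h]) (use ab G.dual_basis_closed in auto)
  also have "\<dots> = (\<Oplus>\<^bsub>R\<^esub>j\<in>{..<n}. \<alpha> (bG j) \<otimes> c j)"
    unfolding F.R.self_module_finsum
  proof (rule F.R.finsum_cong')
    fix j assume j: "j \<in> {..<n}"
    then show "\<chi> (K +>\<^bsub>dual_module R G\<^esub> (\<alpha> (bG j) \<odot>\<^bsub>dual_module R G\<^esub> G.dual_basis j)) = \<alpha> (bG j) \<otimes> c j"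
      using linearD(3)[OF h ab G.dual_basis_closed] by (simp add: c_def E_def self_module_def)
  qed (use ab c_closed in auto)
  finally show ?thesis .
qed

text \<open>
  The rows of \<open>A\<close> are the relations among the generators \<open>E j\<close> of \<open>M\<close>.
\<close>

lemma A_c: assumes i: "i < m" shows "(\<Sum>j<n. fcring_var (A i j) * fcring_var (c j)) \<in> F.R.ker"
proof -
  define \<alpha> where "\<alpha> = dual_map R G F \<psi> (F.dual_basis i)"
  have b: "F.dual_basis i \<in> carrier (dual_module R F)" by (rule F.dual_basis_closed[OF i])
  have K: "\<alpha> \<in> K" and \<alpha>: "\<alpha> \<in> carrier (dual_module R G)"
    using b linearD(1)[OF dmap_linear b] by (auto simp: \<alpha>_def)
  have ap: "\<alpha> (bG j) = A i j" if "j < n" for j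
    using dual_map_apply[OF b G.b_closed[OF that]] linearD(1)[OF psi G.b_closed[OF that]]
    by (simp add: \<alpha>_def A_def F.dual_basis_def)
  have "K +>\<^bsub>dual_module R G\<^esub> \<alpha> = \<zero>\<^bsub>M\<^esub>"
    using DG.coset_eq_self_iff[OF K_submodule \<alpha>] K by (simp add: coker_module_def quot_zero)
  then have "\<chi> (K +>\<^bsub>dual_module R G\<^esub> \<alpha>) = \<zero>"
    using linear_zero[OF M_module F.R.self_module_module chi] by (simp add: self_module_def)
  moreover have "(\<Oplus>\<^bsub>R\<^esub>j\<in>{..<n}. \<alpha> (bG j) \<otimes> c j) = (\<Oplus>\<^bsub>R\<^esub>j\<in>{..<n}. F.R.ev (fcring_var (A i j) * fcring_var (c j)))"
    by (rule F.R.finsum_cong') (auto simp: ap A_closed[OF i] c_closed)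
  ultimately show ?thesis unfolding F.R.ker_iff F.R.ev_sum using form_on_coset[OF \<alpha>] by simp
qed

text \<open>
  Conversely, every solution \<open>q\<close> of the homogeneous system with matrix \<open>A\<close> is the vector of values of a
  linear form on \<open>M\<close>.
\<close>

lemma functional_on_cokernel:
  assumes q: "\<And>i. i < m \<Longrightarrow> (\<Sum>j<n. fcring_var (A i j) * q j) \<in> F.R.ker"
  shows "\<exists>k. linear R M (self_module R) k \<and> (\<forall>\<alpha>\<in>carrier (dual_module R G).
    k (K +>\<^bsub>dual_module R G\<^esub> \<alpha>) = F.R.ev (\<Sum>j<n. fcring_var (\<alpha> (bG j)) * q j))"
proof -
  define h where "h \<alpha> = F.R.ev (\<Sum>j<n. fcring_var (\<alpha> (bG j)) * q j)" for \<alpha>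
  have ab: "\<alpha> (bG j) \<in> carrier R" if "\<alpha> \<in> carrier (dual_module R G)" "j < n" for \<alpha> j
    by (rule form_linear(3)[OF that(1) G.b_closed[OF that(2)]])
  have hs: "h \<alpha> = F.R.ev s" if "\<And>j. j < n \<Longrightarrow> F.R.ev (v j) = \<alpha> (bG j)" "(\<Sum>j<n. v j * q j) = s"
    "\<alpha> \<in> carrier (dual_module R G)" for \<alpha> v s
    unfolding h_def that(2)[symmetric] F.R.ev_sum
    by (rule F.R.finsum_cong') (auto simp: that(1) ab[OF that(3)])
  have lin: "linear R (dual_module R G) (self_module R) h"
    unfolding linear_def
  proof (intro conjI ballI)
    fix \<alpha> assume a: "\<alpha> \<in> carrier (dual_module R G)"
    show "h \<alpha> \<in> carrier (self_module R)" by (simp add: h_def self_module_def)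
    show "h (\<alpha> \<oplus>\<^bsub>dual_module R G\<^esub> \<beta>) = h \<alpha> \<oplus>\<^bsub>self_module R\<^esub> h \<beta>" if b: "\<beta> \<in> carrier (dual_module R G)" for \<beta>
    proof -
      have "h (\<alpha> \<oplus>\<^bsub>dual_module R G\<^esub> \<beta>) = F.R.ev ((\<Sum>j<n. fcring_var (\<alpha> (bG j)) * q j) + (\<Sum>j<n. fcring_var (\<beta> (bG j)) * q j))"
        by (rule hs[of "\<lambda>j. fcring_var (\<alpha> (bG j)) + fcring_var (\<beta> (bG j))"])
          (use a b in \<open>simp_all add: dual_ops(2) G.b_closed ab distrib_right sum.distrib\<close>)
      then show ?thesis by (simp add: h_def self_module_def)
    qed
    show "h (x \<odot>\<^bsub>dual_module R G\<^esub> \<alpha>) = x \<odot>\<^bsub>self_module R\<^esub> h \<alpha>" if x: "x \<in> carrier R" for x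
    proof -
      have "h (x \<odot>\<^bsub>dual_module R G\<^esub> \<alpha>) = F.R.ev (fcring_var x * (\<Sum>j<n. fcring_var (\<alpha> (bG j)) * q j))"
        by (rule hs[of "\<lambda>j. fcring_var x * fcring_var (\<alpha> (bG j))"])
          (use a x in \<open>simp_all add: dual_ops(3) G.b_closed ab sum_distrib_left mult.assoc\<close>)
      then show ?thesis using x by (simp add: h_def self_module_def)
    qed
  qed
  have kill: "h \<alpha> = \<zero>\<^bsub>self_module R\<^esub>" if \<alpha>K: "\<alpha> \<in> K" for \<alpha>
  proof -
    obtain \<beta> where b: "\<beta> \<in> carrier (dual_module R F)" "\<alpha> = dual_map R G F \<psi> \<beta>" using \<alpha>K by blast
    have bb: "\<beta> (bF i) \<in> carrier R" if "i < m" for i by (rule form_linear(3)[OF b(1) F.b_closed[OF that]])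
    have "h \<alpha> = F.R.ev (\<Sum>i<m. fcring_var (\<beta> (bF i)) * (\<Sum>j<n. fcring_var (A i j) * q j))"
    proof (rule hs[of "\<lambda>j. \<Sum>i<m. fcring_var (A i j) * fcring_var (\<beta> (bF i))"])
      fix j assume j: "j < n"
      have "\<alpha> (bG j) = \<beta> (\<psi> (bG j))" unfolding b(2) by (rule dual_map_apply[OF b(1) G.b_closed[OF j]])
      also have "\<dots> = (\<Oplus>\<^bsub>R\<^esub>i\<in>{..<m}. A i j \<otimes> \<beta> (bF i))"
        unfolding A_def by (rule F.form_expand[OF b(1) linearD(1)[OF psi G.b_closed[OF j]]])
      also have "\<dots> = F.R.ev (\<Sum>i<m. fcring_var (A i j) * fcring_var (\<beta> (bF i)))"
        unfolding F.R.ev_sum by (rule F.R.finsum_cong') (auto simp: A_closed j bb)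
      finally show "F.R.ev (\<Sum>i<m. fcring_var (A i j) * fcring_var (\<beta> (bF i))) = \<alpha> (bG j)" by simp
    next
      show "(\<Sum>j<n. (\<Sum>i<m. fcring_var (A i j) * fcring_var (\<beta> (bF i))) * q j)
        = (\<Sum>i<m. fcring_var (\<beta> (bF i)) * (\<Sum>j<n. fcring_var (A i j) * q j))"
        unfolding sum_distrib_left sum_distrib_right by (subst sum.swap) (simp add: mult_ac)
      show "\<alpha> \<in> carrier (dual_module R G)" unfolding b(2) by (rule linearD(1)[OF dmap_linear b(1)])
    qed
    also have "\<dots> = \<zero>" unfolding F.R.ker_iff[symmetric]
      by (intro ideal_on_sum[OF F.R.ker_ideal] ideal_onD(3)[OF F.R.ker_ideal] q) simp
    finally show ?thesis by (simp add: self_module_def)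
  qed
  have "\<exists>k. linear R (quot_module (dual_module R G) K) (self_module R) k \<and>
      (\<forall>\<alpha>\<in>carrier (dual_module R G). k (K +>\<^bsub>dual_module R G\<^esub> \<alpha>) = h \<alpha>)"
    by (rule DG.linear_quot_lift[OF K_submodule F.R.self_module_module lin]) (rule kill)
  then show ?thesis by (simp only: coker_module_def h_def)
qed

text \<open>
  Let \<open>B\<close> be the adjugate of the submatrix with minor \<open>d\<close>. In \<open>M\<close>, multiplying the relations by \<open>B\<close>
  expresses \<open>d E(\<sigma> k)\<close> as a combination of the remaining generators \<open>E(\<tau> t)\<close> with coefficients
  \<open>- (B A)\<^bsub>k, \<tau> t\<^esub>\<close>. The form \<open>p\<^sub>t\<close> sends \<open>E(\<tau> t)\<close> to \<open>d\<close>, the other \<open>E(\<tau> s)\<close> to \<open>0\<close>,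
  and \<open>E(\<sigma> k)\<close> to this coefficient; these forms respect the relations because \<open>B\<close> is an inverse up to \<open>d\<close> on the other side as well.
\<close>

lemma minor_splitting:
  assumes \<rho>: "strict_mono_on {..<m} \<rho>" "\<rho> ` {..<m} \<subseteq> {..<m}"
    and \<sigma>: "strict_mono_on {..<m} \<sigma>" "\<sigma> ` {..<m} \<subseteq> {..<n}"
  obtains d e p where "F.R.ev d = leibniz_det R m (\<lambda>i j. A (\<rho> i) (\<sigma> j))" "split_form R M \<chi> d (n - m) e p"
proof -
  define r where "r = n - m"
  have inj: "inj_on \<rho> {..<m}" "inj_on \<sigma> {..<m}" using \<rho>(1) \<sigma>(1) by (auto intro: strict_mono_on_imp_inj_on)
  have surj: "\<rho> ` {..<m} = {..<m}" by (rule endo_inj_surj[OF _ \<rho>(2) inj(1)]) simp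
  have \<rho>m: "\<rho> i < m" if "i < m" for i using \<rho>(2) that by auto
  have \<sigma>n: "\<sigma> k < n" if "k < m" for k using \<sigma>(2) that by auto
  define D where "D = {..<n} - \<sigma> ` {..<m}"
  have D: "finite D" "card D = r"
    using card_Diff_subset[OF _ \<sigma>(2)] card_image[OF inj(2)] by (simp_all add: D_def r_def)
  define \<tau> where "\<tau> t = sorted_list_of_set D ! t" for t
  have bij: "bij_betw \<tau> {..<r} D" unfolding \<tau>_def by (rule bij_betw_nth) (use D in auto)
  have \<tau>D: "\<tau> t \<in> D" if "t < r" for t using bij that by (auto simp: bij_betw_def)
  have \<tau>n: "\<tau> t < n" if "t < r" for t using \<tau>D[OF that] by (simp add: D_def)
  have \<tau>inj: "\<tau> s = \<tau> t \<longleftrightarrow> s = t" if "s < r" "t < r" for s t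
    using bij that by (auto simp: bij_betw_def inj_on_def)
  have split: "(\<Sum>j<n. f j) = (\<Sum>k<m. f (\<sigma> k)) + (\<Sum>t<r. f (\<tau> t))" for f :: "nat \<Rightarrow> 'a fcring"
  proof -
    have "(\<Sum>j<n. f j) = sum f D + sum f (\<sigma> ` {..<m})"
      unfolding D_def by (rule sum.subset_diff[OF \<sigma>(2)]) simp
    also have "sum f D = (\<Sum>t<r. f (\<tau> t))" by (rule sum.reindex_bij_betw[OF bij, symmetric])
    also have "sum f (\<sigma> ` {..<m}) = (\<Sum>k<m. f (\<sigma> k))" by (rule sum.reindex[OF inj(2), unfolded comp_def])
    finally show ?thesis by (simp add: add.commute)
  qed
  define T where "T i j = fcring_var (A (\<rho> i) j)" for i j
  obtain d B where d: "F.R.ev d = leibniz_det R m (\<lambda>i j. A (\<rho> i) (\<sigma> j))"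
    and AB: "\<And>i i'. i < m \<Longrightarrow> i' < m \<Longrightarrow> (\<Sum>k<m. fcring_var (A (\<rho> i) (\<sigma> k)) * B k i') = (if i = i' then d else 0)"
    and BA: "\<And>k k'. k < m \<Longrightarrow> k' < m \<Longrightarrow> (\<Sum>i<m. B k i * fcring_var (A (\<rho> i) (\<sigma> k'))) = (if k = k' then d else 0)"
    by (rule F.R.leibniz_adjugate[of m "\<lambda>i j. A (\<rho> i) (\<sigma> j)"]) (use A_closed \<rho>m \<sigma>n in auto)
  note AB = AB[folded T_def] and BA = BA[folded T_def]
  define q where "q t j = (if j \<in> \<sigma> ` {..<m} then - (\<Sum>i<m. B (inv_into {..<m} \<sigma> j) i * T i (\<tau> t))
     else if j = \<tau> t then d else 0)" for t j
  have q\<sigma>: "q t (\<sigma> k) = - (\<Sum>i<m. B k i * T i (\<tau> t))" if "k < m" for t k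
    using that inj(2) by (simp add: q_def inv_into_f_f)
  have q\<tau>: "q t (\<tau> s) = (if s = t then d else 0)" if "s < r" "t < r" for s t
    using \<tau>D[OF that(1)] \<tau>inj[OF that] by (simp add: q_def D_def)
  have rel: "(\<Sum>j<n. T i j * q t j) = 0" if i: "i < m" and t: "t < r" for i t
  proof -
    have "(\<Sum>k<m. T i (\<sigma> k) * q t (\<sigma> k)) = - (\<Sum>k<m. \<Sum>i'<m. T i (\<sigma> k) * B k i' * T i' (\<tau> t))"
      by (simp add: q\<sigma> sum_distrib_left sum_negf mult.assoc)
    also have "(\<Sum>k<m. \<Sum>i'<m. T i (\<sigma> k) * B k i' * T i' (\<tau> t)) = (\<Sum>i'<m. (\<Sum>k<m. T i (\<sigma> k) * B k i') * T i' (\<tau> t))"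
      unfolding sum_distrib_right by (rule sum.swap)
    also have "\<dots> = (\<Sum>i'<m. if i' = i then d * T i (\<tau> t) else 0)"
      by (intro sum.cong refl) (simp add: AB i)
    also have "\<dots> = d * T i (\<tau> t)" using i by simp
    finally have 1: "(\<Sum>k<m. T i (\<sigma> k) * q t (\<sigma> k)) = - (d * T i (\<tau> t))" .
    have "(\<Sum>s<r. T i (\<tau> s) * q t (\<tau> s)) = (\<Sum>s<r. if s = t then d * T i (\<tau> t) else 0)"
      by (intro sum.cong refl) (simp add: q\<tau> t mult.commute)
    also have "\<dots> = d * T i (\<tau> t)" using t by simp
    finally show ?thesis unfolding split 1 by simp
  qed
  have ex: "\<exists>k. linear R M (self_module R) k \<and> (\<forall>\<alpha>\<in>carrier (dual_module R G).
      k (K +>\<^bsub>dual_module R G\<^esub> \<alpha>) = F.R.ev (\<Sum>j<n. fcring_var (\<alpha> (bG j)) * q t j))" if t: "t < r" for t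
  proof -
    have "(\<Sum>j<n. fcring_var (A i j) * q t j) \<in> F.R.ker" if "i < m" for i
    proof -
      obtain i' where "i' < m" "i = \<rho> i'" using surj \<open>i < m\<close> by (metis imageE lessThan_iff)
      then show ?thesis using rel[OF _ t, of i'] ideal_onD(1)[OF F.R.ker_ideal] by (simp add: T_def)
    qed
    then show ?thesis by (rule functional_on_cokernel)
  qed
  define p where "p t = (SOME k. linear R M (self_module R) k \<and> (\<forall>\<alpha>\<in>carrier (dual_module R G).
      k (K +>\<^bsub>dual_module R G\<^esub> \<alpha>) = F.R.ev (\<Sum>j<n. fcring_var (\<alpha> (bG j)) * q t j)))" for t
  have p: "linear R M (self_module R) (p t)"
    "\<alpha> \<in> carrier (dual_module R G) \<Longrightarrow>
      p t (K +>\<^bsub>dual_module R G\<^esub> \<alpha>) = F.R.ev (\<Sum>j<n. fcring_var (\<alpha> (bG j)) * q t j)" if "t < r" for t \<alpha>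
    using someI_ex[OF ex[OF that]] unfolding p_def[symmetric] by blast+
  define c' where "c' j = fcring_var (c j)" for j
  have qc: "(\<Sum>t<r. q t j * c' (\<tau> t)) - d * c' j \<in> F.R.ker" if j: "j < n" for j
  proof (cases "j \<in> D")
    case True
    then obtain s where s: "s < r" "j = \<tau> s" using bij by (auto simp: bij_betw_def)
    have "(\<Sum>t<r. q t j * c' (\<tau> t)) = (\<Sum>t<r. if t = s then d * c' j else 0)"
      unfolding s(2) by (intro sum.cong refl) (auto simp: q\<tau> s(1))
    then show ?thesis using s(1) ideal_onD(1)[OF F.R.ker_ideal] by simp
  next
    case False
    then obtain k where k: "k < m" "j = \<sigma> k" using j by (auto simp: D_def)
    have "d * c' j = (\<Sum>k'<m. (if k' = k then d else 0) * c' (\<sigma> k'))"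
      using k by (simp add: if_distrib[of "\<lambda>x. x * _"] cong: if_cong)
    also have "\<dots> = (\<Sum>k'<m. \<Sum>i<m. B k i * (T i (\<sigma> k') * c' (\<sigma> k')))"
    proof (rule sum.cong[OF refl])
      fix k' assume "k' \<in> {..<m}"
      then have "(if k' = k then d else 0) = (\<Sum>i<m. B k i * T i (\<sigma> k'))" using BA[OF k(1), of k'] by auto
      then show "(if k' = k then d else 0) * c' (\<sigma> k') = (\<Sum>i<m. B k i * (T i (\<sigma> k') * c' (\<sigma> k')))"
        by (simp only: sum_distrib_right mult.assoc)
    qed
    also have "\<dots> = (\<Sum>i<m. \<Sum>k'<m. B k i * (T i (\<sigma> k') * c' (\<sigma> k')))" by (rule sum.swap)
    also have "\<dots> = (\<Sum>i<m. B k i * (\<Sum>k'<m. T i (\<sigma> k') * c' (\<sigma> k')))" by (simp only: sum_distrib_left)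
    finally have 1: "d * c' j = (\<Sum>i<m. B k i * (\<Sum>k'<m. T i (\<sigma> k') * c' (\<sigma> k')))" .
    have "(\<Sum>t<r. q t j * c' (\<tau> t)) = - (\<Sum>t<r. \<Sum>i<m. B k i * (T i (\<tau> t) * c' (\<tau> t)))"
      unfolding k(2) q\<sigma>[OF k(1)] by (simp add: sum_negf sum_distrib_right mult.assoc)
    also have "(\<Sum>t<r. \<Sum>i<m. B k i * (T i (\<tau> t) * c' (\<tau> t))) = (\<Sum>i<m. \<Sum>t<r. B k i * (T i (\<tau> t) * c' (\<tau> t)))"
      by (rule sum.swap)
    also have "\<dots> = (\<Sum>i<m. B k i * (\<Sum>t<r. T i (\<tau> t) * c' (\<tau> t)))" by (simp only: sum_distrib_left)
    finally have 2: "(\<Sum>t<r. q t j * c' (\<tau> t)) - d * c' j = - (\<Sum>i<m. B k i * (\<Sum>j<n. T i j * c' j))"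
      unfolding 1 split by (simp add: distrib_left sum.distrib)
    have Tc: "(\<Sum>j<n. T i j * c' j) \<in> F.R.ker" if "i < m" for i
      using A_c[OF \<rho>m[OF that]] by (simp add: T_def c'_def)
    show ?thesis
      unfolding 2
      by (intro ideal_onD(5)[OF F.R.ker_ideal] ideal_on_sum[OF F.R.ker_ideal] ideal_onD(3)[OF F.R.ker_ideal] Tc) simp
  qed
  have ab: "\<alpha> (bG j) \<in> carrier R" if "\<alpha> \<in> carrier (dual_module R G)" "j < n" for \<alpha> j
    by (rule form_linear(3)[OF that(1) G.b_closed[OF that(2)]])
  have "split_form R M \<chi> d r (\<lambda>t. E (\<tau> t)) p"
  proof (intro split_form.intro module_form.intro M_module module_form_axioms.intro chi split_form_axioms.intro)
    show "E (\<tau> t) \<in> carrier M" if "t < r" for t by (rule E_closed[OF \<tau>n[OF that]])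
    show "linear R M (self_module R) (p t)" if "t < r" for t by (rule p(1)[OF that])
  next
    fix s t assume s: "s < r" and t: "t < r"
    have "p t (E (\<tau> s)) = F.R.ev (\<Sum>j<n. fcring_var (G.dual_basis (\<tau> s) (bG j)) * q t j)"
      unfolding E_def by (rule p(2)[OF t G.dual_basis_closed[OF \<tau>n[OF s]]])
    also have "\<dots> = (\<Oplus>\<^bsub>R\<^esub>j\<in>{..<n}. F.R.ev (if j = \<tau> s then q t j else 0))"
      unfolding F.R.ev_sum using \<tau>n[OF s]
      by (intro F.R.finsum_cong') (auto simp: G.dual_basis_def G.b_closed G.coords_basis)
    also have "\<dots> = F.R.ev (q t (\<tau> s))" unfolding F.R.ev_sum[symmetric] using \<tau>n[OF s] by simp
    finally show "p t (E (\<tau> s)) = (if t = s then F.R.ev d else \<zero>)" by (simp add: q\<tau>[OF s t])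
  next
    fix x assume "x \<in> carrier M"
    then obtain \<alpha> where \<alpha>: "\<alpha> \<in> carrier (dual_module R G)" "x = K +>\<^bsub>dual_module R G\<^esub> \<alpha>" unfolding M_carrier by blast
    have "(\<Oplus>\<^bsub>R\<^esub>t\<in>{..<r}. p t x \<otimes> \<chi> (E (\<tau> t))) = (\<Oplus>\<^bsub>R\<^esub>t\<in>{..<r}. F.R.ev ((\<Sum>j<n. fcring_var (\<alpha> (bG j)) * q t j) * c' (\<tau> t)))"
      by (rule F.R.finsum_cong') (auto simp: \<alpha> p(2) c'_def c_def[symmetric] c_closed \<tau>n)
    also have "\<dots> = F.R.ev (\<Sum>j<n. fcring_var (\<alpha> (bG j)) * (\<Sum>t<r. q t j * c' (\<tau> t)))"
      unfolding F.R.ev_sum[symmetric] sum_distrib_left sum_distrib_right by (subst sum.swap) (simp add: mult.assoc)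
    also have "\<dots> = F.R.ev (\<Sum>j<n. fcring_var (\<alpha> (bG j)) * (d * c' j))"
    proof -
      have "(\<Sum>j<n. fcring_var (\<alpha> (bG j)) * (\<Sum>t<r. q t j * c' (\<tau> t))) - (\<Sum>j<n. fcring_var (\<alpha> (bG j)) * (d * c' j)) \<in> F.R.ker"
        unfolding sum_subtractf[symmetric] right_diff_distrib[symmetric]
        by (intro ideal_on_sum[OF F.R.ker_ideal] ideal_onD(3)[OF F.R.ker_ideal] qc) simp
      then show ?thesis unfolding F.R.ker_diff_iff .
    qed
    also have "\<dots> = F.R.ev (d * (\<Sum>j<n. fcring_var (\<alpha> (bG j)) * c' j))" by (simp only: sum_distrib_left mult.left_commute)
    also have "\<dots> = F.R.ev d \<otimes> (\<Oplus>\<^bsub>R\<^esub>j\<in>{..<n}. F.R.ev (fcring_var (\<alpha> (bG j)) * c' j))" by (simp only: F.R.ev_simps F.R.ev_sum)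
    also have "(\<Oplus>\<^bsub>R\<^esub>j\<in>{..<n}. F.R.ev (fcring_var (\<alpha> (bG j)) * c' j)) = (\<Oplus>\<^bsub>R\<^esub>j\<in>{..<n}. \<alpha> (bG j) \<otimes> c j)"
      by (rule F.R.finsum_cong') (auto simp: ab[OF \<alpha>(1)] c'_def c_closed)
    also have "\<dots> = \<chi> x" unfolding \<alpha>(2) by (rule form_on_coset[OF \<alpha>(1), symmetric])
    finally show "(\<Oplus>\<^bsub>R\<^esub>t\<in>{..<r}. p t x \<otimes> \<chi> (E (\<tau> t))) = F.R.ev d \<otimes> \<chi> x" .
  qed
  with d show thesis by (intro that) (simp_all add: r_def)
qed

text \<open>
  Cramer's rule: the adjugate solves the system with right-hand side \<open>d x\<close>, using only the columns
  \<open>\<sigma> k\<close>.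
\<close>

lemma minor_kills_cokernel:
  assumes \<rho>: "strict_mono_on {..<m} \<rho>" "\<rho> ` {..<m} \<subseteq> {..<m}"
    and \<sigma>: "strict_mono_on {..<m} \<sigma>" "\<sigma> ` {..<m} \<subseteq> {..<n}" and x: "x \<in> carrier F"
  shows "leibniz_det R m (\<lambda>i j. A (\<rho> i) (\<sigma> j)) \<odot>\<^bsub>F\<^esub> x \<in> \<psi> ` carrier G"
proof -
  have inj: "inj_on \<rho> {..<m}" using \<rho>(1) by (auto intro: strict_mono_on_imp_inj_on)
  have surj: "\<rho> ` {..<m} = {..<m}" by (rule endo_inj_surj[OF _ \<rho>(2) inj]) simp
  have \<rho>m: "\<rho> i < m" if "i < m" for i using \<rho>(2) that by auto
  have \<sigma>n: "\<sigma> k < n" if "k < m" for k using \<sigma>(2) that by auto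
  obtain d B where d: "F.R.ev d = leibniz_det R m (\<lambda>i j. A (\<rho> i) (\<sigma> j))"
    and AB: "\<And>i i'. i < m \<Longrightarrow> i' < m \<Longrightarrow> (\<Sum>k<m. fcring_var (A (\<rho> i) (\<sigma> k)) * B k i') = (if i = i' then d else 0)"
    by (rule F.R.leibniz_adjugate[of m "\<lambda>i j. A (\<rho> i) (\<sigma> j)"]) (use A_closed \<rho>m \<sigma>n in auto)
  define X' where "X' i = fcring_var (coords R F m bF x i)" for i
  have X': "F.R.ev (X' i) = coords R F m bF x i" if "i < m" for i
    using F.coords_closed[OF x that] by (simp add: X'_def)
  define v where "v k = (\<Sum>i<m. B k i * X' (\<rho> i))" for k
  define y where "y = (\<Oplus>\<^bsub>G\<^esub>k\<in>{..<m}. F.R.ev (v k) \<odot>\<^bsub>G\<^esub> bG (\<sigma> k))"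
  have yt: "F.R.ev (v k) \<odot>\<^bsub>G\<^esub> bG (\<sigma> k) \<in> carrier G" if "k < m" for k
    using G.b_closed[OF \<sigma>n[OF that]] by simp
  have y: "y \<in> carrier G" unfolding y_def by (rule G.finsum_closed) (use yt in auto)
  have "\<psi> y = F.R.ev d \<odot>\<^bsub>F\<^esub> x"
  proof (rule F.coords_eq)
    show "\<psi> y \<in> carrier F" by (rule linearD(1)[OF psi y])
    show "F.R.ev d \<odot>\<^bsub>F\<^esub> x \<in> carrier F" using x by simp
    fix l assume "l < m"
    then obtain i where i: "i < m" "l = \<rho> i" using surj by (metis imageE lessThan_iff)
    have lin: "linear R G (self_module R) (\<lambda>y. coords R F m bF (\<psi> y) l)"
      using linearD[OF psi] \<open>l < m\<close> unfolding linear_def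
      by (auto simp: self_module_def F.coords_closed F.coords_add F.coords_smult)
    have "coords R F m bF (\<psi> y) l = (\<Oplus>\<^bsub>self_module R\<^esub>k\<in>{..<m}. coords R F m bF (\<psi> (F.R.ev (v k) \<odot>\<^bsub>G\<^esub> bG (\<sigma> k))) l)"
      unfolding y_def by (rule linear_finsum[OF G.module_axioms F.R.self_module_module lin]) (use yt in auto)
    also have "\<dots> = (\<Oplus>\<^bsub>R\<^esub>k\<in>{..<m}. F.R.ev (v k * fcring_var (A l (\<sigma> k))))"
      unfolding F.R.self_module_finsum
    proof (rule F.R.finsum_cong')
      fix k assume k: "k \<in> {..<m}"
      then show "coords R F m bF (\<psi> (F.R.ev (v k) \<odot>\<^bsub>G\<^esub> bG (\<sigma> k))) l = F.R.ev (v k * fcring_var (A l (\<sigma> k)))"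
        using linearD(3)[OF lin F.R.ev_simps(1) G.b_closed[OF \<sigma>n]] A_closed[OF \<open>l < m\<close> \<sigma>n]
        by (simp add: self_module_def A_def)
    qed auto
    also have "\<dots> = F.R.ev (\<Sum>k<m. v k * fcring_var (A l (\<sigma> k)))" by (simp only: F.R.ev_sum)
    also have "(\<Sum>k<m. v k * fcring_var (A l (\<sigma> k))) = (\<Sum>i'<m. (\<Sum>k<m. fcring_var (A (\<rho> i) (\<sigma> k)) * B k i') * X' (\<rho> i'))"
      unfolding v_def i(2) sum_distrib_right by (subst sum.swap) (simp add: mult_ac)
    also have "\<dots> = (\<Sum>i'<m. if i' = i then d * X' l else 0)"
      by (intro sum.cong refl) (simp add: AB i)
    also have "\<dots> = d * X' l" using i(1) by simp
    finally show "coords R F m bF (\<psi> y) l = coords R F m bF (F.R.ev d \<odot>\<^bsub>F\<^esub> x) l"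
      using F.coords_smult[OF F.R.ev_simps(1) x \<open>l < m\<close>] X'[OF \<open>l < m\<close>] by simp
  qed
  then show ?thesis using y d by (metis imageI)
qed

end

section \<open>Modules killed by the minors\<close>

lemma (in module) quot_killed:
  assumes K: "submodule K R M" and a: "a \<in> carrier R" and kill: "\<And>x. x \<in> carrier M \<Longrightarrow> a \<odot>\<^bsub>M\<^esub> x \<in> K"
    and Z: "Z \<in> carrier (quot_module M K)"
  shows "a \<odot>\<^bsub>quot_module M K\<^esub> Z = \<zero> \<odot>\<^bsub>quot_module M K\<^esub> Z"
proof -
  obtain x where x: "x \<in> carrier M" "Z = K +>\<^bsub>M\<^esub> x" using Z unfolding quot_carrier by blast
  have "K +>\<^bsub>M\<^esub> (a \<odot>\<^bsub>M\<^esub> x) = K" using coset_eq_self_iff[OF K] kill[OF x(1)] x(1) a by simp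
  then show ?thesis using x a coset_zero[OF K] by (simp add: quot_smult[OF K])
qed

text \<open>
  A product with at least one factor is killed by whatever kills that factor.
\<close>

lemma (in module) sym_power_killed:
  assumes a: "a \<in> carrier R" and kill: "\<And>x. x \<in> carrier M \<Longrightarrow> a \<odot>\<^bsub>M\<^esub> x = \<zero> \<odot>\<^bsub>M\<^esub> x"
    and Z: "Z \<in> carrier (sym_power R M (Suc i))"
  shows "a \<odot>\<^bsub>sym_power R M (Suc i)\<^esub> Z = \<zero> \<odot>\<^bsub>sym_power R M (Suc i)\<^esub> Z"
proof -
  interpret F: module R "free_tuples R M (Suc i)" by (rule free_tuples_module)
  interpret S: module R "sym_power R M (Suc i)"
    unfolding sym_power_def by (rule F.quot_module_module[OF sym_rels_submodule])
  let ?Q = "\<lambda>f. sym_rels R M (Suc i) +>\<^bsub>free_tuples R M (Suc i)\<^esub> f"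
  have Q: "linear R (free_tuples R M (Suc i)) (sym_power R M (Suc i)) ?Q"
    unfolding sym_power_def by (rule F.quot_coset_linear[OF sym_rels_submodule])
  have smult: "linear R (sym_power R M (Suc i)) (sym_power R M (Suc i)) (\<lambda>Z. c \<odot>\<^bsub>sym_power R M (Suc i)\<^esub> Z)" if "c \<in> carrier R" for c
    unfolding linear_def using that by (simp add: S.smult_r_distr R.m_comm flip: S.smult_assoc1)
  have gens: "multilinear_rels R M (Suc i) \<union>
      {unit_vec R xs \<ominus>\<^bsub>free_tuples R M (Suc i)\<^esub> unit_vec R ys | xs ys. xs \<in> tuples M (Suc i) \<and> mset ys = mset xs}
    \<subseteq> sym_rels R M (Suc i)" unfolding sym_rels_def by (rule span_module_superset)
  have ml: "multilinear R M (sym_power R M (Suc i)) (Suc i) (\<lambda>xs. ?Q (unit_vec R xs))"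
    unfolding sym_power_def by (intro multilinear_coset sym_rels_submodule Un_upper1[THEN subset_trans, OF gens])
  obtain f where f: "f \<in> carrier (free_tuples R M (Suc i))" "Z = ?Q f"
    using Z unfolding sym_power_def F.quot_carrier by blast
  show ?thesis
    unfolding f(2)
  proof (rule linear_free_ext[OF S.module_axioms linear_comp[OF Q smult[OF a]] linear_comp[OF Q smult[OF R.zero_closed]] _ f(1)])
    fix xs assume xs: "xs \<in> tuples M (Suc i)"
    then obtain x ys where e: "xs = [] @ x # ys" by (cases xs) (auto simp: tuples_iff)
    have x: "x \<in> carrier M" using xs e by (auto simp: tuples_iff)
    show "a \<odot>\<^bsub>sym_power R M (Suc i)\<^esub> ?Q (unit_vec R xs) = \<zero> \<odot>\<^bsub>sym_power R M (Suc i)\<^esub> ?Q (unit_vec R xs)"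
      using multilinearD(3)[OF ml a, of "[]" x ys] multilinearD(3)[OF ml R.zero_closed, of "[]" x ys] xs
      unfolding e kill[OF x] by metis
  qed
qed

lemma (in cring) ideal_submodule: assumes "ideal I R" shows "submodule I R (self_module R)"
proof -
  interpret S: module R "self_module R" by (rule self_module_module)
  interpret I: ideal I R by fact
  have m: "\<ominus>\<^bsub>self_module R\<^esub> x = \<ominus> x" if "x \<in> carrier R" for x
    using S.minus_equality[of "\<ominus> x" x] that by (simp add: self_module_def l_neg)
  show ?thesis
  proof (rule S.submoduleI)
    show "\<ominus>\<^bsub>self_module R\<^esub> x \<in> I" if "x \<in> I" for x
      unfolding m[OF I.a_Hcarr[OF that]] by (rule I.a_inv_closed[OF that])
  qed (use I.a_subset I.I_l_closed in \<open>auto simp: self_module_def\<close>)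
qed

lemma (in cring) submodule_ideal: assumes "submodule I R (self_module R)" shows "ideal I R"
proof -
  interpret S: module R "self_module R" by (rule self_module_module)
  note D = S.submoduleD[OF assms]
  have c: "x \<in> carrier R" if "x \<in> I" for x using D(2)[OF that] by (simp add: self_module_def)
  have m: "\<ominus>\<^bsub>self_module R\<^esub> x = \<ominus> x" if "x \<in> carrier R" for x
    using S.minus_equality[of "\<ominus> x" x] that by (simp add: self_module_def l_neg)
  show ?thesis
  proof (rule idealI[OF ring_axioms])
    show "subgroup I (add_monoid R)"
    proof (rule add.subgroupI)
      show "I \<subseteq> carrier R" using c by blast
      show "I \<noteq> {}" using D(1) by blast
      show "\<ominus> x \<in> I" if "x \<in> I" for x using D(5)[OF that] m c that by simp
      show "x \<oplus> y \<in> I" if "x \<in> I" "y \<in> I" for x y using D(3)[OF that] by (simp add: self_module_def)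
    qed
    fix a x assume a: "a \<in> I" and x: "x \<in> carrier R"
    show "x \<otimes> a \<in> I" using D(4)[OF x a] by (simp add: self_module_def)
    then show "a \<otimes> x \<in> I" using m_comm[OF x c[OF a]] by simp
  qed
qed
section \<open>The homology in degree \<open>r - h\<close>\<close>

theorem mainTheorem2:
  fixes R :: "('a, 'p) ring_scheme"
    and F :: "('a, 'f, 'q) module_scheme"
    and G :: "('a, 'g, 's) module_scheme"
    and m n r h :: nat
    and bF :: "nat \<Rightarrow> 'f" and bG :: "nat \<Rightarrow> 'g"
    and \<psi> :: "'g \<Rightarrow> 'f"
    and M :: "('a, ('g \<Rightarrow> 'a) set) module"
    and C :: "('a, 'f set) module"
    and I\<^sub>M :: "'a set"
    and \<chi> :: "('g \<Rightarrow> 'a) set \<Rightarrow> 'a"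
  assumes "cring R" and "noetherian_ring R"
    and "module R F" and "is_basis R F m bF"
    and "module R G" and "is_basis R G n bG"
    and "\<psi> \<in> linear_maps R G F"
    and "inj_on (dual_map R G F \<psi>) (carrier (dual_module R F))"
    and "M = coker_module (dual_module R F) (dual_module R G) (dual_map R G F \<psi>)"
    and "r = n - m"
    and "C = coker_module G F \<psi>"
    and "I\<^sub>M = minors_ideal R m n m (\<lambda>i j. coords R F m bF (\<psi> (bG j)) i)"
    and "grade R I\<^sub>M = enat (r + 1)"
    and "\<chi> \<in> linear_maps R M (self_module R)"
    and "grade R (\<chi> ` carrier M) = enat h"
    and "enat h < grade R I\<^sub>M"
  shows "carrier (trunc_koszul_homology R M \<chi> r (r - h)) \<noteq> {\<zero>\<^bsub>trunc_koszul_homology R M \<chi> r (r - h)\<^esub>}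
    \<and> \<not> module_isomorphic R (trunc_koszul_homology R M \<chi> r (r - h)) (quot_module (self_module R) I\<^sub>M)
    \<and> (\<forall>j\<ge>1. \<not> module_isomorphic R (trunc_koszul_homology R M \<chi> r (r - h)) (sym_power R C j))"
proof -
  interpret R: cring R by fact
  interpret PC: presented_cokernel R F m bF G n bG \<psi> \<chi>
  proof (intro presented_cokernel.intro based_module.intro based_module_axioms.intro presented_cokernel_axioms.intro)
    show "linear R G F \<psi>" by (rule linear_mapsD[OF assms(7)])
    show "linear R (coker_module (dual_module R F) (dual_module R G) (dual_map R G F \<psi>)) (self_module R) \<chi>"
      using linear_mapsD[OF assms(14)] unfolding assms(9) .
  qed (rule assms)+
  note M = assms(9)
  define J where "J = \<chi> ` carrier M"
  have J: "ideal J R"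
    unfolding J_def M
    by (rule R.submodule_ideal[OF linear_image_submodule[OF PC.M_module R.self_module_module PC.chi]])
  define D where "D = {leibniz_det R m (\<lambda>i j. PC.A (\<rho> i) (\<sigma> j)) | \<rho> \<sigma>.
     strict_mono_on {..<m} \<rho> \<and> \<rho> ` {..<m} \<subseteq> {..<m} \<and>
     strict_mono_on {..<m} \<sigma> \<and> \<sigma> ` {..<m} \<subseteq> {..<n}}"
  have ID: "I\<^sub>M = Idl\<^bsub>R\<^esub> D" unfolding assms(12) minors_ideal_def D_def PC.A_def ..
  have D: "D \<subseteq> carrier R"
  proof
    fix x assume "x \<in> D"
    then obtain \<rho> \<sigma> where "x = leibniz_det R m (\<lambda>i j. PC.A (\<rho> i) (\<sigma> j))"
      "strict_mono_on {..<m} \<rho>" "\<rho> ` {..<m} \<subseteq> {..<m}" "strict_mono_on {..<m} \<sigma>" "\<sigma> ` {..<m} \<subseteq> {..<n}"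
      unfolding D_def by blast
    then show "x \<in> carrier R" by (metis PC.minor_splitting R.ev_simps(1))
  qed
  have hr: "h \<le> r" using assms(13,16) by simp
  have gJ: "grade R J = enat h" using assms(15) by (simp add: J_def)
  obtain xs z where xs: "length xs = h" "R.ev ` set xs \<subseteq> J" "regular_mod R.ker xs"
    and z: "z \<notin> add_gens R.ker xs" "\<And>b. R.ev b \<in> J \<Longrightarrow> b * z \<in> add_gens R.ker xs"
    by (rule R.maximal_regular_sequence_annihilator[OF assms(2) J gJ]) blast
  have gI: "grade R (Idl\<^bsub>R\<^esub> D) = enat (r + 1)" using assms(13) unfolding ID .
  obtain d1 where d1: "R.ev d1 \<in> D" "\<And>N. d1 ^ N * z \<notin> add_gens R.ker xs"
    by (rule R.large_grade_nonnilpotent_generator[OF D gI _ xs(3) z(1)]) (use hr xs(1) in auto)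
  obtain \<rho> \<sigma> where \<rho>\<sigma>: "R.ev d1 = leibniz_det R m (\<lambda>i j. PC.A (\<rho> i) (\<sigma> j))"
    "strict_mono_on {..<m} \<rho>" "\<rho> ` {..<m} \<subseteq> {..<m}" "strict_mono_on {..<m} \<sigma>" "\<sigma> ` {..<m} \<subseteq> {..<n}"
    using d1(1) unfolding D_def by blast
  obtain d e p where d: "R.ev d = R.ev d1" and split: "split_form R M \<chi> d r e p"
    using PC.minor_splitting[OF \<rho>\<sigma>(2-5)] unfolding \<rho>\<sigma>(1) M assms(10) by metis
  interpret S: split_form R M \<chi> d r e p by (rule split)
  define H where "H = trunc_koszul_homology R M \<chi> r (r - h)"
  \<comment> \<open>All three claims follow from this, because the modules to be excluded, \<open>0\<close> included, are killed by \<open>d\<close>.\<close>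
  have not_killed: "\<exists>Y\<in>carrier H. R.ev d \<odot>\<^bsub>H\<^esub> Y \<noteq> \<zero>\<^bsub>R\<^esub> \<odot>\<^bsub>H\<^esub> Y"
  proof (rule ccontr)
    assume "\<not> ?thesis"
    then have "torsion_homology d r S.a R.ker (r - length xs)"
      unfolding xs(1) H_def by (intro S.killed_homology_imp_torsion) auto
    moreover have "\<not> torsion_homology d r S.a R.ker (r - length xs)"
    proof (rule koszul_nontorsion[OF R.ker_ideal xs(3)])
      fix x assume "x \<in> set xs"
      then obtain y where y: "y \<in> carrier M" "R.ev x = \<chi> y" using xs(2) unfolding J_def by blast
      have "R.ev (\<Sum>t<r. S.u y t * S.a t) = (\<Oplus>\<^bsub>R\<^esub>t\<in>{..<r}. p t y \<otimes>\<^bsub>R\<^esub> \<chi> (e t))"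
        unfolding R.ev_sum
        by (rule R.finsum_cong') (use y in \<open>auto simp: S.ev_u S.ev_a S.p_simps S.form_simps S.e_closed\<close>)
      then have "d * x - (\<Sum>t<r. S.u y t * S.a t) \<in> R.ker"
        unfolding R.ker_diff_iff using S.p_form[OF y(1)] y(2) by simp
      then show "\<exists>u. d * x - (\<Sum>t<r. u t * S.a t) \<in> R.ker" by blast
    next
      fix t assume "t < r"
      then have "R.ev (S.a t) \<in> J" using S.e_closed[of t] by (simp add: S.ev_a J_def)
      then show "z * S.a t \<in> add_gens R.ker xs" using z(2)[of "S.a t"] by (simp add: mult.commute)
    next
      fix N show "d ^ N * z \<notin> add_gens R.ker xs"
        using d1(2)[of N] R.ev_power_cong[OF d, of N z] unfolding R.add_gens_ker_iff by simp
    qed (use xs(1) hr in simp)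
    ultimately show False by blast
  qed
  have closed: "a \<odot>\<^bsub>H\<^esub> Y \<in> carrier H" if "a \<in> carrier R" "Y \<in> carrier H" for a Y
    using S.homology_smult_closed that unfolding H_def by blast
  have not_iso: "\<not> module_isomorphic R H Q"
    if "\<And>Z. Z \<in> carrier Q \<Longrightarrow> R.ev d \<odot>\<^bsub>Q\<^esub> Z = \<zero>\<^bsub>R\<^esub> \<odot>\<^bsub>Q\<^esub> Z" for Q :: "('a, 'y, 'z) module_scheme"
    using module_isomorphic_killed[OF _ R.ev_simps(1) R.zero_closed closed that] not_killed by blast
  have "carrier H \<noteq> {\<zero>\<^bsub>H\<^esub>}"
    using not_killed closed[OF R.ev_simps(1)] closed[OF R.zero_closed] by (metis singletonD)
  moreover have "\<not> module_isomorphic R H (quot_module (self_module R) I\<^sub>M)"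
  proof (rule not_iso, rule module.quot_killed[OF R.self_module_module])
    have I: "ideal I\<^sub>M R" unfolding ID by (rule R.genideal_ideal[OF D])
    show "submodule I\<^sub>M R (self_module R)" by (rule R.ideal_submodule[OF I])
    have "R.ev d \<in> I\<^sub>M" using R.genideal_self[OF D] d1(1) unfolding ID d by blast
    then show "R.ev d \<odot>\<^bsub>self_module R\<^esub> x \<in> I\<^sub>M" if "x \<in> carrier (self_module R)" for x
      using ideal.I_r_closed[OF I] that by (simp add: self_module_def)
  qed auto
  moreover have "\<not> module_isomorphic R H (sym_power R C j)" if "1 \<le> j" for j
  proof (rule not_iso)
    fix Z assume Z: "Z \<in> carrier (sym_power R C j)"
    have im: "submodule (\<psi> ` carrier G) R F"
      by (rule linear_image_submodule[OF assms(5,3) PC.psi])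
    have "module R C" unfolding assms(11) coker_module_def by (rule PC.F.quot_module_module[OF im])
    moreover have "R.ev d \<odot>\<^bsub>C\<^esub> x = \<zero>\<^bsub>R\<^esub> \<odot>\<^bsub>C\<^esub> x" if "x \<in> carrier C" for x
      unfolding assms(11) coker_module_def
      by (rule PC.F.quot_killed[OF im])
        (use that PC.minor_kills_cokernel[OF \<rho>\<sigma>(2-5)] in \<open>simp_all add: d \<rho>\<sigma>(1)[symmetric] assms(11) coker_module_def\<close>)
    moreover obtain i where "j = Suc i" using \<open>1 \<le> j\<close> by (cases j) auto
    ultimately show "R.ev d \<odot>\<^bsub>sym_power R C j\<^esub> Z = \<zero>\<^bsub>R\<^esub> \<odot>\<^bsub>sym_power R C j\<^esub> Z"
      using module.sym_power_killed[of R C "R.ev d" Z i] Z by simp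
  qed
  ultimately show ?thesis unfolding H_def by blast
qed

end
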